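(* Consider the three-dimensional planar isentropic MHD system in Lagrangian coordinates $$\partial_t v-\partial_x u_1=0,\quad \partial_t(vB_i)-\beta\,\partial_x u_i=0\ (i=2,3),\quad \partial_t u_1+\partial_x\big(p(v)+\tfrac12(B_2^2+B_3^2)\big)=0,\quad \partial_t u_i-\beta\,\partial_x B_i=0\ (i=2,3),$$ where $\beta\neq 0$ is a constant and $p(v)=v^{-\gamma}$ with $\gamma>1$, $v>0$. (i) Let $(U_l,U_r,\sigma_3)$ be a 3-shock wave of this system such that, for each $i=2,3$, the pair $(B_{i,l},B_{i,r})$ satisfies one of $$B_{i,l}>B_{i,r}\ge 0,\qquad B_{i,l}<B_{i,r}\le 0,\qquad B_{i,l}=B_{i,r}=0 .$$ Then there is no weight $a>0$ such that $(U_l,U_r,\sigma_3)$ satisfies contraction with weight $a$; that is, for every $a>0$, $(U_l,U_r,\sigma_3)$ does not satisfy contraction with weight $a$. (ii) Let $(\tilde U_l,\tilde U_r,\sigma_4)$ be a 4-shock wave of this system such that, for each $i=2,3$, the pair $(\tilde B_{i,l},\tilde B_{i,r})$ satisfies one of $$\tilde B_{i,r}>\tilde B_{i,l}\ge 0,\qquad \tilde B_{i,r}<\tilde B_{i,l}\le 0,\qquad \tilde B_{i,l}=\tilde B_{i,r}=0 .$$ Then there is no weight $a>0$ such that $(\tilde U_l,\tilde U_r,\sigma_4)$ satisfies contraction with weight $a$.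
   Context: Variables. The conservative variables are $U=(v,q_2,q_3,u_1,u_2,u_3)$ with $v>0$ (non-vacuum) and $q_i=vB_i$ for $i=2,3$. In these variables the system is $\partial_tU+\partial_xf(U)=0$ with $f(U)=\big(-u_1,-\beta u_2,-\beta u_3,\ p(v)+\tfrac{q_2^2+q_3^2}{2v^2},\ -\beta\tfrac{q_2}{v},\ -\beta\tfrac{q_3}{v}\big)$. For states $U_l,U_r$, the subscripts $l,r$ denote their components, and $B_{i,l}=q_{i,l}/v_l$, $B_{i,r}=q_{i,r}/v_r$ (similarly with tildes). Entropy. The strictly convex entropy is $\eta(U)=\int_v^\infty p(s)\,ds+\tfrac12(u_1^2+u_2^2+u_3^2)+\tfrac1{2v}(q_2^2+q_3^2)$, with entropy flux $G(U)=\big(p+\tfrac{q_2^2+q_3^2}{2v^2}\big)u_1-\tfrac{\beta}{v}(q_2u_2+q_3u_3)$. The relative entropy is $\eta(U|V)=\eta(U)-\eta(V)-\nabla\eta(V)\cdot(U-V)$. An entropy solution is a weak solution with $\partial_t\eta(U)+\partial_xG(U)\le 0$ in the sense of distributions. Characteristic fields. With $|B|^2=B_2^2+B_3^2$, $c^2=-p'(v)$ and $$\alpha_\pm=\tfrac12\Big[\tfrac{|B|^2+\beta^2}{v}+c^2\pm\sqrt{\big(\tfrac{|B|^2+\beta^2}{v}+c^2\big)^2-4\beta^2\tfrac{c^2}{v}}\Big],$$ the eigenvalues of the system are $\lambda_1=-\sqrt{\alpha_+}$, $\lambda_2=-\beta/\sqrt v$, $\lambda_3=-\sqrt{\alpha_-}$,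 $\lambda_4=\sqrt{\alpha_-}$, $\lambda_5=\beta/\sqrt v$, $\lambda_6=\sqrt{\alpha_+}$. Shocks. For $i=3,4$, an $i$-shock wave $(U_l,U_r,\sigma_i)$ is an entropic discontinuity ($U_l\ne U_r$) of the $i$-th family with left state $U_l$, right state $U_r$ and speed $\sigma_i$: it satisfies the Rankine–Hugoniot condition $f(U_r)-f(U_l)=\sigma_i(U_r-U_l)$, the entropy inequality $G(U_r)-G(U_l)\le\sigma_i(\eta(U_r)-\eta(U_l))$, and the Liu and Lax entropy conditions for the $i$-th family (in particular $\lambda_i(U_r)<\sigma_i<\lambda_i(U_l)$). Contraction. For a discontinuity $(U_l,U_r,\sigma)$ put $S(t,x)=U_l$ if $x<\sigma t$ and $S(t,x)=U_r$ if $x>\sigma t$. For a weight $a>0$ define the pseudo-distance $$d_a(U(t,x),S(t,x))=\begin{cases}\eta(U(t,x)|U_l)& x<\sigma t,\\ a\,\eta(U(t,x)|U_r)& x>\sigma t.\end{cases}$$ Contraction with weight $a$ refers to the property that, up to a suitable Lipschitz shift $\alpha(t)$ with $\alpha(0)=0$ (depending on the solution), $\int_{-\infty}^\infty d_a(U(t,x+\alpha(t)),S(t,x))\,dx$ is non-increasing in time for bounded entropy solutions $U$. Precisely, "$(U_l,U_r,\sigma)$ does not satisfy contraction with weight $a$" means: for any Lipschitz curve $\alpha(t)$ with $\alpha(0)=0$, there are some (possibly only local in time) entropy solution $\bar U$ and a small constant $T_0>0$ such that for all $0<t<T_0$, $$\int_{-\infty}^{\infty} d_a(\bar U(t,x+\alpha(t)),S(t,x))\,dx>\int_{-\infty}^{\infty}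 d_a(\bar U(0,x),S(0,x))\,dx .$$ *)

theory Defs
  imports "HOL-Analysis.Analysis"
begin

(* A state is U = (v, q2, q3, u1, u2, u3) with q_i = v B_i. *)
type_synonym state = "real \<times> real \<times> real \<times> real \<times> real \<times> real"

definition states :: "state set" where
  "states = {U. 0 < fst U}"

fun B2 :: "state \<Rightarrow> real" where
  "B2 (v, q2, q3, u1, u2, u3) = q2 / v"

fun B3 :: "state \<Rightarrow> real" where
  "B3 (v, q2, q3, u1, u2, u3) = q3 / v"

definition pressure :: "real \<Rightarrow> real \<Rightarrow> real" where
  "pressure \<gamma> v = v powr (- \<gamma>)"

fun flux :: "real \<Rightarrow> real \<Rightarrow> state \<Rightarrow> state" where
  "flux \<beta> \<gamma> (v, q2, q3, u1, u2, u3) =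
     (- u1, - \<beta> * u2, - \<beta> * u3,
      pressure \<gamma> v + (q2\<^sup>2 + q3\<^sup>2) / (2 * v\<^sup>2), - \<beta> * (q2 / v), - \<beta> * (q3 / v))"

fun eta :: "real \<Rightarrow> state \<Rightarrow> real" where
  "eta \<gamma> (v, q2, q3, u1, u2, u3) =
     integral {v..} (pressure \<gamma>) + (u1\<^sup>2 + u2\<^sup>2 + u3\<^sup>2) / 2 + (q2\<^sup>2 + q3\<^sup>2) / (2 * v)"

fun entropy_flux :: "real \<Rightarrow> real \<Rightarrow> state \<Rightarrow> real" where
  "entropy_flux \<beta> \<gamma> (v, q2, q3, u1, u2, u3) =
     (pressure \<gamma> v + (q2\<^sup>2 + q3\<^sup>2) / (2 * v\<^sup>2)) * u1 - \<beta> / v * (q2 * u2 + q3 * u3)"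

(* The derivative of eta at V, applied to U - V, is the term grad eta(V) . (U - V). *)
definition rel_entropy :: "real \<Rightarrow> state \<Rightarrow> state \<Rightarrow> real" where
  "rel_entropy \<gamma> U V =
     eta \<gamma> U - eta \<gamma> V - frechet_derivative (eta \<gamma>) (at V) (U - V)"


definition sound2 :: "real \<Rightarrow> real \<Rightarrow> real" where
  "sound2 \<gamma> v = - deriv (pressure \<gamma>) v"

(* alpha_pm is the case e = 1 (plus) or e = -1 (minus). *)
definition alpha :: "real \<Rightarrow> real \<Rightarrow> real \<Rightarrow> state \<Rightarrow> real" where
  "alpha e \<beta> \<gamma> U =
     (let v = fst U;
          m = ((B2 U)\<^sup>2 + (B3 U)\<^sup>2 + \<beta>\<^sup>2) / v + sound2 \<gamma> v
      in (m + e * sqrt (m\<^sup>2 - 4 * \<beta>\<^sup>2 * (sound2 \<gamma> v / v))) / 2)"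

definition eigenvalue :: "real \<Rightarrow> real \<Rightarrow> nat \<Rightarrow> state \<Rightarrow> real" where
  "eigenvalue \<beta> \<gamma> i U =
     [- sqrt (alpha 1 \<beta> \<gamma> U), - \<beta> / sqrt (fst U), - sqrt (alpha (-1) \<beta> \<gamma> U),
      sqrt (alpha (-1) \<beta> \<gamma> U), \<beta> / sqrt (fst U), sqrt (alpha 1 \<beta> \<gamma> U)] ! (i - 1)"


definition rankine_hugoniot :: "real \<Rightarrow> real \<Rightarrow> state \<Rightarrow> state \<Rightarrow> real \<Rightarrow> bool" where
  "rankine_hugoniot \<beta> \<gamma> Ul Ur \<sigma> \<longleftrightarrow>
     flux \<beta> \<gamma> Ur - flux \<beta> \<gamma> Ul = \<sigma> *\<^sub>R (Ur - Ul)"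

(* The inequalities comparing sigma with the neighbouring characteristic speeds are not imposed:
   switch-off shocks satisfy them only with equality. *)
definition lax_condition :: "real \<Rightarrow> real \<Rightarrow> nat \<Rightarrow> state \<Rightarrow> state \<Rightarrow> real \<Rightarrow> bool" where
  "lax_condition \<beta> \<gamma> i Ul Ur \<sigma> \<longleftrightarrow>
     eigenvalue \<beta> \<gamma> i Ur < \<sigma> \<and> \<sigma> < eigenvalue \<beta> \<gamma> i Ul"

(* Liu's condition: Ur is reached from Ul along the i-th Hugoniot curve W, with speeds s
   starting at the i-th eigenvalue, and no intermediate shock (Ul, W xi) is slower than
   (Ul, Ur).  W is only required to be continuous, since the Hugoniot curves have corners
   at states where the tangential magnetic field is switched on or off. *)
definition liu_condition :: "real \<Rightarrow> real \<Rightarrow> nat \<Rightarrow> state \<Rightarrow> state \<Rightarrow> real \<Rightarrow> bool" where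
  "liu_condition \<beta> \<gamma> i Ul Ur \<sigma> \<longleftrightarrow>
     (\<exists>(W :: real \<Rightarrow> state) (s :: real \<Rightarrow> real) r. 0 < r
        \<and> continuous_on {0..r} W \<and> continuous_on {0..r} s
        \<and> W 0 = Ul \<and> s 0 = eigenvalue \<beta> \<gamma> i Ul \<and> W r = Ur \<and> s r = \<sigma>
        \<and> (\<forall>\<xi>\<in>{0<..r}. W \<xi> \<in> states \<and> W \<xi> \<noteq> Ul
             \<and> rankine_hugoniot \<beta> \<gamma> Ul (W \<xi>) (s \<xi>) \<and> \<sigma> \<le> s \<xi>))"

definition shock_wave :: "real \<Rightarrow> real \<Rightarrow> nat \<Rightarrow> state \<Rightarrow> state \<Rightarrow> real \<Rightarrow> bool" where
  "shock_wave \<beta> \<gamma> i Ul Ur \<sigma> \<longleftrightarrow>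
     Ul \<in> states \<and> Ur \<in> states \<and> Ul \<noteq> Ur
     \<and> rankine_hugoniot \<beta> \<gamma> Ul Ur \<sigma>
     \<and> entropy_flux \<beta> \<gamma> Ur - entropy_flux \<beta> \<gamma> Ul \<le> \<sigma> * (eta \<gamma> Ur - eta \<gamma> Ul)
     \<and> lax_condition \<beta> \<gamma> i Ul Ur \<sigma>
     \<and> liu_condition \<beta> \<gamma> i Ul Ur \<sigma>"


definition dt :: "(real \<times> real \<Rightarrow> real) \<Rightarrow> real \<times> real \<Rightarrow> real" where
  "dt \<phi> z = frechet_derivative \<phi> (at z) (1, 0)"

definition dx :: "(real \<times> real \<Rightarrow> real) \<Rightarrow> real \<times> real \<Rightarrow> real" where
  "dx \<phi> z = frechet_derivative \<phi> (at z) (0, 1)"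

primrec C_k :: "nat \<Rightarrow> (real \<times> real \<Rightarrow> real) \<Rightarrow> bool" where
  "C_k 0 \<phi> \<longleftrightarrow> continuous_on UNIV \<phi>"
| "C_k (Suc k) \<phi> \<longleftrightarrow> (\<forall>z. \<phi> differentiable at z) \<and> C_k k (dt \<phi>) \<and> C_k k (dx \<phi>)"

(* Smooth, compactly supported in t < T; the values at t = 0 need not vanish. *)
definition test_function :: "real \<Rightarrow> (real \<times> real \<Rightarrow> real) \<Rightarrow> bool" where
  "test_function T \<phi> \<longleftrightarrow>
     (\<forall>k. C_k k \<phi>) \<and> compact (closure {z. \<phi> z \<noteq> 0})
     \<and> closure {z. \<phi> z \<noteq> 0} \<subseteq> {..<T} \<times> UNIV"

definition locally_integrable_on ::
  "('a::euclidean_space \<Rightarrow> 'b::euclidean_space) \<Rightarrow> 'a set \<Rightarrow> bool" where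
  "locally_integrable_on h D \<longleftrightarrow> (\<forall>K. compact K \<and> K \<subseteq> D \<longrightarrow> set_integrable lborel K h)"

(* Bounded weak solution on [0,T) x R with initial datum U 0.  As the contraction functional
   evaluates U at every single time, U is the representative for which t |-> U t is weak-*
   continuous into L^infinity; every bounded weak solution has such a representative. *)
definition weak_solution :: "real \<Rightarrow> real \<Rightarrow> real \<Rightarrow> (real \<Rightarrow> real \<Rightarrow> state) \<Rightarrow> bool" where
  "weak_solution \<beta> \<gamma> T U \<longleftrightarrow>
     (\<forall>t\<in>{0..<T}. \<forall>x. U t x \<in> states)
     \<and> bounded {U t x | t x. t \<in> {0..<T}}
     \<and> set_borel_measurable borel ({0..<T} \<times> UNIV) (\<lambda>(t, x). U t x)
     \<and> (\<forall>\<psi>::real \<Rightarrow> real. integrable lborel \<psi> \<longrightarrow>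
           continuous_on {0..<T} (\<lambda>t. LINT x|lborel. \<psi> x *\<^sub>R U t x))
     \<and> locally_integrable_on (\<lambda>(t, x). flux \<beta> \<gamma> (U t x)) ({0..<T} \<times> UNIV)
     \<and> (\<forall>\<phi>. test_function T \<phi> \<longrightarrow>
           (LINT (t, x):{0..<T} \<times> UNIV|lborel.
               dt \<phi> (t, x) *\<^sub>R U t x + dx \<phi> (t, x) *\<^sub>R flux \<beta> \<gamma> (U t x))
           + (LINT x|lborel. \<phi> (0, x) *\<^sub>R U 0 x) = 0)"

definition entropy_solution :: "real \<Rightarrow> real \<Rightarrow> real \<Rightarrow> (real \<Rightarrow> real \<Rightarrow> state) \<Rightarrow> bool" where
  "entropy_solution \<beta> \<gamma> T U \<longleftrightarrow>
     weak_solution \<beta> \<gamma> T U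
     \<and> locally_integrable_on (\<lambda>(t, x). eta \<gamma> (U t x)) ({0..<T} \<times> UNIV)
     \<and> locally_integrable_on (\<lambda>(t, x). entropy_flux \<beta> \<gamma> (U t x)) ({0..<T} \<times> UNIV)
     \<and> locally_integrable_on (\<lambda>x. eta \<gamma> (U 0 x)) UNIV
     \<and> (\<forall>\<phi>. test_function T \<phi> \<and> (\<forall>z. 0 \<le> \<phi> z) \<longrightarrow>
           (LINT (t, x):{0..<T} \<times> UNIV|lborel.
               dt \<phi> (t, x) * eta \<gamma> (U t x) + dx \<phi> (t, x) * entropy_flux \<beta> \<gamma> (U t x))
           + (LINT x|lborel. \<phi> (0, x) * eta \<gamma> (U 0 x)) \<ge> 0)"


(* d_a(W, S(t,x)) for the discontinuity S = (Ul, Ur, sigma); the value on the null set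
   x = sigma t is irrelevant. *)
definition pseudo_dist ::
  "real \<Rightarrow> real \<Rightarrow> state \<Rightarrow> state \<Rightarrow> real \<Rightarrow> real \<Rightarrow> real \<Rightarrow> state \<Rightarrow> real" where
  "pseudo_dist \<gamma> a Ul Ur \<sigma> t x W =
     (if x < \<sigma> * t then rel_entropy \<gamma> W Ul else a * rel_entropy \<gamma> W Ur)"

(* The integrand is nonnegative by convexity of eta, so the integral lies in [0, infinity]. *)
definition total_dist ::
  "real \<Rightarrow> real \<Rightarrow> state \<Rightarrow> state \<Rightarrow> real \<Rightarrow> real \<Rightarrow> (real \<Rightarrow> state) \<Rightarrow> ennreal" where
  "total_dist \<gamma> a Ul Ur \<sigma> t W =
     (\<integral>\<^sup>+ x. ennreal (pseudo_dist \<gamma> a Ul Ur \<sigma> t x (W x)) \<partial>lborel)"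

definition fails_contraction ::
  "real \<Rightarrow> real \<Rightarrow> real \<Rightarrow> state \<Rightarrow> state \<Rightarrow> real \<Rightarrow> bool" where
  "fails_contraction \<beta> \<gamma> a Ul Ur \<sigma> \<longleftrightarrow>
     (\<forall>(\<alpha> :: real \<Rightarrow> real) L. L-lipschitz_on {0..} \<alpha> \<and> \<alpha> 0 = 0 \<longrightarrow>
        (\<exists>U T T0. entropy_solution \<beta> \<gamma> T U \<and> 0 < T0 \<and> T0 \<le> T
           \<and> (\<forall>t. 0 < t \<and> t < T0 \<longrightarrow>
                total_dist \<gamma> a Ul Ur \<sigma> t (\<lambda>x. U t (x + \<alpha> t)) > total_dist \<gamma> a Ul Ur \<sigma> 0 (U 0))))"

end

theory Submission
  imports Defs
begin

text \<open>
  The initial datum consists of a profile joining Ul to some state U, an entropic jump from U to V of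
  speed s, and a profile joining V to Ur.  The profiles are built from shocks,
  Alfven discontinuities and smooth gas-dynamic simple waves, so the entropy they dissipate is
  explicit, and the entropy balance expresses the growth rate of the relative entropy through the
  end states and that dissipation alone.  If a times the relative entropy to Ur is at least the one to
  Ul at U and at most the one to Ul at V, the position of the shift is irrelevant, and the pseudo-distance
  grows for every shift as soon as one explicit number is positive.

  For a slow shock with tangential field on both sides, U and V are the end states with the field
  rotated by a small angle and a tangential velocity chosen such that the left contribution vanishes;
  the right one is positive.  If the field vanishes on both sides and the front state is
  sub-Alfvenic, a small field of amplitude y is switched on in U and V, with a gain of order
  y^2 against a cost o(y^2).  In the remaining cases the shock splits into two entropic shocks of
  equal (or nearly equal) speeds; changing the speed of one of them gains to first order what it costs
  to second order.  Reflection in x turns 4-shocks into 3-shocks.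
\<close>

text \<open>The bad solution may depend on the shift, but one datum defeats all shifts at once; only
  the time \<open>T0\<close> depends on the Lipschitz constant. The real obstacle is the arbitrary
  weight \<open>a\<close>: one side's contribution must be zero or negligible while the other is
  positive, so that no balance between the two sides is needed. Rotation achieves this because
  Alfven discontinuities dissipate nothing and, repeated, produce every tangential velocity; the end
  states can therefore be left along free profiles. This freedom is lost where the tangential field
  vanishes, and a small field can then be removed only by a switch-off shock. Its dissipation is
  bounded by a constant times the field energy times a volume change \<open>r\<close>, and
  \<open>r\<close> may be fixed before the amplitude tends to zero; this makes the cost small
  against the gain. Splitting works at a volume whose Alfven speed equals the shock speed: there the
  tangential jump relations degenerate, so the field can be reversed, switched on or switched off
  without changing the speed. Slowing the second wave opens a growing region of the intermediate
  state, which is charged by either part of the pseudo-distance.\<close>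

text \<open>The second and third arguments are the magnetic field B, not q = v B.\<close>

definition mk :: "real \<Rightarrow> real \<Rightarrow> real \<Rightarrow> real \<Rightarrow> real \<Rightarrow> real \<Rightarrow> state" where
  "mk v b2 b3 u w2 w3 = (v, v * b2, v * b3, u, w2, w3)"

lemma mk_in_states [simp]: "mk v b2 b3 u w2 w3 \<in> states \<longleftrightarrow> 0 < v"
  by (simp add: mk_def states_def)

lemma mk_cases:
  assumes "U \<in> states"
  obtains v b2 b3 u w2 w3 where "U = mk v b2 b3 u w2 w3" "0 < v" "B2 U = b2" "B3 U = b3"
proof -
  obtain v q2 q3 u w2 w3 where U: "U = (v, q2, q3, u, w2, w3)" by (cases U) auto
  with assms have "v > 0" by (simp add: states_def)
  with U show thesis by (intro that[of v "q2 / v" "q3 / v" u w2 w3]) (auto simp: mk_def)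
qed

text \<open>The gradient of \<open>eta \<gamma>\<close> in the conservative variables; it turns the
  Frechet derivative in \<open>rel_entropy\<close> into an inner product.\<close>

fun egrad :: "real \<Rightarrow> state \<Rightarrow> state" where
  "egrad \<gamma> (v, q2, q3, u1, u2, u3) =
     (- pressure \<gamma> v - (q2\<^sup>2 + q3\<^sup>2) / (2 * v\<^sup>2), q2 / v, q3 / v, u1, u2, u3)"

locale planar_mhd =
  fixes \<beta> \<gamma> :: real
  assumes beta: "\<beta> \<noteq> 0" and gamma: "\<gamma> > 1"
begin

abbreviation p where "p \<equiv> pressure \<gamma>"

definition csq :: "real \<Rightarrow> real" where "csq v = \<gamma> * v powr (- \<gamma> - 1)"

text \<open>Closed form of the integral of the pressure over \<open>{v..}\<close>, which converges
  because \<gamma> > 1; its derivative is \<open>- p\<close>.\<close>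

definition en :: "real \<Rightarrow> real" where "en v = v powr (1 - \<gamma>) / (\<gamma> - 1)"

text \<open>The Bregman distance of the convex function \<open>en\<close>: the slope of
  \<open>en\<close> at \<open>w\<close> is \<open>- p w\<close>, hence the plus sign in the linear
  part.\<close>

definition Pi :: "real \<Rightarrow> real \<Rightarrow> real" where "Pi v w = en v - en w + p w * (v - w)"

text \<open>The relative entropy flux, companion of \<^const>\<open>rel_entropy\<close>.\<close>

definition qf :: "state \<Rightarrow> state \<Rightarrow> real" where
  "qf U V = entropy_flux \<beta> \<gamma> U - entropy_flux \<beta> \<gamma> V - inner (egrad \<gamma> V) (flux \<beta> \<gamma> U - flux \<beta> \<gamma> V)"

abbreviation rel where "rel \<equiv> rel_entropy \<gamma>"
abbreviation RH where "RH \<equiv> rankine_hugoniot \<beta> \<gamma>"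

text \<open>The rate at which the discontinuity (A, B, s) dissipates entropy: it is entropic if this is nonnegative.\<close>

definition diss :: "state \<Rightarrow> state \<Rightarrow> real \<Rightarrow> real" where
  "diss A B s = s * (eta \<gamma> B - eta \<gamma> A) - (entropy_flux \<beta> \<gamma> B - entropy_flux \<beta> \<gamma> A)"

section \<open>Convexity of the pressure law and of the internal energy\<close>

lemma csq_pos: "v > 0 \<Longrightarrow> csq v > 0"
  using gamma by (simp add: csq_def)

lemma DERIV_p: "v > 0 \<Longrightarrow> (p has_real_derivative - csq v) (at v)"
  unfolding pressure_def[abs_def] csq_def by (auto intro!: derivative_eq_intros)

lemma DERIV_en: "v > 0 \<Longrightarrow> (en has_real_derivative - p v) (at v)"
proof -
  assume v: "v > 0"
  have "(en has_real_derivative ((1 - \<gamma>) * v powr (1 - \<gamma> - 1) / (\<gamma> - 1))) (at v)"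
    unfolding en_def[abs_def] using v gamma by (auto intro!: derivative_eq_intros)
  also have "(1 - \<gamma>) * v powr (1 - \<gamma> - 1) / (\<gamma> - 1) = - p v"
    using gamma by (simp add: pressure_def divide_eq_eq algebra_simps)
  finally show ?thesis .
qed

lemma DERIV_csq: "v > 0 \<Longrightarrow> (csq has_real_derivative - (\<gamma> * (\<gamma> + 1) * v powr (- \<gamma> - 2))) (at v)"
  unfolding csq_def[abs_def] using gamma
  by (auto intro!: derivative_eq_intros simp: field_simps)

lemma sound2_eq: "v > 0 \<Longrightarrow> sound2 \<gamma> v = csq v"
  unfolding sound2_def using DERIV_imp_deriv[OF DERIV_p] by simp

lemma csq_strict_anti:
  assumes "0 < v" "v < w" shows "csq w < csq v"
  using assms gamma by (auto simp: csq_def intro!: powr_less_mono2_neg)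

lemma p_strict_anti:
  assumes "0 < v" "v < w" shows "p w < p v"
  using assms gamma by (auto simp: pressure_def intro!: powr_less_mono2_neg)

text \<open>Strict convexity of \<open>p\<close>: by the mean value theorem the chord slope is
  \<open>- csq z\<close> for an intermediate \<open>z\<close>, and \<open>csq\<close> is strictly
  decreasing.\<close>

lemma tangent_p_less:
  assumes "0 < x" "0 < y" "x \<noteq> y" shows "p x + csq x * (x - y) < p y"
proof (cases "x < y")
  case True
  obtain z where z: "z > x" "z < y" "p y - p x = (y - x) * - csq z"
    using MVT2[OF True, of p "\<lambda>z. - csq z"] DERIV_p assms by (meson less_le_trans)
  have "csq z < csq x" using csq_strict_anti z assms by auto
  hence "(y - x) * csq z < (y - x) * csq x" using True by simp
  with z(3) show ?thesis by (simp add: algebra_simps)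
next
  case False
  with assms have lt: "y < x" by auto
  obtain z where z: "z > y" "z < x" "p x - p y = (x - y) * - csq z"
    using MVT2[OF lt, of p "\<lambda>z. - csq z"] DERIV_p assms by (meson less_le_trans)
  have "csq x < csq z" using csq_strict_anti z assms by auto
  hence "(x - y) * csq x < (x - y) * csq z" using lt by simp
  with z(3) show ?thesis by (simp add: algebra_simps)
qed

lemma tangent_p: "0 < x \<Longrightarrow> 0 < y \<Longrightarrow> p x + csq x * (x - y) \<le> p y"
  using tangent_p_less[of x y] by (cases "x = y") auto

text \<open>The left side is the integral of the convex function \<open>p\<close> over the interval,
  the right side its trapezoid rule. As a function of the right end point the error increases, by
  the tangent inequality at that point.\<close>

lemma trapezoid_less:
  assumes "0 < a" "a < b" shows "en a - en b < (p a + p b) / 2 * (b - a)"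
proof -
  define G where "G x = (p a + p x) / 2 * (x - a) - en a + en x" for x
  have "G a < G b"
  proof (rule DERIV_pos_imp_increasing_open[OF \<open>a < b\<close>])
    show "\<exists>y. (G has_real_derivative y) (at x) \<and> 0 < y" if "a < x" "x < b" for x
    proof (intro exI conjI)
      show "(G has_real_derivative ((p a - p x - csq x * (x - a)) / 2)) (at x)"
        unfolding G_def[abs_def] using that assms
        by (auto intro!: derivative_eq_intros DERIV_p DERIV_en simp: field_simps)
      show "0 < (p a - p x - csq x * (x - a)) / 2"
        using tangent_p_less[of x a] that assms by simp
    qed
    show "continuous_on {a..b} G"
    proof (intro continuous_at_imp_continuous_on ballI)
      fix x assume "x \<in> {a..b}"
      hence "x > 0" using assms by auto
      thus "isCont G x" unfolding G_def[abs_def]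
        using DERIV_isCont[OF DERIV_p] DERIV_isCont[OF DERIV_en] by (intro continuous_intros) auto
    qed
  qed
  thus ?thesis by (simp add: G_def)
qed

text \<open>For a gas shock the momentum balance turns the right side into the kinetic term
  \<open>s\<^sup>2 * (v - v')\<^sup>2 / 2\<close> of \<open>diss_mk\<close>. So this bound and the
  next decide the sign of the dissipation, for compressions with s < 0 and for expansions with s >
  0.\<close>

lemma Pi_gt_trapezoid:
  assumes "0 < b" "b < a" shows "Pi a b > (p b - p a) / 2 * (a - b)"
  using trapezoid_less[OF assms] by (simp add: Pi_def field_simps)

lemma Pi_lt_trapezoid:
  assumes "0 < a" "a < b" shows "Pi a b < (p a - p b) / 2 * (b - a)"
  using trapezoid_less[OF assms] by (simp add: Pi_def field_simps)

lemma en_tangent_less: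
  assumes "0 < x" "0 < y" "x \<noteq> y" shows "en x - p x * (y - x) < en y"
proof (cases "x < y")
  case less: True
  obtain z where z: "z > x" "z < y" "en y - en x = (y - x) * - p z"
    using MVT2[OF less, of en "\<lambda>z. - p z"] DERIV_en assms by (meson less_le_trans)
  have "p z < p x" using p_strict_anti z assms by auto
  hence "(y - x) * p z < (y - x) * p x" using less by simp
  with z(3) show ?thesis by (simp add: algebra_simps)
next
  case False
  with assms have greater: "y < x" by auto
  obtain z where z: "z > y" "z < x" "en x - en y = (x - y) * - p z"
    using MVT2[OF greater, of en "\<lambda>z. - p z"] DERIV_en assms by (meson less_le_trans)
  have "p x < p z" using p_strict_anti z assms by auto
  hence "(x - y) * p x < (x - y) * p z" using greater by simp
  with z(3) show ?thesis by (simp add: algebra_simps)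
qed

lemma Pi_pos: "0 < a \<Longrightarrow> 0 < b \<Longrightarrow> a \<noteq> b \<Longrightarrow> Pi a b > 0"
  using en_tangent_less[of b a] by (simp add: Pi_def algebra_simps)

lemma Pi_nonneg: "0 < a \<Longrightarrow> 0 < b \<Longrightarrow> Pi a b \<ge> 0"
  using Pi_pos[of a b] by (cases "a = b") (auto simp: Pi_def)

lemma Pi_self [simp]: "Pi a a = 0" by (simp add: Pi_def)

text \<open>Second-order Taylor expansion of \<open>en\<close>, whose second derivative
  \<open>csq\<close> decreases, so the error has one sign on each side of \<open>x\<close>. These
  two bounds limit the dissipation of a switch-off shock from above.\<close>

lemma en_quadratic_right:
  assumes "0 < x" "x < y"
  shows "en x - p x * (y - x) + csq x * (y - x)\<^sup>2 / 2 \<ge> en y"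
proof -
  define G where "G t = en x - p x * (t - x) + csq x * (t - x)\<^sup>2 / 2 - en t" for t
  have "G x \<le> G y"
  proof (rule DERIV_nonneg_imp_nondecreasing[of x y G])
    show "\<exists>d. (G has_real_derivative d) (at t) \<and> 0 \<le> d" if "x \<le> t" "t \<le> y" for t
    proof (intro exI conjI)
      show "(G has_real_derivative (- p x + csq x * (t - x) + p t)) (at t)"
        unfolding G_def[abs_def] using that assms
        by (auto intro!: derivative_eq_intros DERIV_en)
      show "0 \<le> - p x + csq x * (t - x) + p t"
        using tangent_p[of x t] that assms by (simp add: algebra_simps)
    qed
  qed (use assms in auto)
  thus ?thesis by (simp add: G_def)
qed

lemma en_quadratic_left:
  assumes "0 < y" "y < x"
  shows "en x - p x * (y - x) + csq x * (y - x)\<^sup>2 / 2 \<le> en y"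
proof -
  define G where "G t = en x - p x * (t - x) + csq x * (t - x)\<^sup>2 / 2 - en t" for t
  have "G y \<le> G x"
  proof (rule DERIV_nonneg_imp_nondecreasing[of y x G])
    show "\<exists>d. (G has_real_derivative d) (at t) \<and> 0 \<le> d" if "y \<le> t" "t \<le> x" for t
    proof (intro exI conjI)
      show "(G has_real_derivative (- p x + csq x * (t - x) + p t)) (at t)"
        unfolding G_def[abs_def] using that assms
        by (auto intro!: derivative_eq_intros DERIV_en)
      show "0 \<le> - p x + csq x * (t - x) + p t"
        using tangent_p[of x t] that assms by (simp add: algebra_simps)
    qed
  qed (use assms in auto)
  thus ?thesis by (simp add: G_def)
qed

section \<open>The entropy, its gradient and the relative quantities\<close>

lemma integral_pressure: "v > 0 \<Longrightarrow> integral {v..} p = en v"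
  using has_integral_powr_to_inf[of "- \<gamma>" v] gamma
  unfolding pressure_def[abs_def] en_def
  by (subst integral_unique) (auto simp: field_simps)

lemma eta_eq:
  "0 < v \<Longrightarrow> eta \<gamma> (v, q2, q3, u1, u2, u3) =
     en v + (u1\<^sup>2 + u2\<^sup>2 + u3\<^sup>2) / 2 + (q2\<^sup>2 + q3\<^sup>2) / (2 * v)"
  by (simp add: integral_pressure)

lemma open_states: "open states"
proof -
  have "states = fst -` {0<..}" by (auto simp: states_def)
  moreover have "open (fst -` {0<..} :: state set)" by (intro open_vimage_fst) simp
  ultimately show ?thesis by simp
qed

lemma eta_has_derivative:
  assumes "V \<in> states"
  shows "(eta \<gamma> has_derivative (\<lambda>W. inner (egrad \<gamma> V) W)) (at V)"
proof -
  obtain v q2 q3 u1 u2 u3 where V: "V = (v, q2, q3, u1, u2, u3)" by (cases V) auto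
  have v: "v > 0" using assms V by (simp add: states_def)
  let ?f = "\<lambda>U :: state. en (fst U) + ((fst (snd (snd (snd U))))\<^sup>2
      + (fst (snd (snd (snd (snd U)))))\<^sup>2 + (snd (snd (snd (snd (snd U)))))\<^sup>2) / 2
      + ((fst (snd U))\<^sup>2 + (fst (snd (snd U)))\<^sup>2) / (2 * fst U)"
  have en: "(en has_derivative (\<lambda>h. - p v * h)) (at v)"
    using DERIV_en[OF v] unfolding has_field_derivative_def .
  have "((\<lambda>U::state. en (fst U)) has_derivative (\<lambda>W. - p v * fst W)) (at V)"
    by (rule has_derivative_compose[of fst fst V UNIV en "\<lambda>h. - p v * h"])
      (use en in \<open>auto intro!: derivative_eq_intros simp: V\<close>)
  hence "(?f has_derivative (\<lambda>W. inner (egrad \<gamma> V) W)) (at V)"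
    by (rule has_derivative_eq_rhs[OF has_derivative_add[OF has_derivative_add]])
       (use v in \<open>auto intro!: derivative_eq_intros ext simp: V field_simps power2_eq_square\<close>)
  moreover have "?f U = eta \<gamma> U" if "U \<in> states" for U
    using that by (cases U) (auto simp: states_def eta_eq simp del: eta.simps)
  ultimately show ?thesis
    using has_derivative_transform_within_open[OF _ open_states assms, of ?f] by auto
qed

lemma rel_eq:
  "V \<in> states \<Longrightarrow> rel U V = eta \<gamma> U - eta \<gamma> V - inner (egrad \<gamma> V) (U - V)"
  unfolding rel_entropy_def using frechet_derivative_at[OF eta_has_derivative] by metis

lemma rel_mk:
  assumes "0 < v" "0 < v'"
  shows "rel (mk v b2 b3 u w2 w3) (mk v' b2' b3' u' w2' w3') =
    Pi v v' + ((u - u')\<^sup>2 + (w2 - w2')\<^sup>2 + (w3 - w3')\<^sup>2) / 2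
      + v / 2 * ((b2 - b2')\<^sup>2 + (b3 - b3')\<^sup>2)"
proof -
  have "rel (mk v b2 b3 u w2 w3) (mk v' b2' b3' u' w2' w3') =
     eta \<gamma> (mk v b2 b3 u w2 w3) - eta \<gamma> (mk v' b2' b3' u' w2' w3')
     - inner (egrad \<gamma> (mk v' b2' b3' u' w2' w3')) (mk v b2 b3 u w2 w3 - mk v' b2' b3' u' w2' w3')"
    by (rule rel_eq) (simp add: assms)
  thus ?thesis using assms
    by (simp add: mk_def eta_eq Pi_def inner_real_def power_mult_distrib del: eta.simps)
      (simp add: field_simps power2_eq_square)
qed

lemma qf_mk:
  assumes "0 < v" "0 < v'"
  shows "qf (mk v b2 b3 u w2 w3) (mk v' b2' b3' u' w2' w3') =
    (p v + (b2\<^sup>2 + b3\<^sup>2) / 2 - p v' - (b2'\<^sup>2 + b3'\<^sup>2) / 2) * (u - u')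
      - \<beta> * ((b2 - b2') * (w2 - w2') + (b3 - b3') * (w3 - w3'))"
  using assms unfolding qf_def
  by (simp add: mk_def inner_real_def power_mult_distrib)
    (simp add: field_simps power2_eq_square)

lemma RH_mk:
  assumes "0 < v" "0 < v'"
  shows "RH (mk v b2 b3 u w2 w3) (mk v' b2' b3' u' w2' w3') s \<longleftrightarrow>
    u - u' = s * (v' - v) \<and>
    \<beta> * (w2 - w2') = s * (v' * b2' - v * b2) \<and> \<beta> * (w3 - w3') = s * (v' * b3' - v * b3) \<and>
    p v' + (b2'\<^sup>2 + b3'\<^sup>2) / 2 - p v - (b2\<^sup>2 + b3\<^sup>2) / 2 = s * (u' - u) \<and>
    \<beta> * (b2 - b2') = s * (w2' - w2) \<and> \<beta> * (b3 - b3') = s * (w3' - w3)"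
proof -
  have 1: "(v * b2)\<^sup>2 + (v * b3)\<^sup>2 = v\<^sup>2 * (b2\<^sup>2 + b3\<^sup>2)" for v b2 b3 :: real
    by (simp add: algebra_simps)
  show ?thesis using assms unfolding rankine_hugoniot_def
    by (simp add: mk_def 1) (auto simp: algebra_simps)
qed

text \<open>Pairing the Rankine-Hugoniot relation with the fixed vector
  \<open>egrad \<gamma> V\<close> cancels all linear terms, so only the entropy defect of the jump
  survives, and it does not depend on V.\<close>

lemma qf_rel:
  assumes "RH A B s" "V \<in> states"
  shows "qf A V - qf B V = s * (rel A V - rel B V) + diss A B s"
proof -
  have "inner (egrad \<gamma> V) (flux \<beta> \<gamma> B - flux \<beta> \<gamma> A) = s * inner (egrad \<gamma> V) (B - A)"
    using assms(1) by (simp add: rankine_hugoniot_def)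
  thus ?thesis by (simp add: qf_def rel_eq[OF assms(2)] diss_def inner_diff_right algebra_simps)
qed

lemma qf_self [simp]: "qf V V = 0" by (simp add: qf_def)
lemma rel_self: "V \<in> states \<Longrightarrow> rel V V = 0" by (simp add: rel_eq)

lemma diss_eq_qf_rel:
  assumes "RH A B s" "B \<in> states" shows "diss A B s = qf A B - s * rel A B"
  using qf_rel[OF assms] assms(2) by (simp add: rel_self)

text \<open>The jump relations express every velocity jump by volume and field jumps, which
  separates a gas part from a magnetic part. The magnetic part drops out when s is an Alfven speed
  of the left state.\<close>

lemma diss_mk:
  assumes "0 < v" "0 < v'" and RH: "RH (mk v b2 b3 u w2 w3) (mk v' b2' b3' u' w2' w3') s" and "s \<noteq> 0"
  shows "diss (mk v b2 b3 u w2 w3) (mk v' b2' b3' u' w2' w3') s =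
    s * (s\<^sup>2 * (v - v')\<^sup>2 / 2 - Pi v v' + ((b2 - b2')\<^sup>2 + (b3 - b3')\<^sup>2) / 2 * (\<beta>\<^sup>2 / s\<^sup>2 - v))"
proof -
  note R = RH[unfolded RH_mk[OF assms(1,2)]]
  have w2: "w2 - w2' = - \<beta> * (b2 - b2') / s" and w3: "w3 - w3' = - \<beta> * (b3 - b3') / s"
    using R \<open>s \<noteq> 0\<close> by (auto simp: field_simps)
  have u: "u - u' = s * (v' - v)" using R by auto
  have P: "p v + (b2\<^sup>2 + b3\<^sup>2) / 2 - p v' - (b2'\<^sup>2 + b3'\<^sup>2) / 2 = s * (u - u')" using R by (simp add: algebra_simps)
  show ?thesis
    unfolding diss_eq_qf_rel[OF RH mk_in_states[THEN iffD2, OF assms(2)]] qf_mk[OF assms(1,2)]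
      rel_mk[OF assms(1,2)] P u w2 w3
    using \<open>s \<noteq> 0\<close> by (simp add: field_simps power2_eq_square)
qed

lemma rel_nonneg: "U \<in> states \<Longrightarrow> V \<in> states \<Longrightarrow> rel U V \<ge> 0"
  by (elim mk_cases) (auto simp: rel_mk Pi_nonneg)

text \<open>Strictness gives \<open>excess\<close> strict signs at the two end states, which then
  persist for nearby states.\<close>

lemma rel_pos: "U \<in> states \<Longrightarrow> V \<in> states \<Longrightarrow> U \<noteq> V \<Longrightarrow> rel U V > 0"
proof (elim mk_cases)
  fix v b2 b3 u w2 w3 v' b2' b3' u' w2' w3' :: real
  assume UV: "U = mk v b2 b3 u w2 w3" "V = mk v' b2' b3' u' w2' w3'" "0 < v" "0 < v'" "U \<noteq> V"
  consider "v \<noteq> v'" | "v = v'" "(u - u')\<^sup>2 + (w2 - w2')\<^sup>2 + (w3 - w3')\<^sup>2 > 0"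
    | "v = v'" "(b2 - b2')\<^sup>2 + (b3 - b3')\<^sup>2 > 0"
    using UV sum_power2_gt_zero_iff[of "b2 - b2'" "b3 - b3'"] sum_power2_gt_zero_iff[of "u - u'" "w2 - w2'"]
    by (cases "w3 = w3'") (auto simp: add_nonneg_pos)
  thus "rel U V > 0"
    unfolding UV(1,2) rel_mk[OF UV(3,4)]
  proof cases
    case 1
    thus "0 < Pi v v' + ((u - u')\<^sup>2 + (w2 - w2')\<^sup>2 + (w3 - w3')\<^sup>2) / 2
      + v / 2 * ((b2 - b2')\<^sup>2 + (b3 - b3')\<^sup>2)"
      using Pi_pos[OF UV(3,4)] UV(3) by (intro add_pos_nonneg) auto
  next
    case 2
    thus "0 < Pi v v' + ((u - u')\<^sup>2 + (w2 - w2')\<^sup>2 + (w3 - w3')\<^sup>2) / 2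
      + v / 2 * ((b2 - b2')\<^sup>2 + (b3 - b3')\<^sup>2)"
      using UV(3) by (intro add_pos_nonneg[OF add_nonneg_pos]) auto
  next
    case 3
    hence "0 < v / 2 * ((b2 - b2')\<^sup>2 + (b3 - b3')\<^sup>2)"
      using UV(3) by (intro mult_pos_pos) (simp_all del: sum_power2_gt_zero_iff)
    thus "0 < Pi v v' + ((u - u')\<^sup>2 + (w2 - w2')\<^sup>2 + (w3 - w3')\<^sup>2) / 2
      + v / 2 * ((b2 - b2')\<^sup>2 + (b3 - b3')\<^sup>2)"
      using Pi_nonneg[OF UV(3,4)] by (intro add_nonneg_pos) auto
  qed
qed

end

text \<open>The integrability criterion for the whole development: test functions and differences of
  fronts confine the integrands to compact sets.\<close>

lemma integrable_bounded_compact: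
  fixes F :: "'a::euclidean_space \<Rightarrow> 'b::{banach, second_countable_topology}"
  assumes [measurable]: "F \<in> borel_measurable borel" and "compact C"
    and B: "\<And>x. x \<in> C \<Longrightarrow> norm (F x) \<le> B" and z: "\<And>x. x \<notin> C \<Longrightarrow> F x = 0"
  shows "integrable lborel F"
proof (rule Bochner_Integration.integrable_bound)
  have C: "C \<in> sets borel" using \<open>compact C\<close> by (simp add: compact_imp_closed)
  have "emeasure lborel C < \<infinity>" using \<open>compact C\<close> by (rule emeasure_compact_finite)
  thus "integrable lborel (\<lambda>x. indicator C x * B)" using C by (intro integrable_mult_left) auto
  show "AE x in lborel. norm (F x) \<le> norm (indicator C x * B)"
  proof (intro AE_I2)
    fix x show "norm (F x) \<le> norm (indicator C x * B)"
      using B[of x] z[of x] norm_ge_zero[of "F x"] by (cases "x \<in> C") auto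
  qed
qed auto

subsection \<open>Test functions\<close>

lemma test_function_regular:
  assumes "test_function T \<phi>"
  shows "\<phi> differentiable at z" "continuous_on UNIV \<phi>" "continuous_on UNIV (dt \<phi>)" "continuous_on UNIV (dx \<phi>)"
proof -
  have "C_k (Suc 0) \<phi>" "C_k 0 \<phi>" using assms unfolding test_function_def by blast+
  thus "\<phi> differentiable at z" "continuous_on UNIV \<phi>" "continuous_on UNIV (dt \<phi>)" "continuous_on UNIV (dx \<phi>)"
    by (auto simp del: split_paired_All)
qed

lemma test_function_measurable [measurable]:
  assumes "test_function T \<phi>"
  shows "\<phi> \<in> borel_measurable borel" "dt \<phi> \<in> borel_measurable borel" "dx \<phi> \<in> borel_measurable borel"
  using test_function_regular(2-4)[OF assms] by (auto intro: borel_measurable_continuous_onI)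

text \<open>The clause \<open>t < T\<close> is kept beside the box because it makes the test
  function vanish at the final time, so that integration in time leaves no boundary term
  there.\<close>

lemma test_function_support:
  assumes \<phi>: "test_function T \<phi>"
  obtains M where "M > 0"
    "\<And>t x. \<not> (\<bar>t\<bar> \<le> M \<and> \<bar>x\<bar> \<le> M \<and> t < T) \<Longrightarrow> \<phi> (t, x) = 0 \<and> dt \<phi> (t, x) = 0 \<and> dx \<phi> (t, x) = 0"
proof -
  define S where "S = closure {z. \<phi> z \<noteq> 0}"
  have comp: "compact S" and sub: "S \<subseteq> {..<T} \<times> UNIV" using \<phi> by (auto simp: test_function_def S_def)
  obtain M where M: "M > 0" "\<And>z. z \<in> S \<Longrightarrow> norm z \<le> M"
    using compact_imp_bounded[OF comp] by (auto simp: bounded_pos)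
  have out: "\<phi> z = 0 \<and> dt \<phi> z = 0 \<and> dx \<phi> z = 0" if "z \<notin> S" for z
  proof -
    have op: "open (- S)" by (auto simp: S_def)
    have 0: "\<phi> y = 0" if "y \<in> - S" for y
    proof (rule ccontr)
      assume "\<phi> y \<noteq> 0"
      hence "y \<in> S" using closure_subset[of "{z. \<phi> z \<noteq> 0}"] unfolding S_def by blast
      with that show False by blast
    qed
    have "(\<phi> has_derivative (\<lambda>_. 0)) (at z)"
      by (rule has_derivative_transform_within_open[OF has_derivative_const[of 0] op])
        (use \<open>z \<notin> S\<close> 0 in simp_all)
    hence "frechet_derivative \<phi> (at z) = (\<lambda>_. 0)" by (rule frechet_derivative_at[symmetric])
    thus ?thesis using \<open>z \<notin> S\<close> 0 by (simp add: dt_def dx_def)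
  qed
  show thesis
  proof (rule that[OF M(1)])
    fix t x :: real assume "\<not> (\<bar>t\<bar> \<le> M \<and> \<bar>x\<bar> \<le> M \<and> t < T)"
    moreover have "\<bar>t\<bar> \<le> norm (t, x)" "\<bar>x\<bar> \<le> norm (t, x)"
      using norm_fst_le[of t x] norm_snd_le[of x t] by auto
    ultimately have *: "norm (t, x) > M \<or> \<not> t < T" by linarith
    have "(t, x) \<notin> S"
    proof
      assume "(t, x) \<in> S"
      hence "norm (t, x) \<le> M" "(t, x) \<in> {..<T} \<times> UNIV" using M(2) sub by blast+
      with * show False by simp
    qed
    thus "\<phi> (t, x) = 0 \<and> dt \<phi> (t, x) = 0 \<and> dx \<phi> (t, x) = 0" by (rule out)
  qed
qed

lemma test_function_bound:
  assumes \<phi>: "test_function T \<phi>"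
  obtains B where "\<And>z. \<bar>\<phi> z\<bar> \<le> B" "\<And>z. \<bar>dt \<phi> z\<bar> \<le> B" "\<And>z. \<bar>dx \<phi> z\<bar> \<le> B"
proof -
  obtain M where M: "M > 0"
    "\<And>t x. \<not> (\<bar>t\<bar> \<le> M \<and> \<bar>x\<bar> \<le> M \<and> t < T) \<Longrightarrow> \<phi> (t, x) = 0 \<and> dt \<phi> (t, x) = 0 \<and> dx \<phi> (t, x) = 0"
    using test_function_support[OF \<phi>] by blast
  have comp: "compact ({-M..M} \<times> {-M..M})" by (intro compact_Times) auto
  have "\<exists>B\<ge>0. \<forall>z. \<bar>f z\<bar> \<le> B" if f: "continuous_on UNIV f"
    "\<And>t x. \<not> (\<bar>t\<bar> \<le> M \<and> \<bar>x\<bar> \<le> M \<and> t < T) \<Longrightarrow> f (t, x) = 0" for f :: "real \<times> real \<Rightarrow> real"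
  proof -
    have "compact (f ` ({-M..M} \<times> {-M..M}))"
      by (rule compact_continuous_image[OF continuous_on_subset[OF f(1)] comp]) auto
    then obtain B where B: "\<And>y. y \<in> f ` ({-M..M} \<times> {-M..M}) \<Longrightarrow> \<bar>y\<bar> \<le> B"
      using compact_imp_bounded by (force simp: bounded_iff)
    have "\<bar>f z\<bar> \<le> max 0 B" for z
    proof (cases "z \<in> {-M..M} \<times> {-M..M}")
      case True thus ?thesis using B by force
    next
      case False thus ?thesis using f(2)[of "fst z" "snd z"] by (cases z) (auto simp: abs_le_iff)
    qed
    thus ?thesis by (intro exI[of _ "max 0 B"]) auto
  qed
  from this[OF test_function_regular(2)[OF \<phi>]] this[OF test_function_regular(3)[OF \<phi>]]
    this[OF test_function_regular(4)[OF \<phi>]] M(2)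
  obtain B1 B2 B3 where "\<And>z. \<bar>\<phi> z\<bar> \<le> B1" "\<And>z. \<bar>dt \<phi> z\<bar> \<le> B2" "\<And>z. \<bar>dx \<phi> z\<bar> \<le> B3"
    by (metis (no_types, lifting))
  thus thesis by (intro that[of "max B1 (max B2 B3)"]) (auto simp: le_max_iff_disj)
qed

lemma test_function_deriv_line:
  assumes "test_function T \<phi>"
  shows "((\<lambda>t. \<phi> (t, y + s * t)) has_real_derivative (dt \<phi> (t, y + s * t) + s * dx \<phi> (t, y + s * t))) (at t)"
proof -
  let ?D = "frechet_derivative \<phi> (at (t, y + s * t))"
  have D: "(\<phi> has_derivative ?D) (at (t, y + s * t))"
    using test_function_regular(1)[OF assms] by (simp add: frechet_derivative_works)
  have "((\<lambda>t. (t, y + s * t)) has_derivative (\<lambda>h. (h, s * h))) (at t)"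
    by (auto intro!: derivative_eq_intros)
  from has_derivative_compose[OF this D]
  have "((\<lambda>t. \<phi> (t, y + s * t)) has_derivative (\<lambda>h. ?D (h, s * h))) (at t)" .
  moreover have "?D (h, s * h) = (dt \<phi> (t, y + s * t) + s * dx \<phi> (t, y + s * t)) * h" for h
  proof -
    have lin: "linear ?D" using D has_derivative_linear by blast
    have "(h, s * h) = h *\<^sub>R (1, 0) + (s * h) *\<^sub>R (0, 1::real)" by simp
    hence "?D (h, s * h) = h *\<^sub>R ?D (1, 0) + (s * h) *\<^sub>R ?D (0, 1)"
      using linear_add[OF lin] linear_cmul[OF lin] by metis
    thus ?thesis by (simp add: dt_def dx_def algebra_simps)
  qed
  ultimately show ?thesis by (simp add: has_field_derivative_def)
qed

lemma test_function_deriv_x: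
  assumes "test_function T \<phi>"
  shows "((\<lambda>x. \<phi> (t, x)) has_real_derivative dx \<phi> (t, x)) (at x)"
proof -
  let ?D = "frechet_derivative \<phi> (at (t, x))"
  have D: "(\<phi> has_derivative ?D) (at (t, x))"
    using test_function_regular(1)[OF assms] by (simp add: frechet_derivative_works)
  have "((\<lambda>x. (t, x)) has_derivative (\<lambda>h. (0, h))) (at x)"
    by (auto intro!: derivative_eq_intros)
  from has_derivative_compose[OF this D]
  have "((\<lambda>x. \<phi> (t, x)) has_derivative (\<lambda>h. ?D (0, h))) (at x)" .
  moreover have "?D (0, h) = dx \<phi> (t, x) * h" for h
  proof -
    have lin: "linear ?D" using D has_derivative_linear by blast
    have "(0, h) = h *\<^sub>R (0, 1::real)" by simp
    hence "?D (0, h) = h *\<^sub>R ?D (0, 1)" using linear_cmul[OF lin] by metis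
    thus ?thesis by (simp add: dx_def mult.commute)
  qed
  ultimately show ?thesis by (simp add: has_field_derivative_def)
qed

subsection \<open>Heaviside fronts\<close>

text \<open>The common building block: shocks and smooth waves alike are written as superpositions
  of such moving steps.\<close>

definition front :: "real \<Rightarrow> real \<Rightarrow> real \<Rightarrow> real \<Rightarrow> real" where
  "front c s t x = (if c + s * t < x then 1 else 0)"

lemma front_measurable [measurable]:
  assumes [measurable]: "f \<in> borel_measurable M" "g \<in> borel_measurable M"
    "h \<in> borel_measurable M" "k \<in> borel_measurable M"
  shows "(\<lambda>z. front (f z) (g z) (h z) (k z)) \<in> borel_measurable M"
  unfolding front_def by measurable

lemma abs_mult_front_le: "\<bar>a\<bar> \<le> B \<Longrightarrow> \<bar>a * front c s t x\<bar> \<le> B"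
  by (auto simp: front_def)

lemma integral_unit_interval_FTC:
  fixes F f :: "real \<Rightarrow> real"
  assumes "\<And>x. (F has_real_derivative f x) (at x)" "continuous_on {0..1} f"
  shows "(\<integral>t. indicator {0..<1} t * f t \<partial>lborel) = F 1 - F 0"
proof -
  have "(\<integral>t. indicator {0..<1} t * f t \<partial>lborel) = (\<integral>t. indicator {0..1} t *\<^sub>R f t \<partial>lborel)"
  proof (rule integral_cong_AE)
    have m: "(\<lambda>x. indicator {0..1} x *\<^sub>R f x) \<in> borel_measurable borel"
      using assms(2) by (intro borel_measurable_continuous_on_indicator) auto
    thus "(\<lambda>x. indicator {0..1} x *\<^sub>R f x) \<in> borel_measurable lborel" by simp
    have "(\<lambda>x. indicator {0..<1} x * f x) = (\<lambda>x. indicator {0..<1} x * (indicator {0..1} x *\<^sub>R f x))"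
      by (auto simp: indicator_def)
    thus "(\<lambda>x. indicator {0..<1} x * f x) \<in> borel_measurable lborel" using m by simp
    show "AE x in lborel. indicator {0..<1} x * f x = indicator {0..1} x *\<^sub>R f x"
      using AE_lborel_singleton[of 1] by eventually_elim (auto simp: indicator_def)
  qed
  also have "\<dots> = F 1 - F 0"
    using assms by (intro integral_FTC_atLeastAtMost)
      (auto simp: has_real_derivative_iff_has_vector_derivative intro: has_vector_derivative_at_within)
  finally show ?thesis .
qed

text \<open>The shear x = y + s t freezes the front. After Fubini the inner integral is that of the
  derivative of the test function along a line, and only its value at t = 0 remains.\<close>

lemma test_function_front:
  assumes \<phi>: "test_function 1 \<phi>"
  shows "(LINT (t, x):{0..<1} \<times> UNIV|lborel. (dt \<phi> (t, x) + s * dx \<phi> (t, x)) * front c s t x)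
    + (LINT x|lborel. \<phi> (0, x) * front c s 0 x) = 0"
proof -
  note [measurable] = test_function_measurable[OF \<phi>]
  obtain M where M: "M > 0"
    "\<And>t x. \<not> (\<bar>t\<bar> \<le> M \<and> \<bar>x\<bar> \<le> M \<and> t < 1) \<Longrightarrow> \<phi> (t, x) = 0 \<and> dt \<phi> (t, x) = 0 \<and> dx \<phi> (t, x) = 0"
    using test_function_support[OF \<phi>] by blast
  obtain B where B: "\<And>z. \<bar>\<phi> z\<bar> \<le> B" "\<And>z. \<bar>dt \<phi> z\<bar> \<le> B" "\<And>z. \<bar>dx \<phi> z\<bar> \<le> B"
    using test_function_bound[OF \<phi>] by blast
  let ?G = "\<lambda>t y. indicator {0..<1} t * (dt \<phi> (t, y) + s * dx \<phi> (t, y))"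
  have bd: "\<bar>?G t y\<bar> \<le> B + \<bar>s\<bar> * B" for t y
  proof -
    have "\<bar>s * dx \<phi> (t, y)\<bar> \<le> \<bar>s\<bar> * B" using B(3)[of "(t, y)"] by (simp add: abs_mult mult_left_mono)
    thus ?thesis using B(2)[of "(t, y)"] by (auto simp: indicator_def)
  qed
  have comp: "compact ({-M..M} \<times> {-(M + \<bar>s\<bar> * M)..M + \<bar>s\<bar> * M})" "compact ({-M..M} \<times> {-M..M})"
    by (intro compact_Times; simp)+
  have int1: "integrable lborel (\<lambda>(t, x). ?G t x * front c s t x)"
  proof (rule integrable_bounded_compact[OF _ comp(2)])
    show "(\<lambda>(t, x). ?G t x * front c s t x) \<in> borel_measurable borel"
      unfolding borel_prod[symmetric] by measurable
    show "norm (case z of (t, x) \<Rightarrow> ?G t x * front c s t x) \<le> B + \<bar>s\<bar> * B" for z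
      unfolding case_prod_beta real_norm_def by (intro abs_mult_front_le bd)
    show "(case z of (t, x) \<Rightarrow> ?G t x * front c s t x) = 0" if "z \<notin> {-M..M} \<times> {-M..M}" for z
      using that M(2)[of "fst z" "snd z"] by (cases z) (auto simp: abs_le_iff)
  qed
  have int2: "integrable lborel (\<lambda>(t, y). ?G t (y + s * t) * front c 0 0 y)"
  proof (rule integrable_bounded_compact[OF _ comp(1)])
    show "(\<lambda>(t, y). ?G t (y + s * t) * front c 0 0 y) \<in> borel_measurable borel"
      unfolding borel_prod[symmetric] by measurable
    show "norm (case z of (t, y) \<Rightarrow> ?G t (y + s * t) * front c 0 0 y) \<le> B + \<bar>s\<bar> * B" for z
      unfolding case_prod_beta real_norm_def by (intro abs_mult_front_le bd)
    show "(case z of (t, y) \<Rightarrow> ?G t (y + s * t) * front c 0 0 y) = 0"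
      if z: "z \<notin> {-M..M} \<times> {-(M + \<bar>s\<bar> * M)..M + \<bar>s\<bar> * M}" for z
    proof -
      obtain t y where [simp]: "z = (t, y)" by (cases z)
      have "\<not> (\<bar>t\<bar> \<le> M \<and> \<bar>y + s * t\<bar> \<le> M \<and> t < 1)"
      proof
        assume *: "\<bar>t\<bar> \<le> M \<and> \<bar>y + s * t\<bar> \<le> M \<and> t < 1"
        have "\<bar>s * t\<bar> \<le> \<bar>s\<bar> * M" using * by (simp add: abs_mult mult_left_mono)
        hence "\<bar>y\<bar> \<le> M + \<bar>s\<bar> * M" using * by linarith
        with * z show False by (auto simp: abs_le_iff)
      qed
      from M(2)[OF this] show ?thesis by simp
    qed
  qed
  have "(LINT (t, x):{0..<1} \<times> UNIV|lborel. (dt \<phi> (t, x) + s * dx \<phi> (t, x)) * front c s t x)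
      = (\<integral>z. (case z of (t, x) \<Rightarrow> ?G t x * front c s t x) \<partial>(lborel \<Otimes>\<^sub>M lborel))"
    unfolding set_lebesgue_integral_def lborel_prod
    by (rule Bochner_Integration.integral_cong) (auto simp: indicator_def)
  also have "\<dots> = (\<integral>t. \<integral>x. ?G t x * front c s t x \<partial>lborel \<partial>lborel)"
    by (subst lborel_pair.integral_fst'[symmetric]) (use int1 in \<open>auto simp: lborel_prod\<close>)
  also have "\<dots> = (\<integral>t. \<integral>y. ?G t (y + s * t) * front c 0 0 y \<partial>lborel \<partial>lborel)"
  proof (rule Bochner_Integration.integral_cong[OF refl])
    fix t
    show "(\<integral>x. ?G t x * front c s t x \<partial>lborel) = (\<integral>y. ?G t (y + s * t) * front c 0 0 y \<partial>lborel)"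
      by (subst lborel_integral_real_affine[where c = 1 and t = "s * t"])
        (auto simp: front_def add_ac intro!: Bochner_Integration.integral_cong)
  qed
  also have "\<dots> = (\<integral>y. \<integral>t. ?G t (y + s * t) * front c 0 0 y \<partial>lborel \<partial>lborel)"
    by (rule lborel_pair.Fubini_integral[symmetric]) (use int2 in \<open>auto simp: lborel_prod\<close>)
  also have "\<dots> = (\<integral>y. - (\<phi> (0, y) * front c s 0 y) \<partial>lborel)"
  proof (rule Bochner_Integration.integral_cong[OF refl])
    fix y
    have "(\<integral>t. ?G t (y + s * t) \<partial>lborel) = \<phi> (1, y + s * 1) - \<phi> (0, y + s * 0)"
      by (rule integral_unit_interval_FTC[OF test_function_deriv_line[OF \<phi>]])
        (intro continuous_intros continuous_on_compose2[OF test_function_regular(3)[OF \<phi>]]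
          continuous_on_compose2[OF test_function_regular(4)[OF \<phi>]]; auto)
    also have "\<phi> (1, y + s * 1) = 0" using M(2)[of 1 "y + s * 1"] by simp
    finally show "(\<integral>t. ?G t (y + s * t) * front c 0 0 y \<partial>lborel) = - (\<phi> (0, y) * front c s 0 y)"
      by (simp add: front_def)
  qed
  finally show ?thesis by simp
qed

text \<open>The x-derivative of a step is a Dirac mass on the line x = c + s t, so the integral is
  minus that of the test function along the line. This carries the sign of the entropy defect of a
  shock.\<close>

lemma test_function_front_dx:
  assumes \<phi>: "test_function 1 \<phi>" and nn: "\<And>z. 0 \<le> \<phi> z"
  shows "(LINT (t, x):{0..<1} \<times> UNIV|lborel. dx \<phi> (t, x) * front c s t x) \<le> 0"
proof -
  note [measurable] = test_function_measurable[OF \<phi>]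
  obtain M where M: "M > 0"
    "\<And>t x. \<not> (\<bar>t\<bar> \<le> M \<and> \<bar>x\<bar> \<le> M \<and> t < 1) \<Longrightarrow> \<phi> (t, x) = 0 \<and> dt \<phi> (t, x) = 0 \<and> dx \<phi> (t, x) = 0"
    using test_function_support[OF \<phi>] by blast
  obtain B where B: "\<And>z. \<bar>\<phi> z\<bar> \<le> B" "\<And>z. \<bar>dt \<phi> z\<bar> \<le> B" "\<And>z. \<bar>dx \<phi> z\<bar> \<le> B"
    using test_function_bound[OF \<phi>] by blast
  let ?G = "\<lambda>t x. indicator {0..<1} t * dx \<phi> (t, x)"
  have comp: "compact ({-M..M} \<times> {-M..M})" by (intro compact_Times; simp)
  have int1: "integrable lborel (\<lambda>(t, x). ?G t x * front c s t x)"
  proof (rule integrable_bounded_compact[OF _ comp])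
    show "(\<lambda>(t, x). ?G t x * front c s t x) \<in> borel_measurable borel"
      unfolding borel_prod[symmetric] by measurable
    show "norm (case z of (t, x) \<Rightarrow> ?G t x * front c s t x) \<le> B" for z
      unfolding case_prod_beta real_norm_def using B(3)[of z]
      by (intro abs_mult_front_le) (auto simp: indicator_def)
    show "(case z of (t, x) \<Rightarrow> ?G t x * front c s t x) = 0" if "z \<notin> {-M..M} \<times> {-M..M}" for z
      using that M(2)[of "fst z" "snd z"] by (cases z) (auto simp: abs_le_iff)
  qed
  have "(LINT (t, x):{0..<1} \<times> UNIV|lborel. dx \<phi> (t, x) * front c s t x)
      = (\<integral>z. (case z of (t, x) \<Rightarrow> ?G t x * front c s t x) \<partial>(lborel \<Otimes>\<^sub>M lborel))"
    unfolding set_lebesgue_integral_def lborel_prod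
    by (rule Bochner_Integration.integral_cong) (auto simp: indicator_def)
  also have "\<dots> = (\<integral>t. \<integral>x. ?G t x * front c s t x \<partial>lborel \<partial>lborel)"
    by (subst lborel_pair.integral_fst'[symmetric]) (use int1 in \<open>auto simp: lborel_prod\<close>)
  also have "\<dots> = (\<integral>t. - (indicator {0..<1} t * \<phi> (t, c + s * t)) \<partial>lborel)"
  proof (rule Bochner_Integration.integral_cong[OF refl])
    fix t
    \<comment> \<open>The point \<open>b\<close> lies beyond the support and beyond the front, so
      only the value at the front survives.\<close>
    define a b where "a = c + s * t" and "b = max a M + 1"
    have ab: "a \<le> b" "M < b" by (auto simp: b_def)
    have "(\<integral>x. dx \<phi> (t, x) * front c s t x \<partial>lborel) = (\<integral>x. indicator {a..b} x *\<^sub>R dx \<phi> (t, x) \<partial>lborel)"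
    proof (rule integral_cong_AE)
      show "AE x in lborel. dx \<phi> (t, x) * front c s t x = indicator {a..b} x *\<^sub>R dx \<phi> (t, x)"
        using AE_lborel_singleton[of a]
      proof eventually_elim
        case (elim x)
        have "dx \<phi> (t, x) = 0" if "\<not> x \<le> b"
        proof -
          have "\<not> \<bar>x\<bar> \<le> M" using that ab by linarith
          thus ?thesis using M(2) by blast
        qed
        thus ?case using elim by (cases "x \<le> b") (auto simp: front_def a_def indicator_def)
      qed
    qed measurable
    also have "\<dots> = \<phi> (t, b) - \<phi> (t, a)"
      by (rule integral_FTC_atLeastAtMost[OF ab(1)])
        (auto simp: has_real_derivative_iff_has_vector_derivative[symmetric]
          intro!: has_field_derivative_at_within test_function_deriv_x[OF \<phi>]
            continuous_on_compose2[OF test_function_regular(4)[OF \<phi>]] continuous_intros)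
    also have "\<phi> (t, b) = 0" using M(2)[of t b] ab M(1) by auto
    finally have "(\<integral>x. dx \<phi> (t, x) * front c s t x \<partial>lborel) = - \<phi> (t, c + s * t)" by (simp add: a_def)
    thus "(\<integral>x. ?G t x * front c s t x \<partial>lborel) = - (indicator {0..<1} t * \<phi> (t, c + s * t))"
      by (simp add: mult.assoc)
  qed
  also have "\<dots> \<le> 0"
    using nn by (auto intro!: Bochner_Integration.integral_nonneg)
  finally show ?thesis .
qed

text \<open>A step is not integrable by itself, but the difference of two positions is: it is the
  signed area swept, negative for s > 0 because the region of value 1 lies ahead of the
  front.\<close>

lemma integral_front_diff:
  "integrable lborel (\<lambda>x. front c s t x - front c s 0 x)"
  "(\<integral>x. front c s t x - front c s 0 x \<partial>lborel) = - (s * t)"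
proof -
  have eq: "front c s t x - front c s 0 x
      = indicator {c + s * t<..c} x - indicator {c<..c + s * t} x" for x
    by (auto simp: front_def indicator_def)
  have fin: "emeasure lborel {a<..b} < top" for a b :: real
    by (cases "a \<le> b") auto
  have meas: "measure lborel {a<..b} = max 0 (b - a)" for a b :: real
    by (cases "a \<le> b") auto
  show "integrable lborel (\<lambda>x. front c s t x - front c s 0 x)"
    unfolding eq by (intro Bochner_Integration.integrable_diff) (auto simp: integrable_indicator_iff fin)
  show "(\<integral>x. front c s t x - front c s 0 x \<partial>lborel) = - (s * t)"
    unfolding eq using meas by (subst Bochner_Integration.integral_diff) (auto simp: integrable_indicator_iff fin)
qed

lemma test_function_integrable:
  fixes F :: "real \<times> real \<Rightarrow> 'b::{banach, second_countable_topology}"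
  assumes \<phi>: "test_function T \<phi>" and [measurable]: "F \<in> borel_measurable borel" and F: "\<And>z. norm (F z) \<le> B"
  shows "integrable lborel (\<lambda>z. dt \<phi> z *\<^sub>R F z)" "integrable lborel (\<lambda>z. dx \<phi> z *\<^sub>R F z)"
proof -
  note [measurable] = test_function_measurable[OF \<phi>]
  obtain M where M: "M > 0"
    "\<And>t x. \<not> (\<bar>t\<bar> \<le> M \<and> \<bar>x\<bar> \<le> M \<and> t < T) \<Longrightarrow> \<phi> (t, x) = 0 \<and> dt \<phi> (t, x) = 0 \<and> dx \<phi> (t, x) = 0"
    using test_function_support[OF \<phi>] by blast
  obtain C where C: "\<And>z. \<bar>\<phi> z\<bar> \<le> C" "\<And>z. \<bar>dt \<phi> z\<bar> \<le> C" "\<And>z. \<bar>dx \<phi> z\<bar> \<le> C"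
    using test_function_bound[OF \<phi>] by blast
  have comp: "compact ({-M..M} \<times> {-M..M})" by (intro compact_Times; simp)
  have out: "dt \<phi> z = 0 \<and> dx \<phi> z = 0" if "z \<notin> {-M..M} \<times> {-M..M}" for z
  proof -
    have "\<not> (\<bar>fst z\<bar> \<le> M \<and> \<bar>snd z\<bar> \<le> M \<and> fst z < T)" using that by (cases z) auto
    from M(2)[OF this] show ?thesis by simp
  qed
  have C0: "0 \<le> C" using order_trans[OF abs_ge_zero C(1)] .
  show "integrable lborel (\<lambda>z. dt \<phi> z *\<^sub>R F z)"
    by (rule integrable_bounded_compact[OF _ comp, where B = "C * B"])
      (use out mult_mono[OF C(2) F C0] in simp_all)
  show "integrable lborel (\<lambda>z. dx \<phi> z *\<^sub>R F z)"
    by (rule integrable_bounded_compact[OF _ comp, where B = "C * B"])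
      (use out mult_mono[OF C(3) F C0] in simp_all)
qed

lemma test_function_integrable_initial:
  fixes F :: "real \<Rightarrow> 'b::{banach, second_countable_topology}"
  assumes \<phi>: "test_function T \<phi>" and [measurable]: "F \<in> borel_measurable borel" and F: "\<And>z. norm (F z) \<le> B"
  shows "integrable lborel (\<lambda>x. \<phi> (0, x) *\<^sub>R F x)"
proof -
  note [measurable] = test_function_measurable[OF \<phi>]
  obtain M where M: "M > 0"
    "\<And>t x. \<not> (\<bar>t\<bar> \<le> M \<and> \<bar>x\<bar> \<le> M \<and> t < T) \<Longrightarrow> \<phi> (t, x) = 0 \<and> dt \<phi> (t, x) = 0 \<and> dx \<phi> (t, x) = 0"
    using test_function_support[OF \<phi>] by blast
  obtain C where C: "\<And>z. \<bar>\<phi> z\<bar> \<le> C"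
    by (rule test_function_bound[OF \<phi>], rule that)
  have C0: "0 \<le> C" using order_trans[OF abs_ge_zero C(1)] .
  show ?thesis
  proof (rule integrable_bounded_compact[where C = "{-M..M}" and B = "C * B"])
    show "norm (\<phi> (0, x) *\<^sub>R F x) \<le> C * B" for x
      using mult_mono[OF C[of "(0, x)"] F[of x] C0] by simp
    show "\<phi> (0, x) *\<^sub>R F x = 0" if "x \<notin> {-M..M}" for x
    proof -
      have "\<not> (\<bar>0\<bar> \<le> M \<and> \<bar>x\<bar> \<le> M \<and> 0 < T)" using that by (simp add: abs_le_iff; linarith)
      from M(2)[OF this] show ?thesis by simp
    qed
  qed auto
qed

lemma test_function_integrable_front:
  assumes \<phi>: "test_function 1 \<phi>"
  shows "integrable lborel (\<lambda>y. indicator ({0..<1} \<times> UNIV) y *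
      (case y of (t, x) \<Rightarrow> (dt \<phi> (t, x) + s * dx \<phi> (t, x)) * front c s t x))"
    "integrable lborel (\<lambda>x. \<phi> (0, x) * front c s 0 x)"
proof -
  note [measurable] = test_function_measurable[OF \<phi>]
  let ?F = "\<lambda>(t, x). indicator {0..<1} t * front c s t x"
  have "?F \<in> borel_measurable borel" unfolding borel_prod[symmetric] by measurable
  note int = test_function_integrable[OF \<phi> this, of 1]
  have "integrable lborel (\<lambda>y. dt \<phi> y *\<^sub>R ?F y + s * (dx \<phi> y *\<^sub>R ?F y))"
    using int by (intro Bochner_Integration.integrable_add integrable_mult_right) (auto simp: front_def indicator_def)
  also have "(\<lambda>y. dt \<phi> y *\<^sub>R ?F y + s * (dx \<phi> y *\<^sub>R ?F y)) = (\<lambda>y. indicator ({0..<1} \<times> UNIV) y *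
      (case y of (t, x) \<Rightarrow> (dt \<phi> (t, x) + s * dx \<phi> (t, x)) * front c s t x))"
  proof
    fix y :: "real \<times> real"
    obtain t x where y: "y = (t, x)" by (cases y)
    show "dt \<phi> y *\<^sub>R ?F y + s * (dx \<phi> y *\<^sub>R ?F y) = indicator ({0..<1} \<times> UNIV) y *
      (case y of (t, x) \<Rightarrow> (dt \<phi> (t, x) + s * dx \<phi> (t, x)) * front c s t x)"
      by (cases "t \<in> {0..<1}") (simp_all add: y distrib_right del: atLeastLessThan_iff)
  qed
  finally show "integrable lborel (\<lambda>y. indicator ({0..<1} \<times> UNIV) y *
      (case y of (t, x) \<Rightarrow> (dt \<phi> (t, x) + s * dx \<phi> (t, x)) * front c s t x))" .
  show "integrable lborel (\<lambda>x. \<phi> (0, x) * front c s 0 x)"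
    using test_function_integrable_initial[OF \<phi>, of "front c s 0" 1] by (auto simp: front_def)
qed

text \<open>A constant is a front that stays left of the support. Speed 0 yields the first identity,
  and comparing it with speed 1 yields the second.\<close>

lemma test_function_const:
  assumes \<phi>: "test_function 1 \<phi>"
  shows "(LINT (t, x):{0..<1} \<times> UNIV|lborel. dt \<phi> (t, x)) + (LINT x|lborel. \<phi> (0, x)) = 0"
    and "(LINT (t, x):{0..<1} \<times> UNIV|lborel. dx \<phi> (t, x)) = 0"
proof -
  obtain M where M: "M > 0"
    "\<And>t x. \<not> (\<bar>t\<bar> \<le> M \<and> \<bar>x\<bar> \<le> M \<and> t < 1) \<Longrightarrow> \<phi> (t, x) = 0 \<and> dt \<phi> (t, x) = 0 \<and> dx \<phi> (t, x) = 0"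
    using test_function_support[OF \<phi>] by blast
  \<comment> \<open>Started at \<open>- M - 2\<close>, a front of speed at most 1 has not reached
    \<open>- M\<close> by time 1, so it equals 1 on the support.\<close>
  have front: "f * front (- M - 2) s t x = f"
    if "0 \<le> s" "s \<le> 1" "t \<in> {0..<1}" "\<not> \<bar>x\<bar> \<le> M \<longrightarrow> f = 0" for f s t x
  proof (cases "f = 0")
    case False
    hence "- M \<le> x" using that by auto
    moreover have "s * t \<le> 1" using that by (intro mult_le_one) auto
    ultimately show ?thesis by (simp add: front_def)
  qed auto
  have a: "(LINT (t, x):{0..<1} \<times> UNIV|lborel. dt \<phi> (t, x) + s * dx \<phi> (t, x)) + (LINT x|lborel. \<phi> (0, x)) = 0"
    if s: "0 \<le> s" "s \<le> 1" for s
  proof -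
    have "(LINT (t, x):{0..<1} \<times> UNIV|lborel. (dt \<phi> (t, x) + s * dx \<phi> (t, x)) * front (- M - 2) s t x)
      = (LINT (t, x):{0..<1} \<times> UNIV|lborel. dt \<phi> (t, x) + s * dx \<phi> (t, x))"
      unfolding set_lebesgue_integral_def
    proof (intro Bochner_Integration.integral_cong refl)
      fix z :: "real \<times> real"
      obtain t x where z: "z = (t, x)" by (cases z)
      show "indicator ({0..<1} \<times> UNIV) z *\<^sub>R (case z of (t, x) \<Rightarrow> (dt \<phi> (t, x) + s * dx \<phi> (t, x)) * front (- M - 2) s t x)
        = indicator ({0..<1} \<times> UNIV) z *\<^sub>R (case z of (t, x) \<Rightarrow> dt \<phi> (t, x) + s * dx \<phi> (t, x))"
        using front[OF s, of t x "dt \<phi> (t, x) + s * dx \<phi> (t, x)"] M(2)[of t x]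
        by (auto simp: z indicator_def)
    qed
    moreover have "(LINT x|lborel. \<phi> (0, x) * front (- M - 2) s 0 x) = (LINT x|lborel. \<phi> (0, x))"
      using front[OF s, of 0] M(2)[of 0] by (intro Bochner_Integration.integral_cong refl) auto
    ultimately show ?thesis using test_function_front[OF \<phi>, of s "- M - 2"] by simp
  qed
  have [measurable]: "({0..<1} \<times> UNIV :: (real \<times> real) set) \<in> sets borel"
    by (simp add: borel_Times)
  have ti: "set_integrable lborel ({0..<1} \<times> UNIV) (\<lambda>(t, x). dt \<phi> (t, x))"
    "set_integrable lborel ({0..<1} \<times> UNIV) (\<lambda>(t, x). dx \<phi> (t, x))"
    using test_function_integrable[OF \<phi>, of "\<lambda>z. indicator ({0..<1} \<times> UNIV) z :: real" 1]
    unfolding set_integrable_def by (simp_all add: mult.commute)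
  show "(LINT (t, x):{0..<1} \<times> UNIV|lborel. dt \<phi> (t, x)) + (LINT x|lborel. \<phi> (0, x)) = 0"
    using a[of 0] by simp
  with a[of 1] set_integral_add(2)[OF ti]
  show "(LINT (t, x):{0..<1} \<times> UNIV|lborel. dx \<phi> (t, x)) = 0"
    by (simp add: case_prod_unfold)
qed

section \<open>Weak formulations and superposition of fronts\<close>

text \<open>Density P and flux Q are independent and take values in any Euclidean space, so the same
  calculus serves the system and its entropy inequality. The time horizon is fixed to 1.\<close>

definition weak_form :: "(real \<Rightarrow> real \<Rightarrow> 'b::euclidean_space) \<Rightarrow> (real \<Rightarrow> real \<Rightarrow> 'b)
    \<Rightarrow> (real \<times> real \<Rightarrow> real) \<Rightarrow> 'b" where
  "weak_form P Q \<phi> =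
     (LINT (t, x):{0..<1} \<times> UNIV|lborel. dt \<phi> (t, x) *\<^sub>R P t x + dx \<phi> (t, x) *\<^sub>R Q t x)
     + (LINT x|lborel. \<phi> (0, x) *\<^sub>R P 0 x)"

lemma weak_form_cong:
  assumes "\<And>t x. t \<in> {0..<1} \<Longrightarrow> P t x = P' t x" "\<And>t x. t \<in> {0..<1} \<Longrightarrow> Q t x = Q' t x"
  shows "weak_form P Q \<phi> = weak_form P' Q' \<phi>"
  unfolding weak_form_def set_lebesgue_integral_def
  using assms by (intro arg_cong2[where f = "(+)"] Bochner_Integration.integral_cong refl)
    (auto simp: indicator_def)

definition bounded_field :: "(real \<Rightarrow> real \<Rightarrow> 'b::euclidean_space) \<Rightarrow> bool" where
  "bounded_field P \<longleftrightarrow> (\<lambda>(t, x). P t x) \<in> borel_measurable borel \<and> (\<exists>B. \<forall>t x. norm (P t x) \<le> B)"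

lemma bounded_field_const: "bounded_field (\<lambda>t x. c)"
  by (auto simp: bounded_field_def case_prod_unfold)

lemma bounded_field_slice:
  assumes "bounded_field P" shows "P t \<in> borel_measurable borel"
proof -
  have "(\<lambda>x. (t, x)) \<in> borel \<rightarrow>\<^sub>M (borel :: (real \<times> real) measure)"
    by (intro borel_measurable_continuous_onI continuous_intros)
  from measurable_compose[OF this, of "\<lambda>(t, x). P t x"] assms show ?thesis by (simp add: bounded_field_def)
qed

lemma bounded_field_add: "bounded_field P \<Longrightarrow> bounded_field Q \<Longrightarrow> bounded_field (\<lambda>t x. P t x + Q t x)"
  unfolding bounded_field_def case_prod_unfold
  by (auto intro: borel_measurable_add) (metis add_mono norm_triangle_le)

lemma bounded_field_minus: "bounded_field P \<Longrightarrow> bounded_field (\<lambda>t x. - P t x)"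
  unfolding bounded_field_def case_prod_unfold by auto

lemma bounded_field_diff: "bounded_field P \<Longrightarrow> bounded_field Q \<Longrightarrow> bounded_field (\<lambda>t x. P t x - Q t x)"
  using bounded_field_add[OF _ bounded_field_minus, of P Q] by simp

lemma weak_form_integrable:
  assumes \<phi>: "test_function 1 \<phi>" and P: "bounded_field P" "bounded_field Q"
  shows "set_integrable lborel ({0..<1} \<times> UNIV) (\<lambda>(t, x). dt \<phi> (t, x) *\<^sub>R P t x + dx \<phi> (t, x) *\<^sub>R Q t x)"
    "integrable lborel (\<lambda>x. \<phi> (0, x) *\<^sub>R P 0 x)"
proof -
  obtain B C where B: "\<And>t x. norm (P t x) \<le> B" "\<And>t x. norm (Q t x) \<le> C" using P by (auto simp: bounded_field_def)
  have m: "(\<lambda>z. P (fst z) (snd z)) \<in> borel_measurable borel" "(\<lambda>z. Q (fst z) (snd z)) \<in> borel_measurable borel"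
    using P by (auto simp: bounded_field_def case_prod_unfold)
  have S: "({0..<1} \<times> UNIV :: (real \<times> real) set) \<in> sets lborel" by (simp add: borel_Times)
  have "integrable lborel (\<lambda>z. dt \<phi> z *\<^sub>R P (fst z) (snd z) + dx \<phi> z *\<^sub>R Q (fst z) (snd z))"
    using test_function_integrable(1)[OF \<phi> m(1) B(1)] test_function_integrable(2)[OF \<phi> m(2) B(2)]
    by (rule Bochner_Integration.integrable_add)
  thus "set_integrable lborel ({0..<1} \<times> UNIV) (\<lambda>(t, x). dt \<phi> (t, x) *\<^sub>R P t x + dx \<phi> (t, x) *\<^sub>R Q t x)"
    unfolding set_integrable_def using integrable_mult_indicator[OF S] by (simp add: case_prod_unfold)
  show "integrable lborel (\<lambda>x. \<phi> (0, x) *\<^sub>R P 0 x)"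
    by (rule test_function_integrable_initial[OF \<phi> bounded_field_slice[OF P(1)] B(1)])
qed

lemma weak_form_add:
  assumes \<phi>: "test_function 1 \<phi>"
    and P: "bounded_field P" "bounded_field Q" and P': "bounded_field P'" "bounded_field Q'"
  shows "weak_form (\<lambda>t x. P t x + P' t x) (\<lambda>t x. Q t x + Q' t x) \<phi> = weak_form P Q \<phi> + weak_form P' Q' \<phi>"
proof -
  have "(LINT (t, x):{0..<1} \<times> UNIV|lborel. dt \<phi> (t, x) *\<^sub>R (P t x + P' t x) + dx \<phi> (t, x) *\<^sub>R (Q t x + Q' t x))
    = (LINT y:{0..<1} \<times> UNIV|lborel. (case y of (t, x) \<Rightarrow> dt \<phi> (t, x) *\<^sub>R P t x + dx \<phi> (t, x) *\<^sub>R Q t x)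
        + (case y of (t, x) \<Rightarrow> dt \<phi> (t, x) *\<^sub>R P' t x + dx \<phi> (t, x) *\<^sub>R Q' t x))"
    unfolding set_lebesgue_integral_def
    by (intro Bochner_Integration.integral_cong refl) (auto simp: scaleR_add_right split: prod.split)
  also have "\<dots> = (LINT (t, x):{0..<1} \<times> UNIV|lborel. dt \<phi> (t, x) *\<^sub>R P t x + dx \<phi> (t, x) *\<^sub>R Q t x)
      + (LINT (t, x):{0..<1} \<times> UNIV|lborel. dt \<phi> (t, x) *\<^sub>R P' t x + dx \<phi> (t, x) *\<^sub>R Q' t x)"
    by (rule set_integral_add(2)[OF weak_form_integrable(1)[OF \<phi> P] weak_form_integrable(1)[OF \<phi> P']])
  finally show ?thesis unfolding weak_form_def
    using Bochner_Integration.integral_add[OF weak_form_integrable(2)[OF \<phi> P] weak_form_integrable(2)[OF \<phi> P']]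
    by (simp add: scaleR_add_right)
qed

lemma weak_form_const:
  fixes a b :: "'b::euclidean_space"
  assumes \<phi>: "test_function 1 \<phi>"
  shows "weak_form (\<lambda>t x. a) (\<lambda>t x. b) \<phi> = 0"
proof -
  have S: "({0..<1} \<times> UNIV :: (real \<times> real) set) \<in> sets lborel" by (simp add: borel_Times)
  have ti: "integrable lborel (\<lambda>z. indicator ({0..<1} \<times> UNIV) z *\<^sub>R dt \<phi> z)"
    "integrable lborel (\<lambda>z. indicator ({0..<1} \<times> UNIV) z *\<^sub>R dx \<phi> z)" "integrable lborel (\<lambda>x. \<phi> (0, x))"
    using integrable_mult_indicator[OF S, of "dt \<phi>"] integrable_mult_indicator[OF S, of "dx \<phi>"]
      test_function_integrable[OF \<phi>, of "\<lambda>_. 1::real" 1]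
      test_function_integrable_initial[OF \<phi>, of "\<lambda>_. 1::real" 1] by simp_all
  have "(LINT (t, x):{0..<1} \<times> UNIV|lborel. dt \<phi> (t, x) *\<^sub>R a + dx \<phi> (t, x) *\<^sub>R b)
    = (\<integral>z. (indicator ({0..<1} \<times> UNIV) z *\<^sub>R dt \<phi> z) *\<^sub>R a + (indicator ({0..<1} \<times> UNIV) z *\<^sub>R dx \<phi> z) *\<^sub>R b \<partial>lborel)"
    unfolding set_lebesgue_integral_def
    by (intro Bochner_Integration.integral_cong refl) (auto simp: scaleR_add_right split: prod.split)
  also have "\<dots> = (\<integral>z. indicator ({0..<1} \<times> UNIV) z *\<^sub>R dt \<phi> z \<partial>lborel) *\<^sub>R a
      + (\<integral>z. indicator ({0..<1} \<times> UNIV) z *\<^sub>R dx \<phi> z \<partial>lborel) *\<^sub>R b"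
    using ti by (subst Bochner_Integration.integral_add) (auto simp del: scaleR_scaleR)
  also have "(\<integral>z. indicator ({0..<1} \<times> UNIV) z *\<^sub>R dx \<phi> z \<partial>lborel) = 0"
    using test_function_const(2)[OF \<phi>] by (simp add: set_lebesgue_integral_def case_prod_unfold)
  also have "(\<integral>z. indicator ({0..<1} \<times> UNIV) z *\<^sub>R dt \<phi> z \<partial>lborel) = - (LINT x|lborel. \<phi> (0, x))"
    using test_function_const(1)[OF \<phi>] by (simp add: set_lebesgue_integral_def case_prod_unfold)
  finally show ?thesis using ti(3) by (simp add: weak_form_def case_prod_unfold)
qed

text \<open>The front with parameter \<open>z\<close> has jump \<open>k z\<close> in the density and
  \<open>l z\<close> times this in the flux, so each one satisfies the jump condition for its own
  speed. Fubini reduces the claim to \<open>test_function_front\<close> for every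
  \<open>z\<close>.\<close>

lemma weak_superposition:
  fixes k :: "real \<Rightarrow> 'b::euclidean_space" and x0 l :: "real \<Rightarrow> real"
  assumes \<phi>: "test_function 1 \<phi>"
    and m [measurable]: "x0 \<in> borel_measurable borel" "l \<in> borel_measurable borel" "k \<in> borel_measurable borel"
    and K: "\<And>z. z \<in> {p..q} \<Longrightarrow> norm (k z) \<le> K" and L: "\<And>z. z \<in> {p..q} \<Longrightarrow> \<bar>l z\<bar> \<le> L"
    and True: "p \<le> q"
    and G: "\<And>t x. t \<in> {0..<1} \<Longrightarrow> G t x = (\<integral>z. (indicator {p..q} z * front (x0 z) (l z) t x) *\<^sub>R k z \<partial>lborel)"
    and H: "\<And>t x. t \<in> {0..<1} \<Longrightarrow> H t x = (\<integral>z. (indicator {p..q} z * front (x0 z) (l z) t x * l z) *\<^sub>R k z \<partial>lborel)"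
  shows "weak_form G H \<phi> = 0"
  unfolding weak_form_def
proof -
  note [measurable] = test_function_measurable[OF \<phi>]
  obtain M where M: "M > 0"
    "\<And>t x. \<not> (\<bar>t\<bar> \<le> M \<and> \<bar>x\<bar> \<le> M \<and> t < 1) \<Longrightarrow> \<phi> (t, x) = 0 \<and> dt \<phi> (t, x) = 0 \<and> dx \<phi> (t, x) = 0"
    using test_function_support[OF \<phi>] by blast
  obtain B where B: "\<And>z. \<bar>\<phi> z\<bar> \<le> B" "\<And>z. \<bar>dt \<phi> z\<bar> \<le> B" "\<And>z. \<bar>dx \<phi> z\<bar> \<le> B"
    using test_function_bound[OF \<phi>] by blast
  have B0: "0 \<le> B" using order_trans[OF abs_ge_zero B(1)] .
  have K0: "0 \<le> K" using order_trans[OF norm_ge_zero K[of p]] True by auto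
  have L0: "0 \<le> L" using order_trans[OF abs_ge_zero L[of p]] True by auto
  let ?S = "\<lambda>t. indicator {0..<1::real} t :: real"
  let ?I = "\<lambda>z. indicator {p..q} z :: real"
  define \<Psi> where "\<Psi> z t x = (?I z * front (x0 z) (l z) t x * (?S t * (dt \<phi> (t, x) + l z * dx \<phi> (t, x)))) *\<^sub>R k z" for z t x
  define \<Omega> where "\<Omega> z x = (?I z * front (x0 z) (l z) 0 x * \<phi> (0, x)) *\<^sub>R k z" for z x
  have intg: "integrable lborel (\<lambda>z. (?I z * front (x0 z) (l z) t x * (a + b * l z)) *\<^sub>R k z)" for a b t x
  proof (rule integrable_bounded_compact[where C = "{p..q}" and B = "(\<bar>a\<bar> + \<bar>b\<bar> * L) * K"])
    fix z assume z: "z \<in> {p..q}"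
    have "\<bar>a + b * l z\<bar> \<le> \<bar>a\<bar> + \<bar>b\<bar> * L"
      using mult_left_mono[OF L[OF z], of "\<bar>b\<bar>"] by (intro order_trans[OF abs_triangle_ineq]) (simp add: abs_mult)
    thus "norm ((?I z * front (x0 z) (l z) t x * (a + b * l z)) *\<^sub>R k z) \<le> (\<bar>a\<bar> + \<bar>b\<bar> * L) * K"
      using K[OF z] K0 L0 z by (auto simp: front_def intro!: mult_mono)
  qed auto
  have split: "?S t *\<^sub>R (dt \<phi> (t, x) *\<^sub>R G t x + dx \<phi> (t, x) *\<^sub>R H t x) = (\<integral>z. \<Psi> z t x \<partial>lborel)" for t x
  proof (cases "t \<in> {0..<1}")
    case t: True
    have "(\<integral>z. \<Psi> z t x \<partial>lborel) = (\<integral>z. (?S t * dt \<phi> (t, x)) *\<^sub>R ((?I z * front (x0 z) (l z) t x) *\<^sub>R k z)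
        + (?S t * dx \<phi> (t, x)) *\<^sub>R ((?I z * front (x0 z) (l z) t x * l z) *\<^sub>R k z) \<partial>lborel)"
      by (intro Bochner_Integration.integral_cong refl) (simp add: \<Psi>_def algebra_simps flip: scaleR_add_left)
    also have "\<dots> = (?S t * dt \<phi> (t, x)) *\<^sub>R G t x + (?S t * dx \<phi> (t, x)) *\<^sub>R H t x"
      using intg[of t x 1 0] intg[of t x 0 1] unfolding G[OF t] H[OF t]
      by (subst Bochner_Integration.integral_add) (simp_all del: scaleR_scaleR)
    finally show ?thesis by (simp add: algebra_simps)
  qed (simp add: \<Psi>_def)
  have split0: "\<phi> (0, x) *\<^sub>R G 0 x = (\<integral>z. \<Omega> z x \<partial>lborel)" for x
  proof -
    have "(\<integral>z. \<Omega> z x \<partial>lborel) = (\<integral>z. \<phi> (0, x) *\<^sub>R ((?I z * front (x0 z) (l z) 0 x) *\<^sub>R k z) \<partial>lborel)"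
      by (intro Bochner_Integration.integral_cong refl) (simp add: \<Omega>_def algebra_simps)
    thus ?thesis using intg[of 0 x 1 0] by (simp add: G del: scaleR_scaleR)
  qed
  have int1: "integrable (lborel \<Otimes>\<^sub>M lborel) (\<lambda>(z, t, x). \<Psi> z t x)" unfolding lborel_prod
  proof (rule integrable_bounded_compact[where C = "{p..q} \<times> {-M..M} \<times> {-M..M}" and B = "(B + L * B) * K"])
    show "(\<lambda>(z, t, x). \<Psi> z t x) \<in> borel_measurable borel"
    proof -
      have f: "(fst :: real \<times> real \<times> real \<Rightarrow> _) \<in> borel \<rightarrow>\<^sub>M borel"
        "(snd :: real \<times> real \<times> real \<Rightarrow> _) \<in> borel \<rightarrow>\<^sub>M borel"
        "(fst :: real \<times> real \<Rightarrow> _) \<in> borel \<rightarrow>\<^sub>M borel" "(snd :: real \<times> real \<Rightarrow> _) \<in> borel \<rightarrow>\<^sub>M borel"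
        by (intro borel_measurable_continuous_onI continuous_on_fst continuous_on_snd continuous_on_id)+
      note [measurable] = f(1) measurable_compose[OF f(2) f(3)] measurable_compose[OF f(2) f(4)]
        measurable_compose[OF f(2) test_function_measurable(2)[OF \<phi>]]
        measurable_compose[OF f(2) test_function_measurable(3)[OF \<phi>]]
      have "(\<lambda>(z, t, x). \<Psi> z t x) = (\<lambda>y. (?I (fst y) * front (x0 (fst y)) (l (fst y)) (fst (snd y)) (snd (snd y))
          * (?S (fst (snd y)) * (dt \<phi> (snd y) + l (fst y) * dx \<phi> (snd y)))) *\<^sub>R k (fst y))"
        by (auto simp: \<Psi>_def)
      also have "\<dots> \<in> borel_measurable borel" by measurable
      finally show ?thesis .
    qed
    show "compact ({p..q} \<times> {-M..M} \<times> {-M..M})" by (intro compact_Times) auto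
    fix y :: "real \<times> real \<times> real"
    obtain z t x where y: "y = (z, t, x)" by (cases y)
    show "norm (case y of (z, t, x) \<Rightarrow> \<Psi> z t x) \<le> (B + L * B) * K" if yC: "y \<in> {p..q} \<times> {-M..M} \<times> {-M..M}"
    proof -
      have z: "z \<in> {p..q}" using that y by auto
      define X where "X = dt \<phi> (t, x) + l z * dx \<phi> (t, x)"
      have "\<bar>X\<bar> \<le> B + L * B"
        using B(2)[of "(t, x)"] mult_mono[OF L[OF z] B(3)[of "(t, x)"] L0] abs_triangle_ineq[of "dt \<phi> (t, x)" "l z * dx \<phi> (t, x)"]
        unfolding X_def by (simp add: abs_mult)
      moreover have "0 \<le> B + L * B" using B0 L0 by simp
      ultimately have "\<bar>?I z * front (x0 z) (l z) t x * (?S t * X)\<bar> \<le> B + L * B"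
        by (auto simp: front_def indicator_def)
      from mult_mono[OF this K[OF z]] \<open>0 \<le> B + L * B\<close>
      show ?thesis by (simp only: y \<Psi>_def X_def prod.case norm_scaleR real_norm_def norm_ge_zero)
    qed
    show "(case y of (z, t, x) \<Rightarrow> \<Psi> z t x) = 0" if "y \<notin> {p..q} \<times> {-M..M} \<times> {-M..M}"
    proof (cases "z \<in> {p..q}")
      case True
      hence "\<not> (\<bar>t\<bar> \<le> M \<and> \<bar>x\<bar> \<le> M \<and> t < 1)" using that y by auto
      from M(2)[OF this] show ?thesis by (simp add: y \<Psi>_def)
    qed (simp add: y \<Psi>_def)
  qed
  have int2: "integrable (lborel \<Otimes>\<^sub>M lborel) (\<lambda>(z, x). \<Omega> z x)" unfolding lborel_prod
  proof (rule integrable_bounded_compact[where C = "{p..q} \<times> {-M..M}" and B = "B * K"])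
    show "(\<lambda>(z, x). \<Omega> z x) \<in> borel_measurable borel"
      unfolding \<Omega>_def borel_prod[symmetric] by measurable
    show "compact ({p..q} \<times> {-M..M})" by (intro compact_Times) auto
    fix y :: "real \<times> real"
    obtain z x where y: "y = (z, x)" by (cases y)
    show "norm (case y of (z, x) \<Rightarrow> \<Omega> z x) \<le> B * K" if "y \<in> {p..q} \<times> {-M..M}"
    proof -
      have "\<bar>?I z * front (x0 z) (l z) 0 x * \<phi> (0, x)\<bar> \<le> B"
        using B0 B(1)[of "(0, x)"] by (auto simp: front_def indicator_def)
      from mult_mono[OF this K[of z]] that B0
      show ?thesis by (simp add: y \<Omega>_def)
    qed
    show "(case y of (z, x) \<Rightarrow> \<Omega> z x) = 0" if "y \<notin> {p..q} \<times> {-M..M}"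
    proof (cases "z \<in> {p..q}")
      case True
      hence "\<not> (\<bar>0\<bar> \<le> M \<and> \<bar>x\<bar> \<le> M \<and> 0 < (1::real))" using that y by auto
      from M(2)[OF this] show ?thesis by (simp add: y \<Omega>_def)
    qed (simp add: y \<Omega>_def)
  qed
  have "(LINT (t, x):{0..<1} \<times> UNIV|lborel. dt \<phi> (t, x) *\<^sub>R G t x + dx \<phi> (t, x) *\<^sub>R H t x)
      = (\<integral>y. (\<integral>z. (case y of (t, x) \<Rightarrow> \<Psi> z t x) \<partial>lborel) \<partial>lborel)"
    unfolding set_lebesgue_integral_def
    by (intro Bochner_Integration.integral_cong refl) (auto simp: split[symmetric] indicator_def)
  also have "\<dots> = (\<integral>z. (\<integral>y. (case y of (t, x) \<Rightarrow> \<Psi> z t x) \<partial>lborel) \<partial>lborel)"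
    by (rule lborel_pair.Fubini_integral) (use int1 in \<open>simp add: case_prod_unfold\<close>)
  also have "\<dots> = (\<integral>z. - (\<integral>x. \<Omega> z x \<partial>lborel) \<partial>lborel)"
  proof (intro Bochner_Integration.integral_cong refl)
    fix z
    have "(\<integral>y. (case y of (t, x) \<Rightarrow> \<Psi> z t x) \<partial>lborel)
        = (\<integral>y. (?I z * (indicator ({0..<1} \<times> UNIV) y * (case y of (t, x) \<Rightarrow> (dt \<phi> (t, x) + l z * dx \<phi> (t, x)) * front (x0 z) (l z) t x))) *\<^sub>R k z \<partial>lborel)"
    proof (intro Bochner_Integration.integral_cong refl)
      fix y :: "real \<times> real"
      obtain t x where y: "y = (t, x)" by (cases y)
      show "(case y of (t, x) \<Rightarrow> \<Psi> z t x) = (?I z * (indicator ({0..<1} \<times> UNIV) y *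
          (case y of (t, x) \<Rightarrow> (dt \<phi> (t, x) + l z * dx \<phi> (t, x)) * front (x0 z) (l z) t x))) *\<^sub>R k z"
        by (cases "t \<in> {0..<1}") (simp_all add: y \<Psi>_def ac_simps del: atLeastLessThan_iff)
    qed
    also have "\<dots> = (?I z * (LINT (t, x):{0..<1} \<times> UNIV|lborel. (dt \<phi> (t, x) + l z * dx \<phi> (t, x)) * front (x0 z) (l z) t x)) *\<^sub>R k z"
      using test_function_integrable_front(1)[OF \<phi>, of "l z" "x0 z"]
      by (subst integral_scaleR_left) (simp_all add: set_lebesgue_integral_def)
    also have "(LINT (t, x):{0..<1} \<times> UNIV|lborel. (dt \<phi> (t, x) + l z * dx \<phi> (t, x)) * front (x0 z) (l z) t x)
        = - (LINT x|lborel. \<phi> (0, x) * front (x0 z) (l z) 0 x)"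
      using test_function_front[OF \<phi>, of "l z" "x0 z"] by simp
    also have "(?I z * - (LINT x|lborel. \<phi> (0, x) * front (x0 z) (l z) 0 x)) *\<^sub>R k z = - (\<integral>x. \<Omega> z x \<partial>lborel)"
    proof -
      have "(\<integral>x. \<Omega> z x \<partial>lborel) = (\<integral>x. (?I z * (\<phi> (0, x) * front (x0 z) (l z) 0 x)) *\<^sub>R k z \<partial>lborel)"
        by (intro Bochner_Integration.integral_cong refl) (simp add: \<Omega>_def ac_simps)
      also have "\<dots> = (?I z * (LINT x|lborel. \<phi> (0, x) * front (x0 z) (l z) 0 x)) *\<^sub>R k z"
        using test_function_integrable_front(2)[OF \<phi>, of "x0 z" "l z"]
        by (subst integral_scaleR_left) simp_all
      finally show ?thesis by simp
    qed
    finally show "(\<integral>y. (case y of (t, x) \<Rightarrow> \<Psi> z t x) \<partial>lborel) = - (\<integral>x. \<Omega> z x \<partial>lborel)" .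
  qed
  also have "\<dots> = - (\<integral>x. \<integral>z. \<Omega> z x \<partial>lborel \<partial>lborel)"
    by (simp add: lborel_pair.Fubini_integral[OF int2])
  finally show "(LINT (t, x):{0..<1} \<times> UNIV|lborel. dt \<phi> (t, x) *\<^sub>R G t x + dx \<phi> (t, x) *\<^sub>R H t x)
     + (LINT x|lborel. \<phi> (0, x) *\<^sub>R G 0 x) = 0" by (simp add: split0)
qed

text \<open>Each front sweeps the signed area \<open>- l z * t\<close>, and Fubini sums these
  contributions. The bound \<open>X\<close> on the starting positions gives the difference compact
  support.\<close>

lemma energy_superposition:
  fixes k :: "real \<Rightarrow> real" and x0 l :: "real \<Rightarrow> real"
  assumes m [measurable]: "x0 \<in> borel_measurable borel" "l \<in> borel_measurable borel" "k \<in> borel_measurable borel"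
    and K: "\<And>z. z \<in> {p..q} \<Longrightarrow> \<bar>k z\<bar> \<le> K" and L: "\<And>z. z \<in> {p..q} \<Longrightarrow> \<bar>l z\<bar> \<le> L"
    and X: "\<And>z. z \<in> {p..q} \<Longrightarrow> \<bar>x0 z\<bar> \<le> X"
    and True: "p \<le> q" and t: "t \<in> {0..<1}"
    and G: "\<And>t x. t \<in> {0..<1} \<Longrightarrow> G t x = (\<integral>z. (indicator {p..q} z * front (x0 z) (l z) t x) * k z \<partial>lborel)"
  shows "(\<integral>x. G t x - G 0 x \<partial>lborel) = - t * (\<integral>z. indicator {p..q} z * (l z * k z) \<partial>lborel)"
proof -
  let ?I = "\<lambda>z. indicator {p..q} z :: real"
  define \<Omega> where "\<Omega> z x = ?I z * (front (x0 z) (l z) t x - front (x0 z) (l z) 0 x) * k z" for z x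
  have K0: "0 \<le> K" using order_trans[OF abs_ge_zero K[of p]] True by auto
  have intg: "integrable lborel (\<lambda>z. ?I z * front (x0 z) (l z) t x * k z)" for t x
    by (rule integrable_bounded_compact[where C = "{p..q}" and B = K])
      (use K K0 in \<open>auto simp: front_def\<close>)
  have diff: "G t x - G 0 x = (\<integral>z. \<Omega> z x \<partial>lborel)" for x
  proof -
    have "G t x - G 0 x = (\<integral>z. ?I z * front (x0 z) (l z) t x * k z - ?I z * front (x0 z) (l z) 0 x * k z \<partial>lborel)"
      using t G[OF t] G[of 0] by (subst Bochner_Integration.integral_diff[OF intg intg]) simp
    also have "\<dots> = (\<integral>z. \<Omega> z x \<partial>lborel)"
      by (intro Bochner_Integration.integral_cong refl) (simp add: \<Omega>_def algebra_simps)
    finally show ?thesis .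
  qed
  let ?R = "X + L * \<bar>t\<bar>"
  have int2: "integrable (lborel \<Otimes>\<^sub>M lborel) (\<lambda>(z, x). \<Omega> z x)" unfolding lborel_prod
  proof (rule integrable_bounded_compact[where C = "{p..q} \<times> {-?R..?R}" and B = K])
    show "(\<lambda>(z, x). \<Omega> z x) \<in> borel_measurable borel"
      unfolding \<Omega>_def borel_prod[symmetric] by measurable
    show "compact ({p..q} \<times> {-?R..?R})" by (intro compact_Times) auto
    fix y :: "real \<times> real"
    obtain z x where y: "y = (z, x)" by (cases y)
    show "norm (case y of (z, x) \<Rightarrow> \<Omega> z x) \<le> K" if "y \<in> {p..q} \<times> {-?R..?R}"
      using that K[of z] K0 by (auto simp: y \<Omega>_def front_def)
    show "(case y of (z, x) \<Rightarrow> \<Omega> z x) = 0" if "y \<notin> {p..q} \<times> {-?R..?R}"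
    proof (cases "z \<in> {p..q}")
      case True
      have "\<bar>l z * t\<bar> \<le> L * \<bar>t\<bar>" using L[OF True] by (simp add: abs_mult mult_right_mono)
      moreover have "0 \<le> L * \<bar>t\<bar>" using L[OF True] by simp
      ultimately have "front (x0 z) (l z) t x = front (x0 z) (l z) 0 x"
        using X[OF True] that True unfolding y front_def by (auto simp: abs_le_iff)
      thus ?thesis by (simp add: y \<Omega>_def)
    qed (simp add: y \<Omega>_def)
  qed
  have "(\<integral>x. G t x - G 0 x \<partial>lborel) = (\<integral>x. \<integral>z. \<Omega> z x \<partial>lborel \<partial>lborel)" by (simp add: diff)
  also have "\<dots> = (\<integral>z. \<integral>x. \<Omega> z x \<partial>lborel \<partial>lborel)" by (rule lborel_pair.Fubini_integral[OF int2])
  also have "\<dots> = (\<integral>z. - t * (?I z * (l z * k z)) \<partial>lborel)"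
    by (intro Bochner_Integration.integral_cong refl)
      (simp add: \<Omega>_def integral_front_diff)
  finally show ?thesis by simp
qed

context planar_mhd
begin

subsection \<open>Transitions between constant states\<close>

abbreviation fl where "fl \<equiv> flux \<beta> \<gamma>"
abbreviation ent where "ent \<equiv> eta \<gamma>"
abbreviation entf where "entf \<equiv> entropy_flux \<beta> \<gamma>"

lemma continuous_on_ent: "continuous_on states ent"
  by (intro continuous_at_imp_continuous_on ballI has_derivative_continuous[OF eta_has_derivative])

lemma continuous_on_p: "continuous_on states (\<lambda>U. p (fst U))"
  unfolding pressure_def[abs_def] by (intro continuous_intros) (auto simp: states_def)

lemma continuous_on_fl: "continuous_on states fl"
proof -
  have "fl U = (- fst (snd (snd (snd U))), - \<beta> * fst (snd (snd (snd (snd U)))), - \<beta> * snd (snd (snd (snd (snd U)))),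
      p (fst U) + ((fst (snd U))\<^sup>2 + (fst (snd (snd U)))\<^sup>2) / (2 * (fst U)\<^sup>2),
      - \<beta> * (fst (snd U) / fst U), - \<beta> * (fst (snd (snd U)) / fst U))" for U
    by (cases U) auto
  hence "fl = (\<lambda>U. (- fst (snd (snd (snd U))), - \<beta> * fst (snd (snd (snd (snd U)))), - \<beta> * snd (snd (snd (snd (snd U)))),
      p (fst U) + ((fst (snd U))\<^sup>2 + (fst (snd (snd U)))\<^sup>2) / (2 * (fst U)\<^sup>2),
      - \<beta> * (fst (snd U) / fst U), - \<beta> * (fst (snd (snd U)) / fst U)))" by (rule ext)
  thus ?thesis
    by (simp only:) (intro continuous_intros continuous_on_p; auto simp: states_def)
qed

lemma continuous_on_entf: "continuous_on states entf"
proof -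
  have "entf U = (p (fst U) + ((fst (snd U))\<^sup>2 + (fst (snd (snd U)))\<^sup>2) / (2 * (fst U)\<^sup>2)) * fst (snd (snd (snd U)))
      - \<beta> / fst U * (fst (snd U) * fst (snd (snd (snd (snd U)))) + fst (snd (snd U)) * snd (snd (snd (snd (snd U)))))" for U
    by (cases U) auto
  hence "entf = (\<lambda>U. (p (fst U) + ((fst (snd U))\<^sup>2 + (fst (snd (snd U)))\<^sup>2) / (2 * (fst U)\<^sup>2)) * fst (snd (snd (snd U)))
      - \<beta> / fst U * (fst (snd U) * fst (snd (snd (snd (snd U)))) + fst (snd (snd U)) * snd (snd (snd (snd (snd U))))))"
    by (rule ext)
  thus ?thesis
    by (simp only:) (intro continuous_intros continuous_on_p; auto simp: states_def)
qed

lemma continuous_on_rel: "V \<in> states \<Longrightarrow> continuous_on states (\<lambda>U. rel U V)"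
  by (simp only: rel_eq) (intro continuous_intros continuous_on_ent)

text \<open>A compact subset of \<open>states\<close>, not merely a bounded one: it keeps the volume
  away from 0, so that flux, entropy and relative entropy stay bounded along the solution.\<close>

definition compact_valued :: "(real \<Rightarrow> real \<Rightarrow> state) \<Rightarrow> bool" where
  "compact_valued w \<longleftrightarrow> (\<lambda>(t, x). w t x) \<in> borel_measurable borel
     \<and> (\<exists>K. compact K \<and> K \<subseteq> states \<and> (\<forall>t x. w t x \<in> K))"

lemma compact_valued_states: "compact_valued w \<Longrightarrow> w t x \<in> states"
  by (auto simp: compact_valued_def)

lemma compact_valued_compose:
  fixes g :: "state \<Rightarrow> 'b::euclidean_space"
  assumes w: "compact_valued w" and g: "continuous_on states g"
  shows "bounded_field (\<lambda>t x. g (w t x))"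
  unfolding bounded_field_def
proof
  obtain K where K: "compact K" "K \<subseteq> states" "\<And>t x. w t x \<in> K" using w by (auto simp: compact_valued_def)
  have "(\<lambda>U. indicator states U *\<^sub>R g U) \<in> borel_measurable borel"
    using g open_states by (intro borel_measurable_continuous_on_indicator) auto
  moreover have "(\<lambda>z. w (fst z) (snd z)) \<in> borel_measurable borel"
    using w by (auto simp: compact_valued_def case_prod_unfold)
  ultimately have "(\<lambda>z. indicator states (w (fst z) (snd z)) *\<^sub>R g (w (fst z) (snd z))) \<in> borel_measurable borel"
    by (rule measurable_compose[rotated])
  thus "(\<lambda>(t, x). g (w t x)) \<in> borel_measurable borel"
    by (simp add: case_prod_unfold compact_valued_states[OF w])
  have "compact (g ` K)" using K g by (intro compact_continuous_image) (auto intro: continuous_on_subset)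
  then obtain B where "\<And>y. y \<in> g ` K \<Longrightarrow> norm y \<le> B" using compact_imp_bounded by (force simp: bounded_iff)
  thus "\<exists>B. \<forall>t x. norm (g (w t x)) \<le> B" using K by (auto intro!: exI[of _ B])
qed

lemma compact_valued_if:
  assumes "compact_valued w1" "compact_valued w2" and P: "{z. P (fst z) (snd z)} \<in> sets (borel :: (real \<times> real) measure)"
  shows "compact_valued (\<lambda>t x. if P t x then w1 t x else w2 t x)"
  unfolding compact_valued_def
proof
  have m: "(\<lambda>z. w1 (fst z) (snd z)) \<in> borel_measurable borel" "(\<lambda>z. w2 (fst z) (snd z)) \<in> borel_measurable borel"
    using assms by (auto simp: compact_valued_def case_prod_unfold)
  show "(\<lambda>(t, x). if P t x then w1 t x else w2 t x) \<in> borel_measurable borel"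
    using measurable_If[OF m, of "\<lambda>z. P (fst z) (snd z)"] P by (simp add: case_prod_unfold)
  obtain K1 K2 where "compact K1" "K1 \<subseteq> states" "\<And>t x. w1 t x \<in> K1" "compact K2" "K2 \<subseteq> states" "\<And>t x. w2 t x \<in> K2"
    using assms by (auto simp: compact_valued_def)
  thus "\<exists>K. compact K \<and> K \<subseteq> states \<and> (\<forall>t x. (if P t x then w1 t x else w2 t x) \<in> K)"
    by (intro exI[of _ "K1 \<union> K2"]) auto
qed

lemma compact_valued_const: "A \<in> states \<Longrightarrow> compact_valued (\<lambda>t x. A)"
  by (auto simp: compact_valued_def case_prod_unfold intro!: exI[of _ "{A}"])

text \<open>The number d is the total dissipation rate.  The last clause is the entropy balance relative to every
  constant state V; it is additive under concatenation of transitions.  The profile at t = 0 need not be a step.\<close>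

definition transition :: "state \<Rightarrow> state \<Rightarrow> real \<Rightarrow> real \<Rightarrow> real \<Rightarrow> (real \<Rightarrow> real \<Rightarrow> state) \<Rightarrow> bool" where
  "transition A B d l r w \<longleftrightarrow> l \<le> r \<and> compact_valued w
     \<and> (\<forall>t\<in>{0..<1}. \<forall>x. (x \<le> l \<longrightarrow> w t x = A) \<and> (r \<le> x \<longrightarrow> w t x = B))
     \<and> (\<forall>t\<in>{0..<1}. AE x in lborel. continuous (at t within {0..<1}) (\<lambda>s. w s x))
     \<and> (\<forall>\<phi>. test_function 1 \<phi> \<longrightarrow> weak_form w (\<lambda>t x. fl (w t x)) \<phi> = 0)
     \<and> (\<forall>\<phi>. test_function 1 \<phi> \<longrightarrow> (\<forall>z. 0 \<le> \<phi> z) \<longrightarrow>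
          0 \<le> weak_form (\<lambda>t x. ent (w t x)) (\<lambda>t x. entf (w t x)) \<phi>)
     \<and> (\<forall>V\<in>states. \<forall>t\<in>{0..<1}. (\<integral>x. rel (w t x) V - rel (w 0 x) V \<partial>lborel) = t * (qf A V - qf B V - d))"

lemma bounded_field_locally_integrable:
  assumes "bounded_field P" shows "locally_integrable_on (\<lambda>(t, x). P t x) D"
  unfolding locally_integrable_on_def
proof (intro allI impI)
  fix K :: "(real \<times> real) set" assume "compact K \<and> K \<subseteq> D"
  hence K: "compact K" "K \<in> sets borel" by (auto intro: compact_imp_closed borel_closed)
  obtain B where B: "\<And>t x. norm (P t x) \<le> B" "(\<lambda>(t, x). P t x) \<in> borel_measurable borel"
    using assms by (auto simp: bounded_field_def)
  show "set_integrable lborel K (\<lambda>(t, x). P t x)"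
    unfolding set_integrable_def
    by (rule integrable_bounded_compact[OF _ K(1), where B = B])
      (use B K(2) in \<open>auto intro!: borel_measurable_scaleR\<close>)
qed

text \<open>Weak-* continuity in time comes from continuity in t at almost every x by dominated
  convergence; the compact range supplies the dominating function and all local
  integrability.\<close>

lemma transition_entropy_solution:
  assumes T: "transition A B d l r w"
  shows "entropy_solution \<beta> \<gamma> 1 w"
proof -
  have w: "compact_valued w" using T by (simp add: transition_def)
  obtain K where K: "compact K" "K \<subseteq> states" "\<And>t x. w t x \<in> K" using w by (auto simp: compact_valued_def)
  have bf: "bounded_field w" "bounded_field (\<lambda>t x. fl (w t x))" "bounded_field (\<lambda>t x. ent (w t x))"
      "bounded_field (\<lambda>t x. entf (w t x))"
    using compact_valued_compose[OF w continuous_on_id] compact_valued_compose[OF w continuous_on_fl]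
      compact_valued_compose[OF w continuous_on_ent] compact_valued_compose[OF w continuous_on_entf] by auto
  have cont: "continuous_on {0..<1} (\<lambda>t. LINT x|lborel. \<psi> x *\<^sub>R w t x)" if \<psi>: "integrable lborel \<psi>" for \<psi> :: "real \<Rightarrow> real"
    unfolding continuous_on_sequentially
  proof (intro allI ballI impI)
    fix t and \<tau> :: "nat \<Rightarrow> real" assume t: "t \<in> {0..<1}" and "(\<forall>n. \<tau> n \<in> {0..<1}) \<and> \<tau> \<longlonglongrightarrow> t"
    hence \<tau>: "\<And>n. \<tau> n \<in> {0..<1}" "\<tau> \<longlonglongrightarrow> t" by auto
    obtain B where B: "\<And>t x. norm (w t x) \<le> B" using bf(1) by (auto simp: bounded_field_def)
    note [measurable] = bounded_field_slice[OF bf(1)] borel_measurable_integrable[OF \<psi>]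
    show "((\<lambda>t. LINT x|lborel. \<psi> x *\<^sub>R w t x) \<circ> \<tau>) \<longlonglongrightarrow> (LINT x|lborel. \<psi> x *\<^sub>R w t x)"
      unfolding o_def
    proof (rule integral_dominated_convergence[where w = "\<lambda>x. norm (\<psi> x) * B"])
      show "integrable lborel (\<lambda>x. norm (\<psi> x) * B)" using \<psi> by (intro integrable_mult_left integrable_norm)
      have "AE x in lborel. continuous (at t within {0..<1}) (\<lambda>s. w s x)" using T t by (simp add: transition_def)
      thus "AE x in lborel. (\<lambda>n. \<psi> x *\<^sub>R w (\<tau> n) x) \<longlonglongrightarrow> \<psi> x *\<^sub>R w t x"
      proof eventually_elim
        case (elim x)
        thus ?case using \<tau> by (auto simp: continuous_within_sequentially o_def intro!: tendsto_intros)
      qed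
      show "AE x in lborel. norm (\<psi> x *\<^sub>R w (\<tau> n) x) \<le> norm (\<psi> x) * B" for n
        using B by (auto intro!: AE_I2 mult_left_mono)
    qed measurable
  qed
  have S: "({0..<1} \<times> UNIV :: (real \<times> real) set) \<in> sets borel" by (simp add: borel_Times)
  have slice: "locally_integrable_on (\<lambda>x. ent (w 0 x)) UNIV"
    unfolding locally_integrable_on_def
  proof (intro allI impI)
    fix C :: "real set" assume "compact C \<and> C \<subseteq> UNIV"
    hence C: "compact C" "C \<in> sets borel" by (auto intro: compact_imp_closed borel_closed)
    obtain B where B: "\<And>t x. norm (ent (w t x)) \<le> B" using bf(3) by (auto simp: bounded_field_def)
    show "set_integrable lborel C (\<lambda>x. ent (w 0 x))"
      unfolding set_integrable_def
      by (rule integrable_bounded_compact[OF _ C(1), where B = B])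
        (use B C(2) bounded_field_slice[OF bf(3)] in \<open>auto intro!: borel_measurable_scaleR\<close>)
  qed
  have "bounded {w t x |t x. t \<in> {0..<1}}"
    using compact_imp_bounded[OF K(1)] by (rule bounded_subset) (use K(3) in auto)
  moreover have "set_borel_measurable borel ({0..<1} \<times> UNIV) (\<lambda>(t, x). w t x)"
    unfolding set_borel_measurable_def using bf(1) S by (auto simp: bounded_field_def)
  ultimately have "weak_solution \<beta> \<gamma> 1 w"
    unfolding weak_solution_def
    using compact_valued_states[OF w] cont bounded_field_locally_integrable[OF bf(2)] T
    by (auto simp: transition_def weak_form_def)
  thus ?thesis
    unfolding entropy_solution_def
    using bounded_field_locally_integrable[OF bf(3)] bounded_field_locally_integrable[OF bf(4)] slice T
    by (auto simp: transition_def weak_form_def)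
qed

lemma transition_integrable:
  assumes T: "transition A B d l r w" and V: "V \<in> states" and t: "t \<in> {0..<1}"
  shows "integrable lborel (\<lambda>x. rel (w t x) V - rel (w 0 x) V)"
proof -
  have w: "compact_valued w" using T by (simp add: transition_def)
  note bf = compact_valued_compose[OF w continuous_on_rel[OF V]]
  obtain b where b: "\<And>t x. norm (rel (w t x) V) \<le> b" using bf by (auto simp: bounded_field_def)
  show ?thesis
  proof (rule integrable_bounded_compact[where C = "{l..r}" and B = "b + b"])
    show "norm (rel (w t x) V - rel (w 0 x) V) \<le> b + b" for x
      by (rule order_trans[OF norm_triangle_ineq4 add_mono[OF b b]])
    show "rel (w t x) V - rel (w 0 x) V = 0" if "x \<notin> {l..r}" for x
      using that T t by (cases "x \<le> l") (auto simp: transition_def)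
  qed (use bounded_field_slice[OF bf] in auto)
qed

text \<open>The two waves occupy adjacent intervals and never interact before time 1, so all
  balances simply add.\<close>

lemma transition_concat:
  assumes T1: "transition A B d1 l m w1" and T2: "transition B C d2 m r w2"
  shows "transition A C (d1 + d2) l r (\<lambda>t x. if x \<le> m then w1 t x else w2 t x)" (is "transition _ _ _ _ _ ?w")
proof -
  have w: "compact_valued w1" "compact_valued w2" and lmr: "l \<le> m" "m \<le> r" using T1 T2 by (auto simp: transition_def)
  have cv: "compact_valued ?w"
  proof (rule compact_valued_if[OF w])
    have "closed {z::real \<times> real. snd z \<le> m}" by (intro closed_Collect_le continuous_intros)
    thus "{z::real \<times> real. snd z \<le> m} \<in> sets borel" by (rule borel_closed)
  qed
  \<comment> \<open>At every point one of the two waves has the value B. Hence each function of the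
    state is additive up to the constant \<open>g B\<close>, and no cross terms arise however
    nonlinear \<open>g\<close> is.\<close>
  have eq: "g (?w t x) = g (w1 t x) + (g (w2 t x) + - g B)" if "t \<in> {0..<1}" for t x and g :: "state \<Rightarrow> 'b::euclidean_space"
    using T1 T2 that by (cases "x \<le> m") (auto simp: transition_def)
  have wf: "weak_form (\<lambda>t x. g (?w t x)) (\<lambda>t x. h (?w t x)) \<phi> =
      weak_form (\<lambda>t x. g (w1 t x)) (\<lambda>t x. h (w1 t x)) \<phi> + weak_form (\<lambda>t x. g (w2 t x)) (\<lambda>t x. h (w2 t x)) \<phi>"
    if g: "continuous_on states g" and h: "continuous_on states h" and \<phi>: "test_function 1 \<phi>"
    for g h :: "state \<Rightarrow> 'b::euclidean_space" and \<phi>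
  proof -
    note b = compact_valued_compose[OF w(1) g] compact_valued_compose[OF w(1) h]
      compact_valued_compose[OF w(2) g] compact_valued_compose[OF w(2) h]
    have "weak_form (\<lambda>t x. g (?w t x)) (\<lambda>t x. h (?w t x)) \<phi>
      = weak_form (\<lambda>t x. g (w1 t x) + (g (w2 t x) + - g B)) (\<lambda>t x. h (w1 t x) + (h (w2 t x) + - h B)) \<phi>"
      by (rule weak_form_cong) (rule eq; assumption)+
    also have "\<dots> = weak_form (\<lambda>t x. g (w1 t x)) (\<lambda>t x. h (w1 t x)) \<phi> + weak_form (\<lambda>t x. g (w2 t x)) (\<lambda>t x. h (w2 t x)) \<phi>"
      using b by (simp add: weak_form_add[OF \<phi>] bounded_field_add bounded_field_const bounded_field_diff weak_form_const[OF \<phi>] del: add_uminus_conv_diff)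
    finally show ?thesis .
  qed
  have en: "(\<integral>x. rel (?w t x) V - rel (?w 0 x) V \<partial>lborel) = t * (qf A V - qf C V - (d1 + d2))"
    if V: "V \<in> states" and t: "t \<in> {0..<1}" for V t
  proof -
    have "rel (?w t x) V - rel (?w 0 x) V = (rel (w1 t x) V - rel (w1 0 x) V) + (rel (w2 t x) V - rel (w2 0 x) V)" for x
      using eq[OF t, of "\<lambda>U. rel U V" x] eq[of 0 "\<lambda>U. rel U V" x] by simp
    hence "(\<integral>x. rel (?w t x) V - rel (?w 0 x) V \<partial>lborel)
      = (\<integral>x. rel (w1 t x) V - rel (w1 0 x) V \<partial>lborel) + (\<integral>x. rel (w2 t x) V - rel (w2 0 x) V \<partial>lborel)"
      using Bochner_Integration.integral_add[OF transition_integrable[OF T1 V t] transition_integrable[OF T2 V t]] by presburger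
    also have "\<dots> = t * (qf A V - qf B V - d1) + t * (qf B V - qf C V - d2)"
      using T1 T2 V t by (auto simp: transition_def)
    finally show ?thesis by (simp add: algebra_simps)
  qed
  have ae: "AE x in lborel. continuous (at t within {0..<1}) (\<lambda>s. ?w s x)" if t: "t \<in> {0..<1}" for t
  proof -
    have "AE x in lborel. continuous (at t within {0..<1}) (\<lambda>s. w1 s x)"
      "AE x in lborel. continuous (at t within {0..<1}) (\<lambda>s. w2 s x)" using T1 T2 t by (auto simp: transition_def)
    thus ?thesis
    proof eventually_elim
      case (elim x) thus ?case by (cases "x \<le> m") simp_all
    qed
  qed
  show ?thesis unfolding transition_def
  proof (intro conjI ballI allI impI)
    fix \<phi> assume \<phi>: "test_function 1 \<phi>"
    show "weak_form ?w (\<lambda>t x. fl (?w t x)) \<phi> = 0"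
      using wf[OF continuous_on_id continuous_on_fl \<phi>] T1 T2 \<phi> by (simp add: transition_def)
    assume "\<forall>z. 0 \<le> \<phi> z"
    thus "0 \<le> weak_form (\<lambda>t x. ent (?w t x)) (\<lambda>t x. entf (?w t x)) \<phi>"
      unfolding wf[OF continuous_on_ent continuous_on_entf \<phi>] using T1 T2 \<phi> by (simp add: transition_def)
  next
    fix t x :: real assume t: "t \<in> {0..<1}"
    show "?w t x = A" if "x \<le> l" using that T1 t lmr by (simp add: transition_def)
    have w2: "\<And>x. x \<le> m \<Longrightarrow> w2 t x = B" "\<And>x. r \<le> x \<Longrightarrow> w2 t x = C" and w1: "\<And>x. m \<le> x \<Longrightarrow> w1 t x = B"
      using T1 T2 t by (simp_all add: transition_def)
    show "?w t x = C" if "r \<le> x"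
      using that lmr w1[of x] w2(1)[of x] w2(2)[of x] by (cases "x \<le> m") auto
  qed (use cv lmr en ae in auto)
qed

lemma integral_unit_const: "(\<integral>z. (indicator {0..1::real} z * a) *\<^sub>R k \<partial>lborel) = a *\<^sub>R (k :: 'b::euclidean_space)"
proof -
  have "integrable lborel (\<lambda>z. indicator {0..1::real} z * a)" by (intro integrable_mult_left) simp
  thus ?thesis by (subst integral_scaleR_left) simp_all
qed

text \<open>The profile is a single front. Its entropy flux jump is s times the entropy jump, which
  balances exactly, minus the dissipation, whose sign is known.\<close>

lemma transition_shock:
  assumes AB: "A \<in> states" "B \<in> states" and RH: "RH A B s" and d: "0 \<le> diss A B s"
  shows "transition A B (diss A B s) (c - \<bar>s\<bar>) (c + \<bar>s\<bar> + 1) (\<lambda>t x. if x \<le> c + s * t then A else B)"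
    (is "transition _ _ _ _ _ ?w")
proof -
  have cv: "compact_valued ?w"
  proof (rule compact_valued_if[OF compact_valued_const[OF AB(1)] compact_valued_const[OF AB(2)]])
    have "closed {z::real \<times> real. snd z \<le> c + s * fst z}" by (intro closed_Collect_le continuous_intros)
    thus "{z::real \<times> real. snd z \<le> c + s * fst z} \<in> sets borel" by (rule borel_closed)
  qed
  have eq: "g (?w t x) = g A + front c s t x *\<^sub>R (g B - g A)" for t x and g :: "state \<Rightarrow> 'b::euclidean_space"
    by (simp add: front_def)
  have bff: "bounded_field (\<lambda>t x. front c s t x *\<^sub>R k)" for k :: "'b::euclidean_space"
  proof -
    have "(\<lambda>(t, x). front c s t x *\<^sub>R k) \<in> borel_measurable borel" unfolding borel_prod[symmetric] by measurable
    moreover have "norm (front c s t x *\<^sub>R k) \<le> norm k" for t x by (simp add: front_def)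
    ultimately show ?thesis unfolding bounded_field_def by blast
  qed
  \<comment> \<open>A single front is the superposition of a constant family over the unit
    interval.\<close>
  have sup: "weak_form (\<lambda>t x. front c s t x *\<^sub>R k) (\<lambda>t x. front c s t x *\<^sub>R (s *\<^sub>R k)) \<phi> = 0"
    if "test_function 1 \<phi>" for \<phi> and k :: "'b::euclidean_space"
    by (rule weak_superposition[OF that, where ?x0.0 = "\<lambda>_. c" and l = "\<lambda>_. s" and k = "\<lambda>_. k" and p = 0 and q = 1
        and K = "norm k" and L = "\<bar>s\<bar>"])
      (simp_all add: integral_unit_const mult.assoc flip: scaleR_scaleR)
  have wf: "weak_form (\<lambda>t x. g (?w t x)) (\<lambda>t x. h (?w t x)) \<phi>
      = weak_form (\<lambda>t x. front c s t x *\<^sub>R (g B - g A)) (\<lambda>t x. front c s t x *\<^sub>R (h B - h A)) \<phi>"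
    if \<phi>: "test_function 1 \<phi>" for g h :: "state \<Rightarrow> 'b::euclidean_space" and \<phi>
    unfolding eq by (simp add: weak_form_add[OF \<phi>] bff bounded_field_const weak_form_const[OF \<phi>])
  show ?thesis unfolding transition_def
  proof (intro conjI ballI allI impI)
    show "c - \<bar>s\<bar> \<le> c + \<bar>s\<bar> + 1" by simp
    show "compact_valued ?w" by (rule cv)
  next
    fix t x :: real assume t: "t \<in> {0..<1}"
    have st: "\<bar>s * t\<bar> \<le> \<bar>s\<bar>" using t by (auto simp: abs_mult intro: mult_left_le)
    show "?w t x = A" if "x \<le> c - \<bar>s\<bar>" using that st by auto
    show "?w t x = B" if "c + \<bar>s\<bar> + 1 \<le> x" using that st by auto
  next
    fix t :: real assume t: "t \<in> {0..<1}"
    have "AE x in lborel. x \<noteq> c + s * t" by (rule AE_lborel_singleton)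
    thus "AE x in lborel. continuous (at t within {0..<1}) (\<lambda>\<tau>. ?w \<tau> x)"
    proof eventually_elim
      case (elim x)
      have lim: "((\<lambda>\<tau>. c + s * \<tau>) \<longlongrightarrow> c + s * t) (at t within {0..<1})" by (intro tendsto_intros)
      have "eventually (\<lambda>\<tau>. ?w \<tau> x = ?w t x) (at t within {0..<1})"
      proof (cases "x < c + s * t")
        case True
        from order_tendstoD(1)[OF lim this] show ?thesis by eventually_elim (use True in auto)
      next
        case False
        with elim have "c + s * t < x" by auto
        from order_tendstoD(2)[OF lim this] show ?thesis by eventually_elim (use False elim in auto)
      qed
      thus ?case unfolding continuous_within by (rule tendsto_eventually)
    qed
  next
    fix \<phi> assume \<phi>: "test_function 1 \<phi>"
    have "fl B - fl A = s *\<^sub>R (B - A)" using RH by (simp add: rankine_hugoniot_def)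
    thus "weak_form ?w (\<lambda>t x. fl (?w t x)) \<phi> = 0"
      using wf[OF \<phi>, of "\<lambda>U. U" fl] sup[OF \<phi>, of "B - A"] by simp
  next
    fix \<phi> :: "real \<times> real \<Rightarrow> real" assume \<phi>: "test_function 1 \<phi>" and nn: "\<forall>z. 0 \<le> \<phi> z"
    let ?j = "ent B - ent A"
    \<comment> \<open>Splitting off \<open>- diss A B s\<close> leaves a front obeying its own jump
      condition and a pure flux front, whose weak form is a nonnegative integral along the shock
      line.\<close>
    have "weak_form (\<lambda>t x. ent (?w t x)) (\<lambda>t x. entf (?w t x)) \<phi>
      = weak_form (\<lambda>t x. front c s t x *\<^sub>R ?j + 0) (\<lambda>t x. front c s t x *\<^sub>R (s *\<^sub>R ?j) + front c s t x *\<^sub>R (- diss A B s)) \<phi>"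
      unfolding wf[OF \<phi>] by (intro arg_cong3[where f = weak_form] refl ext) (simp_all add: diss_def algebra_simps)
    also have "\<dots> = weak_form (\<lambda>t x. front c s t x *\<^sub>R ?j) (\<lambda>t x. front c s t x *\<^sub>R (s *\<^sub>R ?j)) \<phi>
        + weak_form (\<lambda>t x. 0) (\<lambda>t x. front c s t x *\<^sub>R (- diss A B s)) \<phi>"
      by (rule weak_form_add[OF \<phi> bff bff bounded_field_const bff])
    also have "weak_form (\<lambda>t x. 0) (\<lambda>t x. front c s t x *\<^sub>R (- diss A B s)) \<phi>
        = (LINT y:{0..<1} \<times> UNIV|lborel. - diss A B s * (case y of (t, x) \<Rightarrow> dx \<phi> (t, x) * front c s t x))"
      unfolding weak_form_def by (simp add: case_prod_unfold mult_ac)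
    also have "\<dots> = - diss A B s * (LINT (t, x):{0..<1} \<times> UNIV|lborel. dx \<phi> (t, x) * front c s t x)"
      by (rule set_integral_mult_right)
    finally show "0 \<le> weak_form (\<lambda>t x. ent (?w t x)) (\<lambda>t x. entf (?w t x)) \<phi>"
      using sup[OF \<phi>, of ?j] test_function_front_dx[OF \<phi>, of c s] nn d by (simp add: mult_nonneg_nonpos)
  next
    fix V t assume V: "V \<in> states" and t: "t \<in> {0..<1::real}"
    let ?k = "rel B V - rel A V"
    have "(\<integral>x. rel (?w t x) V - rel (?w 0 x) V \<partial>lborel) = (\<integral>x. front c s t x * ?k - front c s 0 x * ?k \<partial>lborel)"
      by (intro Bochner_Integration.integral_cong refl) (auto simp: front_def)
    also have "\<dots> = - (s * t) * ?k"
      using integral_front_diff(2)[of c s t] by (simp flip: left_diff_distrib)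
    also have "\<dots> = t * (qf A V - qf B V - diss A B s)"
      by (simp add: qf_rel[OF RH V] algebra_simps)
    finally show "(\<integral>x. rel (?w t x) V - rel (?w 0 x) V \<partial>lborel) = t * (qf A V - qf B V - diss A B s)" .
  qed
qed

section \<open>Smooth simple waves\<close>

text \<open>\<open>R\<close> is an integral curve whose tangent is an eigenvector for the speed
  \<open>lam\<close>; the point with parameter \<open>z\<close> travels from \<open>x0 z\<close>
  with speed \<open>lam z\<close>. As these points keep their order, the wave is a superposition of
  infinitesimal fronts, each satisfying the jump conditions of the system and of the entropy to
  first order; hence no dissipation.\<close>

lemma transition_fan:
  fixes R R' :: "real \<Rightarrow> state" and lam x0 e' :: "real \<Rightarrow> real"
  assumes pq: "zl < zr"
    and R: "\<And>z. z \<in> {zl..zr} \<Longrightarrow> (R has_vector_derivative R' z) (at z within {zl..zr})" "continuous_on {zl..zr} R'"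
      "\<And>z. z \<in> {zl..zr} \<Longrightarrow> R z \<in> states"
    and F: "\<And>z. z \<in> {zl..zr} \<Longrightarrow> ((\<lambda>z. fl (R z)) has_vector_derivative lam z *\<^sub>R R' z) (at z within {zl..zr})"
    and E: "\<And>z. z \<in> {zl..zr} \<Longrightarrow> ((\<lambda>z. ent (R z)) has_vector_derivative e' z) (at z within {zl..zr})" "continuous_on {zl..zr} e'"
    and EF: "\<And>z. z \<in> {zl..zr} \<Longrightarrow> ((\<lambda>z. entf (R z)) has_vector_derivative lam z * e' z) (at z within {zl..zr})"
    and lam: "continuous_on {zl..zr} lam" and x0: "continuous_on {zl..zr} x0"
    and mono: "\<And>t z z'. t \<in> {0..<1} \<Longrightarrow> zl \<le> z \<Longrightarrow> z < z' \<Longrightarrow> z' \<le> zr \<Longrightarrow> x0 z + lam z * t < x0 z' + lam z' * t"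
    and bd: "\<And>t z. t \<in> {0..<1} \<Longrightarrow> z \<in> {zl..zr} \<Longrightarrow> l \<le> x0 z + lam z * t \<and> x0 z + lam z * t < r"
  shows "\<exists>w. transition (R zl) (R zr) 0 l r w"
proof -
  define I where "I z = (indicator {zl..zr} z :: real)" for z
  define a where "a z = I z * x0 z" for z
  define b where "b z = I z * lam z" for z
  define H where "H z t x = I z * front (a z) (b z) t x" for z t x
  have [measurable]: "I \<in> borel_measurable borel" unfolding I_def by measurable
  have ext: "(\<lambda>z. I z *\<^sub>R f z) \<in> borel_measurable borel" if "continuous_on {zl..zr} f" for f :: "real \<Rightarrow> 'b::euclidean_space"
    unfolding I_def using that by (intro borel_measurable_continuous_on_indicator) auto
  have [measurable]: "a \<in> borel_measurable borel" "b \<in> borel_measurable borel"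
    using ext[OF x0] ext[OF lam] by (simp_all add: a_def[abs_def] b_def[abs_def])
  have bnd: "\<exists>K. \<forall>z\<in>{zl..zr}. norm (I z *\<^sub>R f z) \<le> K" if "continuous_on {zl..zr} f" for f :: "real \<Rightarrow> 'b::euclidean_space"
  proof -
    have "compact (f ` {zl..zr})" using that by (intro compact_continuous_image) auto
    then obtain K where "\<And>y. y \<in> f ` {zl..zr} \<Longrightarrow> norm y \<le> K" using compact_imp_bounded by (force simp: bounded_iff)
    thus ?thesis by (intro exI[of _ K]) (auto simp: I_def)
  qed
  \<comment> \<open>\<open>P t x\<close> adds to \<open>zl\<close> the length of the set of
    parameters whose front lies left of x. It inverts the position map without an inverse function
    theorem, and its measurability and range are immediate.\<close>
  define P where "P t x = zl + (\<integral>z. H z t x \<partial>lborel)" for t x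
  define w where "w t x = R (P t x)" for t x
  have Hint: "integrable lborel (\<lambda>z. H z t x)" for t x
    by (rule integrable_bounded_compact[where C = "{zl..zr}" and B = 1]) (auto simp: H_def I_def front_def)
  have I_int: "integrable lborel I"
    by (rule integrable_bounded_compact[where C = "{zl..zr}" and B = 1]) (auto simp: I_def)
  have P_range: "P t x \<in> {zl..zr}" for t x
  proof -
    have "0 \<le> (\<integral>z. H z t x \<partial>lborel)" by (intro Bochner_Integration.integral_nonneg) (auto simp: H_def I_def front_def)
    moreover have "(\<integral>z. H z t x \<partial>lborel) \<le> (\<integral>z. I z \<partial>lborel)"
      by (intro integral_mono Hint I_int) (auto simp: H_def I_def front_def)
    moreover have "(\<integral>z. I z \<partial>lborel) = zr - zl" using pq by (simp add: I_def[abs_def])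
    ultimately show ?thesis by (auto simp: P_def)
  qed
  \<comment> \<open>The parameter \<open>c\<close> separates the fronts left of x from those right
    of it; ends of the interval are taken when x lies outside the wave.\<close>
  have cut: "\<exists>c\<in>{zl..zr}. (\<forall>z\<in>{zl..zr}. (z < c \<longrightarrow> x0 z + lam z * t < x) \<and> (c < z \<longrightarrow> x < x0 z + lam z * t))"
    if t: "t \<in> {0..<1}" for t x
  proof -
    let ?X = "\<lambda>z. x0 z + lam z * t"
    consider "x \<le> ?X zl" | "?X zr \<le> x" | "?X zl \<le> x" "x \<le> ?X zr" by linarith
    thus ?thesis
    proof cases
      case 1
      thus ?thesis using mono[OF t, of zl] pq by (intro bexI[of _ zl]) force+
    next
      case 2
      thus ?thesis using mono[OF t, of _ zr] pq by (intro bexI[of _ zr]) force+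
    next
      case 3
      have "\<exists>c\<ge>zl. c \<le> zr \<and> ?X c = x"
        by (rule IVT'[of ?X, OF 3]) (use pq in \<open>auto intro!: continuous_intros lam x0\<close>)
      then obtain c where "zl \<le> c" "c \<le> zr" "?X c = x" by blast
      thus ?thesis using mono[OF t, of _ c] mono[OF t, of c] by (intro bexI[of _ c]) auto
    qed
  qed
  have int_cut: "(\<integral>z. H z t x *\<^sub>R k z \<partial>lborel) = f c - f zl"
    if t: "t \<in> {0..<1}" and c: "c \<in> {zl..zr}" "\<forall>z\<in>{zl..zr}. (z < c \<longrightarrow> x0 z + lam z * t < x) \<and> (c < z \<longrightarrow> x < x0 z + lam z * t)"
      and f: "\<And>z. z \<in> {zl..zr} \<Longrightarrow> (f has_vector_derivative k z) (at z within {zl..zr})" "continuous_on {zl..zr} k"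
    for t x c and f k :: "real \<Rightarrow> 'b::euclidean_space"
  proof -
    have k: "(\<lambda>z. I z *\<^sub>R k z) \<in> borel_measurable borel" by (rule ext[OF f(2)])
    have "(\<integral>z. H z t x *\<^sub>R k z \<partial>lborel) = (\<integral>z. indicator {zl..c} z *\<^sub>R k z \<partial>lborel)"
    proof (rule integral_cong_AE)
      have 1: "(\<lambda>z. H z t x *\<^sub>R k z) = (\<lambda>z. front (a z) (b z) t x *\<^sub>R (I z *\<^sub>R k z))" by (auto simp: H_def mult.commute)
      have "(\<lambda>z. front (a z) (b z) t x *\<^sub>R (I z *\<^sub>R k z)) \<in> borel_measurable borel"
        by (rule borel_measurable_scaleR[OF _ k]) measurable
      thus "(\<lambda>z. H z t x *\<^sub>R k z) \<in> borel_measurable lborel" by (simp only: 1 measurable_lborel2)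
      have 2: "(\<lambda>z. indicator {zl..c} z *\<^sub>R k z) = (\<lambda>z. indicator {zl..c} z *\<^sub>R (I z *\<^sub>R k z))"
        using c(1) by (auto simp: I_def indicator_def)
      have "(\<lambda>z. (indicator {zl..c} z :: real) *\<^sub>R (I z *\<^sub>R k z)) \<in> borel_measurable borel"
        by (rule borel_measurable_scaleR[OF _ k]) measurable
      thus "(\<lambda>z. indicator {zl..c} z *\<^sub>R k z) \<in> borel_measurable lborel" by (simp only: 2 measurable_lborel2)
      show "AE z in lborel. H z t x *\<^sub>R k z = indicator {zl..c} z *\<^sub>R k z"
        using AE_lborel_singleton[of c]
      proof eventually_elim
        case (elim z)
        show ?case
        proof (cases "z \<in> {zl..zr}")
          case True
          thus ?thesis using elim c(2)[rule_format, OF True] by (cases "z < c") (auto simp: H_def I_def a_def b_def front_def)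
        next
          case False
          thus ?thesis using c(1) by (auto simp: H_def I_def)
        qed
      qed
    qed
    also have "\<dots> = f c - f zl"
    proof (rule integral_FTC_atLeastAtMost)
      show "zl \<le> c" using c by auto
      show "continuous_on {zl..c} k" using c by (intro continuous_on_subset[OF f(2)]) auto
      show "(f has_vector_derivative k z) (at z within {zl..c})" if "zl \<le> z" "z \<le> c" for z
        using that c by (intro has_vector_derivative_within_subset[OF f(1)]) auto
    qed
    finally show ?thesis .
  qed
  have P_cut: "P t x = c"
    if t: "t \<in> {0..<1}" and c: "c \<in> {zl..zr}" "\<forall>z\<in>{zl..zr}. (z < c \<longrightarrow> x0 z + lam z * t < x) \<and> (c < z \<longrightarrow> x < x0 z + lam z * t)"
    for t x c
    using int_cut[OF that, of "\<lambda>z. z" "\<lambda>_. 1"] by (simp add: P_def)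
  \<comment> \<open>Every continuously differentiable function of the parameter becomes a
    superposition of the same fronts, so one argument covers the state, the flux, the entropy, its
    flux and the relative quantities.\<close>
  have rep: "f (P t x) = f zl + (\<integral>z. H z t x *\<^sub>R k z \<partial>lborel)"
    if t: "t \<in> {0..<1}" and f: "\<And>z. z \<in> {zl..zr} \<Longrightarrow> (f has_vector_derivative k z) (at z within {zl..zr})" "continuous_on {zl..zr} k"
    for t x and f k :: "real \<Rightarrow> 'b::euclidean_space"
  proof -
    obtain c where c: "c \<in> {zl..zr}" "\<forall>z\<in>{zl..zr}. (z < c \<longrightarrow> x0 z + lam z * t < x) \<and> (c < z \<longrightarrow> x < x0 z + lam z * t)"
      using cut[OF t] by blast
    show ?thesis using P_cut[OF t c] int_cut[OF t c f] by simp
  qed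
  have contR: "continuous_on {zl..zr} R"
    unfolding continuous_on_eq_continuous_within by (intro ballI has_vector_derivative_continuous[OF R(1)])
  have cv: "compact_valued w" unfolding compact_valued_def
  proof
    have f: "(fst :: real \<times> real \<Rightarrow> _) \<in> borel \<rightarrow>\<^sub>M borel" "(snd :: real \<times> real \<Rightarrow> _) \<in> borel \<rightarrow>\<^sub>M borel"
      by (intro borel_measurable_continuous_onI continuous_on_fst continuous_on_snd continuous_on_id)+
    note [measurable] = f
    have "(\<lambda>y::real \<times> real. \<integral>z. H z (fst y) (snd y) \<partial>lborel) \<in> borel_measurable borel"
      unfolding H_def by (rule lborel.borel_measurable_lebesgue_integral) measurable
    hence "(\<lambda>y. P (fst y) (snd y)) \<in> borel_measurable borel" by (simp add: P_def[abs_def])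
    from measurable_compose[OF this ext[OF contR]]
    show "(\<lambda>(t, x). w t x) \<in> borel_measurable borel"
      using P_range by (simp add: w_def case_prod_unfold I_def)
    show "\<exists>K. compact K \<and> K \<subseteq> states \<and> (\<forall>t x. w t x \<in> K)"
      using compact_continuous_image[OF contR] R(3) P_range
      by (intro exI[of _ "R ` {zl..zr}"]) (auto simp: w_def)
  qed
  have weak: "weak_form (\<lambda>t x. g (w t x)) (\<lambda>t x. h (w t x)) \<phi> = 0"
    if \<phi>: "test_function 1 \<phi>" and gc: "continuous_on states g" "continuous_on states h"
      and g: "\<And>z. z \<in> {zl..zr} \<Longrightarrow> ((\<lambda>z. g (R z)) has_vector_derivative k z) (at z within {zl..zr})" "continuous_on {zl..zr} k"
      and h: "\<And>z. z \<in> {zl..zr} \<Longrightarrow> ((\<lambda>z. h (R z)) has_vector_derivative lam z *\<^sub>R k z) (at z within {zl..zr})"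
    for \<phi> and g h :: "state \<Rightarrow> 'b::euclidean_space" and k
  proof -
    obtain K where K: "\<And>z. z \<in> {zl..zr} \<Longrightarrow> norm (I z *\<^sub>R k z) \<le> K" using bnd[OF g(2)] by blast
    have "\<exists>L. \<forall>z\<in>{zl..zr}. \<bar>b z\<bar> \<le> L" using bnd[OF lam] by (simp add: b_def)
    then obtain L where L: "\<And>z. z \<in> {zl..zr} \<Longrightarrow> \<bar>b z\<bar> \<le> L" by blast
    have lk: "continuous_on {zl..zr} (\<lambda>z. lam z *\<^sub>R k z)" by (intro continuous_intros lam g)
    have 0: "weak_form (\<lambda>t x. g (w t x) - g (R zl)) (\<lambda>t x. h (w t x) - h (R zl)) \<phi> = 0"
    proof (rule weak_superposition[OF \<phi> _ _ ext[OF g(2)] K L, where p = zl and q = zr])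
      fix t x :: real assume t: "t \<in> {0..<1}"
      show "g (w t x) - g (R zl) = (\<integral>z. (indicator {zl..zr} z * front (a z) (b z) t x) *\<^sub>R I z *\<^sub>R k z \<partial>lborel)"
        using rep[OF t g] by (simp add: w_def) (intro Bochner_Integration.integral_cong refl, auto simp: H_def I_def indicator_def)
      show "h (w t x) - h (R zl) = (\<integral>z. (indicator {zl..zr} z * front (a z) (b z) t x * b z) *\<^sub>R I z *\<^sub>R k z \<partial>lborel)"
        using rep[OF t h lk] by (simp add: w_def) (intro Bochner_Integration.integral_cong refl, auto simp: H_def I_def b_def indicator_def)
    qed (use pq in auto)
    note bf = compact_valued_compose[OF cv gc(1)] compact_valued_compose[OF cv gc(2)]
    have "weak_form (\<lambda>t x. (g (w t x) - g (R zl)) + g (R zl)) (\<lambda>t x. (h (w t x) - h (R zl)) + h (R zl)) \<phi> = 0"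
      by (subst weak_form_add[OF \<phi>]) (use bf 0 in \<open>auto simp: bounded_field_diff bounded_field_const weak_form_const[OF \<phi>]\<close>)
    thus ?thesis by simp
  qed
  have "transition (R zl) (R zr) 0 l r w" unfolding transition_def
  proof (intro conjI ballI allI impI)
    show "l \<le> r" using bd[of 0 zl] pq by auto
    show "compact_valued w" by (rule cv)
  next
    fix t x :: real assume t: "t \<in> {0..<1}"
    obtain c where c: "c \<in> {zl..zr}" "\<forall>z\<in>{zl..zr}. (z < c \<longrightarrow> x0 z + lam z * t < x) \<and> (c < z \<longrightarrow> x < x0 z + lam z * t)"
      using cut[OF t] by blast
    show "w t x = R zl" if "x \<le> l"
      using that c bd[OF t, of zl] pq P_cut[OF t c] by (cases "zl < c") (auto simp: w_def)
    show "w t x = R zr" if "r \<le> x"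
      using that c bd[OF t, of zr] pq P_cut[OF t c] by (cases "c < zr") (auto simp: w_def)
  next
    fix t :: real assume t: "t \<in> {0..<1}"
    show "AE x in lborel. continuous (at t within {0..<1}) (\<lambda>\<tau>. w \<tau> x)"
    proof (rule AE_I2)
      fix x
      obtain c where c: "c \<in> {zl..zr}" "\<forall>z\<in>{zl..zr}. (z < c \<longrightarrow> x0 z + lam z * t < x) \<and> (c < z \<longrightarrow> x < x0 z + lam z * t)"
        using cut[OF t] by blast
      show "continuous (at t within {0..<1}) (\<lambda>\<tau>. w \<tau> x)"
        unfolding continuous_within_sequentially
      proof (intro allI impI)
        fix \<tau> :: "nat \<Rightarrow> real" assume \<tau>: "(\<forall>n. \<tau> n \<in> {0..<1}) \<and> \<tau> \<longlonglongrightarrow> t"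
        have "(\<lambda>n. \<integral>z. H z (\<tau> n) x \<partial>lborel) \<longlonglongrightarrow> (\<integral>z. H z t x \<partial>lborel)"
        proof (rule integral_dominated_convergence[where w = I])
          show "integrable lborel I" by (rule I_int)
          show "AE z in lborel. norm (H z (\<tau> n) x) \<le> I z" for n by (auto simp: H_def I_def front_def)
          show "AE z in lborel. (\<lambda>n. H z (\<tau> n) x) \<longlonglongrightarrow> H z t x"
            using AE_lborel_singleton[of c]
          proof eventually_elim
            case (elim z)
            show ?case
            proof (cases "z \<in> {zl..zr}")
              case True
              have lim: "(\<lambda>n. a z + b z * \<tau> n) \<longlonglongrightarrow> a z + b z * t" using \<tau> by (intro tendsto_intros) auto
              have "eventually (\<lambda>n. H z (\<tau> n) x = H z t x) sequentially"
              proof (cases "z < c")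
                case zc: True
                hence "a z + b z * t < x" using c True by (auto simp: a_def b_def I_def)
                from order_tendstoD(2)[OF lim this] show ?thesis
                  by eventually_elim (use \<open>a z + b z * t < x\<close> in \<open>auto simp: H_def front_def\<close>)
              next
                case False
                hence "x < a z + b z * t" using c True elim by (auto simp: a_def b_def I_def)
                from order_tendstoD(1)[OF lim this] show ?thesis
                  by eventually_elim (use \<open>x < a z + b z * t\<close> in \<open>auto simp: H_def front_def\<close>)
              qed
              thus ?thesis by (rule tendsto_eventually)
            qed (simp add: H_def I_def)
          qed
        qed (auto simp: H_def)
        hence "(\<lambda>n. P (\<tau> n) x) \<longlonglongrightarrow> P t x" unfolding P_def by (intro tendsto_intros)
        hence "(\<lambda>n. R (P (\<tau> n) x)) \<longlonglongrightarrow> R (P t x)"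
          by (rule continuous_on_tendsto_compose[OF contR]) (simp_all only: P_range eventually_True)
        thus "((\<lambda>\<tau>. w \<tau> x) \<circ> \<tau>) \<longlonglongrightarrow> w t x" by (simp add: w_def o_def)
      qed
    qed
  next
    fix \<phi> assume \<phi>: "test_function 1 \<phi>"
    show "weak_form w (\<lambda>t x. fl (w t x)) \<phi> = 0"
      using weak[OF \<phi> continuous_on_id continuous_on_fl R(1,2) F] by simp
  next
    fix \<phi> assume \<phi>: "test_function 1 \<phi>"
    show "0 \<le> weak_form (\<lambda>t x. ent (w t x)) (\<lambda>t x. entf (w t x)) \<phi>"
      using weak[OF \<phi> continuous_on_ent continuous_on_entf E] EF by simp
  next
    fix V t assume V: "V \<in> states" and t: "t \<in> {0..<1::real}"
    let ?k = "\<lambda>z. e' z - inner (egrad \<gamma> V) (R' z)"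
    have kc: "continuous_on {zl..zr} ?k" by (intro continuous_intros E R)
    have kd: "((\<lambda>z. rel (R z) V) has_vector_derivative ?k z) (at z within {zl..zr})" if "z \<in> {zl..zr}" for z
      unfolding rel_eq[OF V] inner_diff_right
      by (auto intro!: derivative_eq_intros bounded_linear.has_vector_derivative[OF bounded_linear_inner_right] E R that)
    have qd: "((\<lambda>z. qf (R z) V) has_vector_derivative lam z * ?k z) (at z within {zl..zr})" if "z \<in> {zl..zr}" for z
      unfolding qf_def inner_diff_right
      by (auto intro!: derivative_eq_intros bounded_linear.has_vector_derivative[OF bounded_linear_inner_right] EF F that
        simp: algebra_simps)
    have "\<exists>K. \<forall>z\<in>{zl..zr}. \<bar>I z * ?k z\<bar> \<le> K" using bnd[OF kc] by simp
    then obtain K where K: "\<And>z. z \<in> {zl..zr} \<Longrightarrow> \<bar>I z * ?k z\<bar> \<le> K" by blast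
    have "\<exists>L. \<forall>z\<in>{zl..zr}. \<bar>b z\<bar> \<le> L" using bnd[OF lam] by (simp add: b_def)
    then obtain L where L: "\<And>z. z \<in> {zl..zr} \<Longrightarrow> \<bar>b z\<bar> \<le> L" by blast
    have "\<exists>X. \<forall>z\<in>{zl..zr}. \<bar>a z\<bar> \<le> X" using bnd[OF x0] by (simp add: a_def)
    then obtain X where X: "\<And>z. z \<in> {zl..zr} \<Longrightarrow> \<bar>a z\<bar> \<le> X" by blast
    have "(\<integral>x. (rel (w t x) V - rel (R zl) V) - (rel (w 0 x) V - rel (R zl) V) \<partial>lborel)
        = - t * (\<integral>z. indicator {zl..zr} z * (b z * (I z * ?k z)) \<partial>lborel)"
    proof (rule energy_superposition[OF _ _ _ K L X])
      fix t x :: real assume t: "t \<in> {0..<1}"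
      show "rel (w t x) V - rel (R zl) V = (\<integral>z. indicator {zl..zr} z * front (a z) (b z) t x * (I z * ?k z) \<partial>lborel)"
        using rep[OF t kd kc] by (simp add: w_def) (intro Bochner_Integration.integral_cong refl, auto simp: H_def I_def indicator_def)
    qed (use pq t ext[OF kc] in auto)
    also have "(\<integral>z. indicator {zl..zr} z * (b z * (I z * ?k z)) \<partial>lborel) = (\<integral>z. indicator {zl..zr} z *\<^sub>R (lam z * ?k z) \<partial>lborel)"
      by (intro Bochner_Integration.integral_cong refl) (auto simp: b_def I_def indicator_def)
    also have "\<dots> = qf (R zr) V - qf (R zl) V"
      by (rule integral_FTC_atLeastAtMost) (use pq qd lam kc in \<open>auto intro!: continuous_on_mult\<close>)
    finally show "(\<integral>x. rel (w t x) V - rel (w 0 x) V \<partial>lborel) = t * (qf (R zl) V - qf (R zr) V - 0)"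
      by (simp add: algebra_simps)
  qed
  thus ?thesis by blast
qed

text \<open>The sound speed and a primitive of it: u1 - Cint v or u1 + Cint v is constant along a simple wave.\<close>

definition cs :: "real \<Rightarrow> real" where "cs v = sqrt \<gamma> * v powr (- (\<gamma> + 1) / 2)"

definition Cint :: "real \<Rightarrow> real" where "Cint v = - (2 * sqrt \<gamma> / (\<gamma> - 1)) * v powr (- (\<gamma> - 1) / 2)"

lemma cs_pos: "v > 0 \<Longrightarrow> cs v > 0" using gamma by (simp add: cs_def)

lemma cs_sq: "v > 0 \<Longrightarrow> cs v * cs v = csq v"
proof -
  assume v: "v > 0"
  have "v powr (- (\<gamma> + 1) / 2) * v powr (- (\<gamma> + 1) / 2) = v powr (- \<gamma> - 1)"
  proof -
    have "- (\<gamma> + 1) / 2 + - (\<gamma> + 1) / 2 = - \<gamma> - 1" by (simp add: field_simps)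
    thus ?thesis by (metis powr_add)
  qed
  moreover have "sqrt \<gamma> * sqrt \<gamma> = \<gamma>" using gamma by simp
  ultimately show ?thesis by (simp add: cs_def csq_def mult_ac)
qed

lemma cs_strict_anti: "0 < v \<Longrightarrow> v < w \<Longrightarrow> cs w < cs v"
  using gamma unfolding cs_def by (intro mult_strict_left_mono powr_less_mono2_neg) auto

lemma DERIV_Cint: "v > 0 \<Longrightarrow> (Cint has_real_derivative cs v) (at v)"
proof -
  assume v: "v > 0"
  have "(Cint has_real_derivative - (2 * sqrt \<gamma> / (\<gamma> - 1)) * (- (\<gamma> - 1) / 2 * v powr (- (\<gamma> - 1) / 2 - 1))) (at v)"
    unfolding Cint_def[abs_def] by (rule DERIV_cmult[OF has_real_derivative_powr[OF v]])
  moreover have "- (\<gamma> - 1) / 2 - 1 = - (\<gamma> + 1) / 2" by (simp add: field_simps)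
  moreover have "- (2 * sqrt \<gamma> / (\<gamma> - 1)) * (- (\<gamma> - 1) / 2 * X) = sqrt \<gamma> * X" for X
    using gamma by (simp add: divide_simps) (simp add: algebra_simps)
  ultimately show ?thesis by (simp only: cs_def)
qed

lemma continuous_on_cs: "continuous_on {0<..} cs"
  unfolding cs_def[abs_def] by (intro continuous_intros) auto

lemma transition_const:
  assumes "A \<in> states" "l \<le> r" shows "transition A A 0 l r (\<lambda>t x. A)"
  using assms by (auto simp: transition_def compact_valued_const weak_form_const)

text \<open>The sign \<open>e\<close> selects the acoustic family, with speed
  \<open>- e * cs\<close>. Spreading the initial profile enough handles rarefactions and
  compressions of any strength; the length needed does not depend on the position.\<close>

lemma transition_gas_fan:
  assumes v: "0 < v1" "0 < v2" and e: "e = 1 \<or> e = -1"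
  shows "\<exists>L\<ge>0. \<forall>l. \<exists>w. transition (mk v1 0 0 u w2 w3) (mk v2 0 0 (u + e * (Cint v2 - Cint v1)) w2 w3) 0 l (l + L) w"
proof (cases "v1 = v2")
  case True
  thus ?thesis using v transition_const[of "mk v1 0 0 u w2 w3"] by (intro exI[of _ 0]) auto
next
  case False
  \<comment> \<open>The sign \<open>k\<close> makes the parameter \<open>z\<close>, with volume
    \<open>k * z\<close>, increase from the left state to the right state.\<close>
  define k :: real where "k = (if v1 < v2 then 1 else -1)"
  have k: "k = 1 \<or> k = -1" "k * k = 1" and ee: "e * e = 1" using e by (auto simp: k_def)
  define zl zr where "zl = k * v1" and "zr = k * v2"
  have zlr: "zl < zr" and kz: "k * zl = v1" "k * zr = v2" using False by (auto simp: zl_def zr_def k_def)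
  have pos: "0 < k * z" and ge: "min v1 v2 \<le> k * z" if "z \<in> {zl..zr}" for z
    using that v False by (auto simp: zl_def zr_def k_def split: if_splits)
  define R where "R z = mk (k * z) 0 0 (u + e * (Cint (k * z) - Cint v1)) w2 w3" for z
  define R' :: "real \<Rightarrow> state" where "R' z = (k, 0, 0, e * (k * cs (k * z)), 0, 0)" for z
  define lam where "lam z = - e * cs (k * z)" for z
  define e' where "e' z = - k * p (k * z) + (u + e * (Cint (k * z) - Cint v1)) * (e * (k * cs (k * z)))" for z
  have kd: "((\<lambda>z. k * z) has_real_derivative k) (at z within S)" for z S
    by (auto intro!: derivative_eq_intros)
  have dC: "((\<lambda>z. Cint (k * z)) has_real_derivative k * cs (k * z)) (at z within S)" if "z \<in> {zl..zr}" for z S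
    using DERIV_chain2[where f = Cint and g = "\<lambda>z. k * z", OF DERIV_Cint[OF pos[OF that]] kd] by (simp add: mult_ac)
  have dp: "((\<lambda>z. p (k * z)) has_real_derivative - k * csq (k * z)) (at z within S)" if "z \<in> {zl..zr}" for z S
    using DERIV_chain2[where f = p and g = "\<lambda>z. k * z", OF DERIV_p[OF pos[OF that]] kd] by (simp add: mult_ac)
  have den: "((\<lambda>z. en (k * z)) has_real_derivative - k * p (k * z)) (at z within S)" if "z \<in> {zl..zr}" for z S
    using DERIV_chain2[where f = en and g = "\<lambda>z. k * z", OF DERIV_en[OF pos[OF that]] kd] by (simp add: mult_ac)
  have du: "((\<lambda>z. u + e * (Cint (k * z) - Cint v1)) has_real_derivative e * (k * cs (k * z))) (at z within S)" if "z \<in> {zl..zr}" for z S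
    using dC[OF that] by (auto intro!: derivative_eq_intros)
  have sq: "cs (k * z) * cs (k * z) = csq (k * z)" if "z \<in> {zl..zr}" for z using cs_sq[OF pos[OF that]] .
  have ccs: "continuous_on {zl..zr} (\<lambda>z. cs (k * z))"
    by (rule continuous_on_compose2[OF continuous_on_cs]) (use pos in \<open>auto intro!: continuous_intros\<close>)
  have cp: "continuous_on {zl..zr} (\<lambda>z. p (k * z))" "continuous_on {zl..zr} (\<lambda>z. Cint (k * z))"
    by (rule DERIV_continuous_on[OF dp], assumption) (rule DERIV_continuous_on[OF dC], assumption)
  define m where "m = cs (min v1 v2)"
  have m0: "m > 0" using v by (auto simp: m_def intro!: cs_pos)
  have lm: "\<bar>lam z\<bar> \<le> m" if "z \<in> {zl..zr}" for z
  proof -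
    have "cs (k * z) \<le> m"
      using cs_strict_anti[of "min v1 v2" "k * z"] ge[OF that] v by (cases "k * z = min v1 v2") (auto simp: m_def)
    thus ?thesis using e cs_pos[OF pos[OF that]] by (auto simp: lam_def abs_mult)
  qed
  have mono: "e * k * lam z < e * k * lam z'" if "zl \<le> z" "z < z'" "z' \<le> zr" for z z'
  proof -
    have "k * cs (k * z') < k * cs (k * z)"
      using k cs_strict_anti[of "k * z" "k * z'"] cs_strict_anti[of "k * z'" "k * z"] pos[of z] pos[of z'] that by auto
    moreover have "e * k * lam z = - (e * e) * (k * cs (k * z))" for z by (simp add: lam_def mult_ac)
    ultimately show ?thesis by (simp add: ee)
  qed
  have "\<exists>w. transition (R zl) (R zr) 0 l (l + (4 * m + 1)) w" for l
  proof -
    \<comment> \<open>If \<open>lam\<close> increases, the parameter \<open>z\<close> sits at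
      \<open>(1 + t) * lam z\<close> up to a constant. If \<open>lam\<close> decreases, starting at
      \<open>- 2 * lam z\<close> gives \<open>- (2 - t) * lam z\<close>, which keeps increasing in
      \<open>z\<close> until time 2. The offset places the wave right of \<open>l\<close>.\<close>
    define x0 where "x0 z = (if e * k = 1 then lam z else - 2 * lam z) + (l + 2 * m)" for z
    have ek: "e * k = 1 \<or> e * k = -1" using e k by auto
    show ?thesis
    proof (rule transition_fan[OF zlr, of R R' lam e' x0])
      fix z assume z: "z \<in> {zl..zr}"
      show "R z \<in> states" using pos[OF z] by (simp add: R_def)
      show "(R has_vector_derivative R' z) (at z within {zl..zr})"
        unfolding R_def[abs_def] R'_def mk_def
        by (intro has_vector_derivative_Pair)
          (use du[OF z] in \<open>auto simp: has_real_derivative_iff_has_vector_derivative[symmetric] intro!: derivative_eq_intros\<close>)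
      have "lam z *\<^sub>R R' z = (- (e * (k * cs (k * z))), 0, 0, - k * csq (k * z), 0, 0)"
        using ee by (simp add: lam_def R'_def sq[OF z, symmetric] mult_ac)
      moreover have "((\<lambda>z. fl (R z)) has_vector_derivative (- (e * (k * cs (k * z))), 0, 0, - k * csq (k * z), 0, 0)) (at z within {zl..zr})"
        unfolding R_def[abs_def] mk_def flux.simps
        by (intro has_vector_derivative_Pair)
          (use dC[OF z] dp[OF z] in \<open>auto simp: has_real_derivative_iff_has_vector_derivative[symmetric] intro!: derivative_eq_intros\<close>)
      ultimately show "((\<lambda>z. fl (R z)) has_vector_derivative lam z *\<^sub>R R' z) (at z within {zl..zr})" by simp
      have "((\<lambda>z. en (k * z) + ((u + e * (Cint (k * z) - Cint v1))\<^sup>2 + w2\<^sup>2 + w3\<^sup>2) / 2) has_real_derivative e' z) (at z within {zl..zr})"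
        unfolding e'_def by (auto intro!: derivative_eq_intros den[OF z] dC[OF z])
      thus "((\<lambda>z. ent (R z)) has_vector_derivative e' z) (at z within {zl..zr})"
        unfolding has_real_derivative_iff_has_vector_derivative
        by (rule has_vector_derivative_transform[OF z, rotated])
          (use pos in \<open>simp add: R_def mk_def eta_eq del: eta.simps\<close>)
      have "lam z * e' z = - k * csq (k * z) * (u + e * (Cint (k * z) - Cint v1)) + p (k * z) * (e * (k * cs (k * z)))"
      proof -
        have "lam z * e' z = e * k * cs (k * z) * p (k * z) - (e * e) * (cs (k * z) * cs (k * z)) * k * (u + e * (Cint (k * z) - Cint v1))"
          unfolding lam_def e'_def by algebra
        thus ?thesis unfolding ee sq[OF z] by (simp add: algebra_simps)
      qed
      moreover have "(\<lambda>z. entf (R z)) = (\<lambda>z. p (k * z) * (u + e * (Cint (k * z) - Cint v1)))"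
        by (rule ext) (simp add: R_def mk_def)
      ultimately show "((\<lambda>z. entf (R z)) has_vector_derivative lam z * e' z) (at z within {zl..zr})"
        using DERIV_mult[OF dp[OF z] du[OF z]]
        by (simp add: has_real_derivative_iff_has_vector_derivative[symmetric] add.commute mult.commute)
    next
      show "continuous_on {zl..zr} R'" unfolding R'_def[abs_def] by (intro continuous_intros ccs)
      show "continuous_on {zl..zr} e'" unfolding e'_def[abs_def] by (intro continuous_intros ccs cp)
      show "continuous_on {zl..zr} lam" unfolding lam_def[abs_def] by (intro continuous_intros ccs)
      thus "continuous_on {zl..zr} x0" unfolding x0_def[abs_def] by (cases "e * k = 1") (auto intro!: continuous_intros)
    next
      fix t z z' :: real assume t: "t \<in> {0..<1}" and z: "zl \<le> z" "z < z'" "z' \<le> zr"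
      show "x0 z + lam z * t < x0 z' + lam z' * t"
      proof (cases "e * k = 1")
        case True
        hence "lam z < lam z'" using mono[OF z] by simp
        hence "(1 + t) * lam z < (1 + t) * lam z'" using t by simp
        thus ?thesis using True by (simp add: x0_def algebra_simps)
      next
        case False
        hence "lam z' < lam z" using mono[OF z] ek by simp
        hence "(2 - t) * lam z' < (2 - t) * lam z" using t by simp
        thus ?thesis using False by (simp add: x0_def algebra_simps)
      qed
    next
      fix t z :: real assume t: "t \<in> {0..<1}" and z: "z \<in> {zl..zr}"
      have "\<bar>(1 + t) * lam z\<bar> \<le> 2 * m" "\<bar>(2 - t) * lam z\<bar> \<le> 2 * m"
        unfolding abs_mult using t lm[OF z] by (auto intro!: mult_mono)
      thus "l \<le> x0 z + lam z * t \<and> x0 z + lam z * t < l + (4 * m + 1)"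
        unfolding x0_def by (cases "e * k = 1") (auto simp: algebra_simps abs_le_iff)
    qed
  qed
  thus ?thesis using m0 by (intro exI[of _ "4 * m + 1"]) (auto simp: R_def kz)
qed

section \<open>Chains of elementary waves\<close>

text \<open>The case fan comprises compression waves: with a sufficiently wide initial profile they stay smooth
  up to time 1.\<close>

inductive path :: "state \<Rightarrow> state \<Rightarrow> real \<Rightarrow> bool" where
  nil: "A \<in> states \<Longrightarrow> path A A 0"
| shock: "A \<in> states \<Longrightarrow> B \<in> states \<Longrightarrow> RH A B s \<Longrightarrow> 0 \<le> diss A B s \<Longrightarrow> path A B (diss A B s)"
| fan: "0 < v1 \<Longrightarrow> 0 < v2 \<Longrightarrow> e = 1 \<or> e = -1 \<Longrightarrow>
    path (mk v1 0 0 u w2 w3) (mk v2 0 0 (u + e * (Cint v2 - Cint v1)) w2 w3) 0"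
| trans: "path A B d \<Longrightarrow> path B C d' \<Longrightarrow> path A C (d + d')"

lemma path_states: "path A B d \<Longrightarrow> A \<in> states \<and> B \<in> states"
  by (induction rule: path.induct) auto

text \<open>The length L is chosen before the position \<open>l\<close>, so waves can be laid side
  by side in any order, even if their speeds would make them collide later than time 1.\<close>

lemma path_transition: "path A B d \<Longrightarrow> \<exists>L\<ge>0. \<forall>l. \<exists>w. transition A B d l (l + L) w"
proof (induction rule: path.induct)
  case (nil A)
  thus ?case using transition_const[OF nil] by (intro exI[of _ 0]) auto
next
  case (shock A B s)
  have "transition A B (diss A B s) l (l + (2 * \<bar>s\<bar> + 1)) (\<lambda>t x. if x \<le> (l + \<bar>s\<bar>) + s * t then A else B)" for l
    using transition_shock[OF shock, of "l + \<bar>s\<bar>"] by (simp add: algebra_simps)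
  thus ?case by (intro exI[of _ "2 * \<bar>s\<bar> + 1"]) auto
next
  case (fan v1 v2 e u w2 w3)
  thus ?case by (rule transition_gas_fan)
next
  case (trans A B d C d')
  then obtain L1 L2 where L: "L1 \<ge> 0" "\<And>l. \<exists>w. transition A B d l (l + L1) w"
    "L2 \<ge> 0" "\<And>l. \<exists>w. transition B C d' l (l + L2) w" by blast
  have "\<exists>w. transition A C (d + d') l (l + (L1 + L2)) w" for l
  proof -
    obtain w1 where 1: "transition A B d l (l + L1) w1" using L(2) by blast
    obtain w2 where 2: "transition B C d' (l + L1) (l + L1 + L2) w2" using L(4) by blast
    from transition_concat[OF 1 2] show ?thesis by (auto simp: add.assoc)
  qed
  thus ?case using L by (intro exI[of _ "L1 + L2"]) auto
qed

lemma transition_weaken: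
  assumes "transition A B d l r w" "l' \<le> l" "r \<le> r'" shows "transition A B d l' r' w"
  using assms unfolding transition_def by (auto intro: order_trans)

section \<open>From chains of waves to the failure of contraction\<close>

text \<open>The price of a state U when it counts as lying right of the interface of the
  pseudo-distance, minus its price on the left.\<close>

definition excess :: "real \<Rightarrow> state \<Rightarrow> state \<Rightarrow> state \<Rightarrow> real" where
  "excess a A B U = a * rel U B - rel U A"

text \<open>The number in the last line is the growth rate at t = 0 of the pseudo-distance when the shift has speed s;
  the signs of excess make every other shift worse.\<close>

definition expanding :: "real \<Rightarrow> state \<Rightarrow> state \<Rightarrow> bool" where
  "expanding a A B \<longleftrightarrow> (\<exists>U V s dl dr. path A U dl \<and> path V B dr \<and> RH U V s \<and> 0 \<le> diss U V s
     \<and> 0 \<le> excess a A B U \<and> excess a A B V \<le> 0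
     \<and> 0 < a * (qf V B - dr - s * rel V B) - (qf U A + dl - s * rel U A))"

text \<open>X is the interface of the pseudo-distance, Y the jump of the solution. Any interval
  between them is charged the higher of its two possible prices, so X = Y is the cheapest choice,
  and it gives the bound.\<close>

lemma integral_piecewise:
  fixes m1 m2 p1 p2 X Y :: real
  defines "C \<equiv> \<lambda>X Y y. if y < X then (if y \<le> Y then m1 else p1) else (if y \<le> Y then m2 else p2)"
  assumes m: "m1 \<le> m2" and p: "p2 \<le> p1"
  shows "integrable lborel (\<lambda>y. C X Y y - C 0 0 y)" (is ?I)
    and "Y * (m1 - p2) \<le> (\<integral>y. C X Y y - C 0 0 y \<partial>lborel)" (is ?L)
proof -
  have [measurable]: "(\<lambda>y. C X Y y - C 0 0 y) \<in> borel_measurable borel"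
    unfolding C_def by measurable
  \<comment> \<open>A front of speed X at time 1 is a step at X, so
    \<open>integral_front_diff\<close> evaluates the integral.\<close>
  define D where "D y = (if X \<le> Y
      then (m2 - m1) * (front 0 X 1 y - front 0 X 0 y) + (p2 - m2) * (front 0 Y 1 y - front 0 Y 0 y)
      else (p1 - m1) * (front 0 Y 1 y - front 0 Y 0 y) + (p2 - p1) * (front 0 X 1 y - front 0 X 0 y))" for y
  have Dint: "integrable lborel D"
    unfolding D_def[abs_def] using integral_front_diff(1)[of 0 X 1] integral_front_diff(1)[of 0 Y 1]
    by (cases "X \<le> Y") (auto intro!: Bochner_Integration.integrable_add)
  have eq: "AE y in lborel. D y = C X Y y - C 0 0 y"
    using AE_lborel_singleton[of X] AE_lborel_singleton[of 0]
    by eventually_elim (auto simp: D_def C_def front_def)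
  show ?I by (rule integrable_cong_AE_imp[OF Dint _ eq]) simp
  have "(\<integral>y. C X Y y - C 0 0 y \<partial>lborel) = (\<integral>y. D y \<partial>lborel)"
    by (rule integral_cong_AE) (use eq borel_measurable_integrable[OF Dint] in auto)
  also have "\<dots> = (if X \<le> Y then - ((m2 - m1) * X) - (p2 - m2) * Y else - ((p1 - m1) * Y) - (p2 - p1) * X)"
    unfolding D_def[abs_def] using integral_front_diff[of 0 X 1] integral_front_diff[of 0 Y 1]
    by (cases "X \<le> Y") simp_all
  also have "\<dots> \<ge> Y * (m1 - p2)"
    using mult_left_mono[of X Y "m2 - m1"] mult_left_mono[of Y X "p1 - p2"] m p
    by (cases "X \<le> Y") (auto simp: algebra_simps)
  finally show ?L .
qed

theorem expanding_fails_contraction: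
  assumes ex: "expanding a A B" and a: "a > 0"
  shows "fails_contraction \<beta> \<gamma> a A B \<sigma>"
  unfolding fails_contraction_def
proof (intro allI impI, elim conjE)
  fix \<alpha> :: "real \<Rightarrow> real" and L assume lip: "L-lipschitz_on {0..} \<alpha>" and \<alpha>0: "\<alpha> 0 = 0"
  obtain U V s dl dr where pl: "path A U dl" and pr: "path V B dr" and RH: "RH U V s" and d: "0 \<le> diss U V s"
    and exU: "0 \<le> excess a A B U" and exV: "excess a A B V \<le> 0"
    and pos: "0 < a * (qf V B - dr - s * rel V B) - (qf U A + dl - s * rel U A)"
    using ex unfolding expanding_def by blast
  have st: "A \<in> states" "U \<in> states" "V \<in> states" "B \<in> states" using path_states pl pr by auto
  define M where "M = \<bar>s\<bar> + 1"
  obtain Ll where Ll: "Ll \<ge> 0" "\<And>l. \<exists>w. transition A U dl l (l + Ll) w" using path_transition[OF pl] by blast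
  obtain Lr where Lr: "Lr \<ge> 0" "\<And>l. \<exists>w. transition V B dr l (l + Lr) w" using path_transition[OF pr] by blast
  obtain wl where wl: "transition A U dl (- M - Ll) (- M) wl" using Ll(2)[of "- M - Ll"] by auto
  obtain wr where wr: "transition V B dr M (M + Lr) wr" using Lr(2) by blast
  define wc where "wc t x = (if x \<le> 0 + s * t then U else V)" for t x
  have wc: "transition U V (diss U V s) (- M) M wc"
    unfolding wc_def by (rule transition_weaken[OF transition_shock[OF st(2,3) RH d]]) (auto simp: M_def)
  define W where "W t x = (if x \<le> M then (if x \<le> - M then wl t x else wc t x) else wr t x)" for t x
  have W: "transition A B (dl + diss U V s + dr) (- M - Ll) (M + Lr) W"
    unfolding W_def by (rule transition_concat[OF transition_concat[OF wl wc] wr])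
  have cvW: "compact_valued W" using W by (simp add: transition_def)
  \<comment> \<open>Before this time the interface moves by less than 1, hence stays inside
    \<open>(- M, M)\<close>, the region between the two end profiles; the central jump stays there
    as well.\<close>
  define T0 where "T0 = 1 / (1 + L + \<bar>\<sigma>\<bar>)"
  have L0: "L \<ge> 0" using lip by (rule lipschitz_on_nonneg)
  have T0: "0 < T0" "T0 \<le> 1" using L0 by (auto simp: T0_def)
  \<comment> \<open>The position of the interface in the coordinate y = x + \<alpha>(t) of the
    solution.\<close>
  define X where "X t = \<sigma> * t + \<alpha> t" for t
  have X: "\<bar>X t\<bar> < M" if "0 \<le> t" "t < T0" for t
  proof -
    have "\<bar>\<alpha> t\<bar> \<le> L * t" using lipschitz_onD[OF lip, of t 0] that \<alpha>0 by (auto simp: dist_real_def)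
    moreover have "\<bar>\<sigma> * t\<bar> = \<bar>\<sigma>\<bar> * t" using that by (simp add: abs_mult)
    ultimately have "\<bar>X t\<bar> \<le> (L + \<bar>\<sigma>\<bar>) * t" unfolding X_def by (simp add: distrib_right)
    also have "\<dots> \<le> (1 + L + \<bar>\<sigma>\<bar>) * t" using that by (simp add: mult_right_mono)
    also have "\<dots> < 1" using that L0 by (simp add: T0_def less_divide_eq mult.commute)
    finally show ?thesis by (simp add: M_def)
  qed
  define F where "F t y = (if y < X t then rel (W t y) A else a * rel (W t y) B)" for t y
  have F0: "F t y \<ge> 0" for t y
    using rel_nonneg[OF compact_valued_states[OF cvW]] st a by (auto simp: F_def)
  have sl: "(\<lambda>y. rel (W t y) Z) \<in> borel_measurable borel" if "Z \<in> states" for t Z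
    by (rule bounded_field_slice[OF compact_valued_compose[OF cvW continuous_on_rel[OF that]]])
  have Fm [measurable]: "F t \<in> borel_measurable borel" for t
    unfolding F_def[abs_def] using sl[OF st(1)] sl[OF st(4)] by measurable
  have Fint: "integrable lborel (F t)" if t: "0 \<le> t" "t < T0" for t
  proof -
    obtain b1 b2 where b: "\<And>t x. norm (rel (W t x) A) \<le> b1" "\<And>t x. norm (rel (W t x) B) \<le> b2"
      using compact_valued_compose[OF cvW continuous_on_rel[OF st(1)]] compact_valued_compose[OF cvW continuous_on_rel[OF st(4)]]
      by (auto simp: bounded_field_def)
    have t1: "t \<in> {0..<1}" using t T0 by auto
    show ?thesis
    proof (rule integrable_bounded_compact[OF Fm, where C = "{- M - Ll..M + Lr}" and B = "max b1 (a * b2)"])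
      show "norm (F t y) \<le> max b1 (a * b2)" for y
        using b(1)[of t y] mult_left_mono[OF b(2)[of t y], of a] a by (auto simp: F_def abs_mult le_max_iff_disj)
      show "F t y = 0" if "y \<notin> {- M - Ll..M + Lr}" for y
      proof (cases "y < - M - Ll")
        case True
        hence "W t y = A" using W t1 by (simp add: transition_def)
        thus ?thesis using True X[OF t] Ll(1) by (simp add: F_def rel_self[OF st(1)])
      next
        case False
        hence y: "M + Lr \<le> y" using that by auto
        hence "W t y = B" using W t1 by (simp add: transition_def)
        thus ?thesis using y X[OF t] Lr(1) by (simp add: F_def rel_self[OF st(4)])
      qed
    qed simp
  qed
  have td: "total_dist \<gamma> a A B \<sigma> t (\<lambda>x. W t (x + \<alpha> t)) = ennreal (\<integral>y. F t y \<partial>lborel)"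
    if t: "0 \<le> t" "t < T0" for t
  proof -
    have "total_dist \<gamma> a A B \<sigma> t (\<lambda>x. W t (x + \<alpha> t)) = (\<integral>\<^sup>+x. ennreal (F t (\<alpha> t + 1 * x)) \<partial>lborel)"
      unfolding total_dist_def by (intro nn_integral_cong) (auto simp: pseudo_dist_def F_def X_def add.commute)
    also have "\<dots> = (\<integral>\<^sup>+y. ennreal (F t y) \<partial>lborel)"
      using nn_integral_real_affine[of "\<lambda>y. ennreal (F t y)" 1 "\<alpha> t"] by simp
    also have "\<dots> = ennreal (\<integral>y. F t y \<partial>lborel)"
      by (rule nn_integral_eq_integral[OF Fint[OF t]]) (simp add: F0)
    finally show ?thesis .
  qed
  let ?m1 = "rel U A" and ?m2 = "a * rel U B" and ?p1 = "rel V A" and ?p2 = "a * rel V B"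
  define C where "C X Y y = (if y < X then (if y \<le> Y then ?m1 else ?p1) else (if y \<le> Y then ?m2 else ?p2))" for X Y y :: real
  \<comment> \<open>Each end profile is charged by one relative entropy only and the shift does not
    affect it. What depends on the shift is the step function \<open>C\<close>, which takes four
    values.\<close>
  have dec: "F t y = (rel (wl t y) A - ?m1) + a * (rel (wr t y) B - rel V B) + C (X t) (s * t) y"
    if t: "0 \<le> t" "t < T0" for t y
  proof -
    have t1: "t \<in> {0..<1}" using t T0 by auto
    have st': "\<bar>s * t\<bar> < M" using t1 mult_left_le[of t "\<bar>s\<bar>"] by (simp add: abs_mult M_def)
    have l: "- M \<le> y \<Longrightarrow> wl t y = U" and r: "y \<le> M \<Longrightarrow> wr t y = V"
      using wl wr t1 by (simp_all add: transition_def)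
    consider "y \<le> - M" | "- M < y" "y \<le> M" | "M < y" by linarith
    thus ?thesis
    proof cases
      case 1
      moreover have "y \<le> M" "y < X t" "y \<le> s * t" using 1 X[OF t] st' by (auto simp: M_def)
      ultimately show ?thesis using r by (simp add: F_def W_def C_def)
    next
      case 2
      thus ?thesis using r l by (simp add: F_def W_def C_def wc_def)
    next
      case 3
      moreover have "- M \<le> y" "\<not> y < X t" "\<not> y \<le> s * t" using 3 X[OF t] st' by auto
      ultimately show ?thesis using l by (simp add: F_def W_def C_def algebra_simps)
    qed
  qed
  have main: "(\<integral>y. F 0 y \<partial>lborel) < (\<integral>y. F t y \<partial>lborel)" if t: "0 < t" "t < T0" for t
  proof -
    have t': "0 \<le> t" and t1: "t \<in> {0..<1}" using t T0 by auto
    have X0: "X 0 = 0" by (simp add: X_def \<alpha>0)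
    have Ci: "integrable lborel (\<lambda>y. C (X t) (s * t) y - C 0 0 y)"
      "(s * t) * (?m1 - ?p2) \<le> (\<integral>y. C (X t) (s * t) y - C 0 0 y \<partial>lborel)"
      unfolding C_def using exU exV by (intro integral_piecewise; simp add: excess_def)+
    have li: "integrable lborel (\<lambda>x. rel (wl t x) A - rel (wl 0 x) A)"
      "integrable lborel (\<lambda>x. rel (wr t x) B - rel (wr 0 x) B)"
      using transition_integrable[OF wl st(1) t1] transition_integrable[OF wr st(4) t1] by auto
    have lv: "(\<integral>x. rel (wl t x) A - rel (wl 0 x) A \<partial>lborel) = t * (- qf U A - dl)"
      "(\<integral>x. rel (wr t x) B - rel (wr 0 x) B \<partial>lborel) = t * (qf V B - dr)"
      using wl wr st t1 by (auto simp: transition_def)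
    have "(\<integral>y. F t y \<partial>lborel) - (\<integral>y. F 0 y \<partial>lborel) = (\<integral>y. F t y - F 0 y \<partial>lborel)"
      using Fint[OF t' t(2)] Fint[of 0] T0 by simp
    also have "\<dots> = (\<integral>y. (rel (wl t y) A - rel (wl 0 y) A) + a * (rel (wr t y) B - rel (wr 0 y) B)
        + (C (X t) (s * t) y - C 0 0 y) \<partial>lborel)"
      by (intro Bochner_Integration.integral_cong refl)
        (simp only: dec[OF t' t(2)] dec[OF order.refl T0(1)] X0 mult_zero_right, simp add: algebra_simps)
    also have "\<dots> = t * (- qf U A - dl) + a * (t * (qf V B - dr)) + (\<integral>y. C (X t) (s * t) y - C 0 0 y \<partial>lborel)"
      using li Ci(1) by (simp add: lv)
    also have "\<dots> \<ge> t * (- qf U A - dl) + a * (t * (qf V B - dr)) + (s * t) * (?m1 - ?p2)"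
      using Ci(2) by simp
    finally have "(\<integral>y. F t y \<partial>lborel) - (\<integral>y. F 0 y \<partial>lborel)
      \<ge> t * (a * (qf V B - dr - s * rel V B) - (qf U A + dl - s * rel U A))" by (simp add: algebra_simps)
    moreover have "t * (a * (qf V B - dr - s * rel V B) - (qf U A + dl - s * rel U A)) > 0" using pos t by simp
    ultimately show ?thesis by linarith
  qed
  show "\<exists>U T T0. entropy_solution \<beta> \<gamma> T U \<and> 0 < T0 \<and> T0 \<le> T \<and>
      (\<forall>t. 0 < t \<and> t < T0 \<longrightarrow> total_dist \<gamma> a A B \<sigma> 0 (U 0) < total_dist \<gamma> a A B \<sigma> t (\<lambda>x. U t (x + \<alpha> t)))"
  proof (intro exI conjI allI impI)
    show "entropy_solution \<beta> \<gamma> 1 W" by (rule transition_entropy_solution[OF W])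
    show "0 < T0" "T0 \<le> 1" by (rule T0)+
    fix t assume t: "0 < t \<and> t < T0"
    have "0 \<le> (\<integral>y. F 0 y \<partial>lborel)" using F0 by simp
    thus "total_dist \<gamma> a A B \<sigma> 0 (W 0) < total_dist \<gamma> a A B \<sigma> t (\<lambda>x. W t (x + \<alpha> t))"
      using td[of 0] td[of t] main[of t] t T0 \<alpha>0 by (simp add: ennreal_less_iff)
  qed
qed

subsection \<open>Alfven waves\<close>

text \<open>At Alfven speed the tangential jump relations fix only the velocity jump, and equal
  field strength balances the pressure. Both parts of \<open>diss_mk\<close> vanish.\<close>

lemma path_alfven:
  assumes v: "v > 0" and b: "b2\<^sup>2 + b3\<^sup>2 = c2\<^sup>2 + c3\<^sup>2" and e: "e = 1 \<or> e = -1"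
  shows "path (mk v b2 b3 u w2 w3) (mk v c2 c3 u (w2 + e * sqrt v * (c2 - b2)) (w3 + e * sqrt v * (c3 - b3))) 0"
proof -
  define s where "s = - \<beta> * e / sqrt v"
  have ee: "e * e = 1" and vv: "sqrt v * sqrt v = v" "sqrt v \<noteq> 0" using e v by auto
  have sv: "s * v = - \<beta> * e * sqrt v" unfolding s_def using vv by (simp add: field_simps)
  have se: "s * e * sqrt v = - \<beta>" unfolding s_def using vv ee by (simp add: mult.assoc)
  have s0: "s \<noteq> 0" using beta e vv by (auto simp: s_def)
  have RH: "RH (mk v b2 b3 u w2 w3) (mk v c2 c3 u (w2 + e * sqrt v * (c2 - b2)) (w3 + e * sqrt v * (c3 - b3))) s"
    unfolding RH_mk[OF v v]
  proof (intro conjI)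
    show "\<beta> * (w2 - (w2 + e * sqrt v * (c2 - b2))) = s * (v * c2 - v * b2)"
      "\<beta> * (w3 - (w3 + e * sqrt v * (c3 - b3))) = s * (v * c3 - v * b3)"
      using sv by algebra+
    show "\<beta> * (b2 - c2) = s * (w2 + e * sqrt v * (c2 - b2) - w2)" "\<beta> * (b3 - c3) = s * (w3 + e * sqrt v * (c3 - b3) - w3)"
      using se by algebra+
  qed (use b in auto)
  have "\<beta>\<^sup>2 / s\<^sup>2 = v" unfolding s_def using vv beta e by (auto simp: power2_eq_square field_simps)
  hence "diss (mk v b2 b3 u w2 w3) (mk v c2 c3 u (w2 + e * sqrt v * (c2 - b2)) (w3 + e * sqrt v * (c3 - b3))) s = 0"
    unfolding diss_mk[OF v v RH s0] by simp
  thus ?thesis using path.shock[OF _ _ RH] v by simp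
qed

lemma path_trans0: "path A B 0 \<Longrightarrow> path B C 0 \<Longrightarrow> path A C 0"
  using path.trans[of A B 0 C 0] by simp

text \<open>Three Alfven jumps of alternating family lead from b through x and y back to b, and the
  velocity changes add up to 2 \<open>sqrt v\<close> (x - y). Vectors of length |b| can differ by at
  most 2 |b|, whence the bound on d.\<close>

lemma path_shift_small:
  assumes v: "v > 0" and d: "d2\<^sup>2 + d3\<^sup>2 \<le> 16 * (b2\<^sup>2 + b3\<^sup>2)"
  shows "path (mk v b2 b3 u w2 w3) (mk v b2 b3 u (w2 + sqrt v * d2) (w3 + sqrt v * d3)) 0"
proof (cases "d2\<^sup>2 + d3\<^sup>2 = 0")
  case True
  thus ?thesis using path.nil[of "mk v b2 b3 u w2 w3"] v by simp
next
  case False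
  define D where "D = d2\<^sup>2 + d3\<^sup>2"
  have D: "D > 0" using False by (simp add: D_def sum_power2_gt_zero_iff)
  define m where "m = sqrt ((b2\<^sup>2 + b3\<^sup>2 - D / 16) / D)"
  have m: "m\<^sup>2 * D = b2\<^sup>2 + b3\<^sup>2 - D / 16" using d D by (simp add: m_def D_def[symmetric])
  \<comment> \<open>Symmetric choice with x - y = d / 2: both are plus or minus d / 4 plus the same
    multiple \<open>m\<close> of d turned by a right angle, and \<open>m\<close> adjusts their
    length to that of b.\<close>
  define x2 x3 y2 y3 where "x2 = d2 / 4 - m * d3" and "x3 = d3 / 4 + m * d2" and "y2 = - d2 / 4 - m * d3" and "y3 = - d3 / 4 + m * d2"
  have x: "x2\<^sup>2 + x3\<^sup>2 = D / 16 + m\<^sup>2 * D" and y: "y2\<^sup>2 + y3\<^sup>2 = D / 16 + m\<^sup>2 * D"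
    unfolding x2_def x3_def y2_def y3_def D_def by (simp_all add: power2_eq_square algebra_simps)
  have n: "b2\<^sup>2 + b3\<^sup>2 = x2\<^sup>2 + x3\<^sup>2" "x2\<^sup>2 + x3\<^sup>2 = y2\<^sup>2 + y3\<^sup>2" "y2\<^sup>2 + y3\<^sup>2 = b2\<^sup>2 + b3\<^sup>2"
    using x y m by simp_all
  from path_trans0[OF path_trans0[OF path_alfven[OF v n(1), of 1] path_alfven[OF v n(2), of "-1"]] path_alfven[OF v n(3), of 1], of u w2 w3]
  show ?thesis by (simp add: x2_def x3_def y2_def y3_def algebra_simps)
qed

text \<open>One Alfven jump turns the field, then repeated small shifts correct the velocity. The
  result costs no dissipation and has no smallness condition.\<close>

lemma path_tangential:
  assumes v: "v > 0" and b: "b2\<^sup>2 + b3\<^sup>2 = c2\<^sup>2 + c3\<^sup>2" and nz: "b2 \<noteq> 0 \<or> b3 \<noteq> 0"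
  shows "path (mk v b2 b3 u w2 w3) (mk v c2 c3 u z2 z3) 0"
proof -
  have bp: "b2\<^sup>2 + b3\<^sup>2 > 0" using nz by (simp add: sum_power2_gt_zero_iff)
  have rep: "path (mk v c2 c3 u w2 w3) (mk v c2 c3 u (w2 + real n * (sqrt v * d2)) (w3 + real n * (sqrt v * d3))) 0"
    if "d2\<^sup>2 + d3\<^sup>2 \<le> 16 * (c2\<^sup>2 + c3\<^sup>2)" for n d2 d3 w2 w3
  proof (induction n)
    case 0
    show ?case using path.nil[of "mk v c2 c3 u w2 w3"] v by simp
  next
    case (Suc n)
    from path_trans0[OF Suc path_shift_small[OF v that]] show ?case by (simp add: algebra_simps)
  qed
  define y2 y3 where "y2 = w2 + 1 * sqrt v * (c2 - b2)" and "y3 = w3 + 1 * sqrt v * (c3 - b3)"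
  define a2 a3 where "a2 = (z2 - y2) / sqrt v" and "a3 = (z3 - y3) / sqrt v"
  \<comment> \<open>Cutting the velocity defect into \<open>n\<close> equal parts brings each part
    within the range of \<open>path_shift_small\<close>.\<close>
  obtain n :: nat where n: "(a2\<^sup>2 + a3\<^sup>2) / (16 * (c2\<^sup>2 + c3\<^sup>2)) < real n" using reals_Archimedean2 by blast
  have np: "real n > 0" using n bp b by (intro le_less_trans[OF _ n] divide_nonneg_pos) auto
  have "(a2 / real n)\<^sup>2 + (a3 / real n)\<^sup>2 = (a2\<^sup>2 + a3\<^sup>2) / (real n)\<^sup>2" by (simp add: power_divide add_divide_distrib)
  also have "\<dots> \<le> 16 * (c2\<^sup>2 + c3\<^sup>2)"
  proof -
    have "a2\<^sup>2 + a3\<^sup>2 < real n * (16 * (c2\<^sup>2 + c3\<^sup>2))" using n bp b by (simp add: divide_less_eq)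
    also have "\<dots> \<le> (real n)\<^sup>2 * (16 * (c2\<^sup>2 + c3\<^sup>2))"
      using np by (intro mult_right_mono) (auto simp: power2_eq_square)
    finally show ?thesis using np by (simp add: divide_le_eq mult.commute)
  qed
  finally have "path (mk v c2 c3 u y2 y3) (mk v c2 c3 u (y2 + real n * (sqrt v * (a2 / real n))) (y3 + real n * (sqrt v * (a3 / real n)))) 0"
    by (rule rep)
  moreover have "y2 + real n * (sqrt v * (a2 / real n)) = z2" "y3 + real n * (sqrt v * (a3 / real n)) = z3"
    using np v by (simp_all add: a2_def a3_def)
  ultimately show ?thesis
    using path_trans0[OF path_alfven[OF v b, of 1 u w2 w3]] by (simp add: y2_def y3_def)
qed

subsection \<open>Gas dynamics\<close>

lemma Cint_neg: "v > 0 \<Longrightarrow> Cint v < 0"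
  using gamma by (simp add: Cint_def)

text \<open>\<gamma> > 1 makes \<open>Cint\<close> range over all negative numbers, so a prescribed
  value is attained at a positive volume as long as it stays negative.\<close>

lemma Cint_surj: "c < 0 \<Longrightarrow> \<exists>v>0. Cint v = c"
proof -
  assume c: "c < 0"
  define y where "y = - c * (\<gamma> - 1) / (2 * sqrt \<gamma>)"
  have y: "y > 0" unfolding y_def using c gamma by (intro divide_pos_pos mult_pos_pos) auto
  have "(y powr (- 2 / (\<gamma> - 1))) powr (- (\<gamma> - 1) / 2) = y"
  proof -
    have "- 2 / (\<gamma> - 1) * (- (\<gamma> - 1) / 2) = 1" using gamma by (simp add: divide_simps)
    thus ?thesis using y by (simp only: powr_powr) simp
  qed
  hence "Cint (y powr (- 2 / (\<gamma> - 1))) = c"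
    using gamma by (simp add: Cint_def y_def)
  thus ?thesis using y by (intro exI[of _ "y powr (- 2 / (\<gamma> - 1))"]) auto
qed

text \<open>Two families of simple waves control the two Riemann invariants; a third wave is
  inserted only to avoid the vacuum.\<close>

lemma path_gas:
  assumes v: "0 < v1" "0 < v2"
  shows "path (mk v1 0 0 u1 w2 w3) (mk v2 0 0 u2 w2 w3) 0"
proof -
  define c1 c2 where "c1 = Cint v1" and "c2 = Cint v2"
  \<comment> \<open>A wave with e = 1 changes \<open>Cint\<close> and u1 equally, one with e = -1
    oppositely; this is half of the mismatch between the two required changes.\<close>
  define h2 where "h2 = ((c2 - c1) - (u2 - u1)) / 2"
  \<comment> \<open>The preliminary compression keeps \<open>c1 + h1 + h2\<close> at most
    \<open>c1\<close>, hence in the range of \<open>Cint\<close>; the last wave undoes it.\<close>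
  define h1 where "h1 = - \<bar>h2\<bar>"
  have c: "c1 < 0" "c2 < 0" using Cint_neg v by (auto simp: c1_def c2_def)
  have h: "c1 + h1 < 0" "c1 + h1 + h2 < 0" using c by (auto simp: h1_def)
  obtain x where x: "x > 0" "Cint x = c1 + h1" using Cint_surj[OF h(1)] by blast
  obtain y where y: "y > 0" "Cint y = c1 + h1 + h2" using Cint_surj[OF h(2)] by blast
  have 1: "path (mk v1 0 0 u1 w2 w3) (mk x 0 0 (u1 + h1) w2 w3) 0"
    using path.fan[OF v(1) x(1), of 1 u1 w2 w3] by (simp add: x c1_def)
  have 2: "path (mk x 0 0 (u1 + h1) w2 w3) (mk y 0 0 (u1 + h1 - h2) w2 w3) 0"
    using path.fan[OF x(1) y(1), of "-1" "u1 + h1" w2 w3] by (simp add: x y)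
  have 3: "path (mk y 0 0 (u1 + h1 - h2) w2 w3) (mk v2 0 0 u2 w2 w3) 0"
    using path.fan[OF y(1) v(2), of 1 "u1 + h1 - h2" w2 w3] by (simp add: y c2_def[symmetric] h2_def field_simps)
  from path_trans0[OF path_trans0[OF 1 2] 3] show ?thesis .
qed

subsection \<open>Switching the tangential field off\<close>

text \<open>Switching the field off forces s to be an Alfven speed of the magnetised state, and the
  hypothesis on \<open>x\<close> is the remaining momentum balance. The direction follows the
  comparison of sound and Alfven speed: \<open>Pi\<close> is compared with the trapezoid for entropy
  admissibility, and with the Taylor polynomial for the upper bound on the dissipation.\<close>

lemma switch_shock:
  assumes v: "0 < v" "0 < x" "x \<noteq> v" and f: "\<beta>\<^sup>2 / v * (x - v) + p x - p v = (b2\<^sup>2 + b3\<^sup>2) / 2"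
    and dir: "(v < x \<and> csq v \<le> \<beta>\<^sup>2 / v \<and> s = \<bar>\<beta>\<bar> / sqrt v) \<or> (x < v \<and> \<beta>\<^sup>2 / v \<le> csq v \<and> s = - \<bar>\<beta>\<bar> / sqrt v)"
  shows "\<exists>d. path (mk v b2 b3 u w2 w3) (mk x 0 0 (u + s * (v - x)) (w2 + \<beta> * b2 / s) (w3 + \<beta> * b3 / s)) d
    \<and> d \<le> \<bar>\<beta>\<bar> / sqrt v * ((b2\<^sup>2 + b3\<^sup>2) / 2) * \<bar>x - v\<bar>"
proof -
  let ?B = "mk x 0 0 (u + s * (v - x)) (w2 + \<beta> * b2 / s) (w3 + \<beta> * b3 / s)"
  define h where "h = (b2\<^sup>2 + b3\<^sup>2) / 2"
  have s2: "s\<^sup>2 = \<beta>\<^sup>2 / v" using dir v by (auto simp: power_divide)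
  have s0: "s \<noteq> 0" using dir v beta by auto
  have bs: "\<beta>\<^sup>2 / s\<^sup>2 = v" unfolding s2 using v beta by simp
  have bs2: "\<beta> * \<beta> = s * s * v" using s2 v by (simp add: field_simps power2_eq_square)
  have h0: "h \<ge> 0" by (simp add: h_def)
  have f': "p x - p v = s\<^sup>2 * (v - x) + h"
  proof -
    have "s\<^sup>2 * (x - v) = - (s\<^sup>2 * (v - x))" by (simp add: right_diff_distrib)
    thus ?thesis using f unfolding s2[symmetric] h_def by linarith
  qed
  have RH: "RH (mk v b2 b3 u w2 w3) ?B s"
    unfolding RH_mk[OF v(1,2)]
  proof (intro conjI)
    show "\<beta> * (w2 - (w2 + \<beta> * b2 / s)) = s * (x * 0 - v * b2)" "\<beta> * (w3 - (w3 + \<beta> * b3 / s)) = s * (x * 0 - v * b3)"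
      using bs2 s0 by (simp_all add: field_simps)
    show "p x + (0\<^sup>2 + 0\<^sup>2) / 2 - p v - (b2\<^sup>2 + b3\<^sup>2) / 2 = s * (u + s * (v - x) - u)"
      using f' unfolding h_def by (simp add: power2_eq_square)
  qed (use s0 in \<open>auto simp: algebra_simps\<close>)
  have D: "diss (mk v b2 b3 u w2 w3) ?B s = s * (s\<^sup>2 * (v - x)\<^sup>2 / 2 - Pi v x)"
    unfolding diss_mk[OF v(1,2) RH s0] bs by simp
  have "0 \<le> diss (mk v b2 b3 u w2 w3) ?B s \<and> diss (mk v b2 b3 u w2 w3) ?B s \<le> \<bar>s\<bar> * h * \<bar>x - v\<bar>"
  proof (cases "v < x")
    case True
    have s: "s > 0" using dir v beta True by auto
    have c: "csq v \<le> s\<^sup>2" unfolding s2 using dir True by auto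
    have "Pi v x \<le> (p v - p x) / 2 * (x - v)" using Pi_lt_trapezoid[OF v(1) True] by simp
    also have "\<dots> = s\<^sup>2 * (v - x)\<^sup>2 / 2 - h * (x - v) / 2"
    proof -
      have e: "p v - p x = s\<^sup>2 * (x - v) - h" using f' by (simp add: algebra_simps)
      show ?thesis unfolding e by (simp add: power2_eq_square field_simps)
    qed
    finally have 1: "Pi v x \<le> s\<^sup>2 * (v - x)\<^sup>2 / 2 - h * (x - v) / 2" .
    have "0 \<le> h * (x - v)" using h0 True by simp
    with 1 have 2: "0 \<le> s\<^sup>2 * (v - x)\<^sup>2 / 2 - Pi v x" by simp
    have "Pi v x \<ge> (p v - p x) * (x - v) - csq v * (x - v)\<^sup>2 / 2"
      using en_quadratic_right[OF v(1) True] by (simp add: Pi_def algebra_simps)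
    moreover have "(p v - p x) * (x - v) = s\<^sup>2 * (v - x)\<^sup>2 - h * (x - v)"
    proof -
      have e: "p v - p x = s\<^sup>2 * (x - v) - h" using f' by (simp add: algebra_simps)
      show ?thesis unfolding e by (simp add: power2_eq_square field_simps)
    qed
    moreover have "csq v * (x - v)\<^sup>2 \<le> s\<^sup>2 * (v - x)\<^sup>2"
      using mult_right_mono[OF c, of "(v - x)\<^sup>2"] by (simp add: power2_commute[of x v])
    ultimately have 3: "s\<^sup>2 * (v - x)\<^sup>2 / 2 - Pi v x \<le> h * (x - v)" by linarith
    show ?thesis unfolding D using 2 3 s True mult_left_mono[OF 3, of s] by simp
  next
    case False
    hence xv: "x < v" using v by auto
    have s: "s < 0" using dir v beta xv by auto
    have c: "s\<^sup>2 \<le> csq v" unfolding s2 using dir xv by auto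
    have "Pi v x \<ge> (p x - p v) / 2 * (v - x)" using Pi_gt_trapezoid[OF v(2) xv] by simp
    moreover have "(p x - p v) / 2 * (v - x) = s\<^sup>2 * (v - x)\<^sup>2 / 2 + h * (v - x) / 2"
      unfolding f' by (simp add: power2_eq_square field_simps)
    moreover have "0 \<le> h * (v - x)" using h0 xv by simp
    ultimately have 2: "s\<^sup>2 * (v - x)\<^sup>2 / 2 - Pi v x \<le> 0" by linarith
    have "Pi v x \<le> (p x - p v) * (v - x) - csq v * (v - x)\<^sup>2 / 2"
      using en_quadratic_left[OF v(2) xv] by (simp add: Pi_def power2_commute[of x v] algebra_simps)
    moreover have "(p x - p v) * (v - x) = s\<^sup>2 * (v - x)\<^sup>2 + h * (v - x)"
      unfolding f' by (simp add: power2_eq_square field_simps)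
    moreover have "s\<^sup>2 * (v - x)\<^sup>2 \<le> csq v * (v - x)\<^sup>2"
      using mult_right_mono[OF c, of "(v - x)\<^sup>2"] by simp
    ultimately have 3: "- (h * (v - x)) \<le> s\<^sup>2 * (v - x)\<^sup>2 / 2 - Pi v x" by linarith
    have "s * (s\<^sup>2 * (v - x)\<^sup>2 / 2 - Pi v x) \<le> s * (- (h * (v - x)))"
      using s 3 by (intro mult_left_mono_neg) auto
    thus ?thesis unfolding D using 2 s xv by (simp add: mult_nonpos_nonpos)
  qed
  moreover have "\<bar>s\<bar> = \<bar>\<beta>\<bar> / sqrt v" using dir v by auto
  moreover have "path (mk v b2 b3 u w2 w3) ?B (diss (mk v b2 b3 u w2 w3) ?B s)"
    by (rule path.shock[OF _ _ RH]) (use v calculation in auto)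
  ultimately show ?thesis by (auto simp: h_def)
qed

text \<open>A magnetic energy up to this bound can be switched off by a shock that changes the specific
  volume v by at most r.\<close>

definition gap :: "real \<Rightarrow> real \<Rightarrow> real" where
  "gap v r = min (p (v + r) - p v + csq v * r) (p (v - r) - p v - csq v * r)"

text \<open>Gas waves cannot alter the tangential velocity, so it is preset by Alfven jumps before
  the shock; volume and normal velocity are corrected by gas waves afterwards. All of these are
  free, and only the shock dissipates.\<close>

lemma path_switch_off:
  assumes r: "0 < r" "r < v" and b: "b2 \<noteq> 0 \<or> b3 \<noteq> 0" and g: "(b2\<^sup>2 + b3\<^sup>2) / 2 \<le> gap v r" and vg: "0 < vg"
  shows "\<exists>d. path (mk v b2 b3 u w2 w3) (mk vg 0 0 ug z2 z3) d \<and> d \<le> \<bar>\<beta>\<bar> / sqrt v * ((b2\<^sup>2 + b3\<^sup>2) / 2) * r"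
proof -
  have v: "0 < v" using r by simp
  let ?f = "\<lambda>x. \<beta>\<^sup>2 / v * (x - v) + p x - p v"
  have bp: "b2\<^sup>2 + b3\<^sup>2 > 0" using b by (simp add: sum_power2_gt_zero_iff)
  have cont: "continuous_on {a..c} ?f" if "0 < a" for a c
  proof -
    have "continuous_on {a..c} p"
      by (rule DERIV_continuous_on[of _ _ "\<lambda>x. - csq x"]) (use that in \<open>auto intro!: has_field_derivative_at_within DERIV_p\<close>)
    thus ?thesis by (intro continuous_intros)
  qed
  \<comment> \<open>An intermediate value argument finds the volume behind the shock, right or left
    of \<open>v\<close>; \<open>gap\<close> bounds the attained energy from below in either
    direction, whatever \<beta> is.\<close>
  have "\<exists>x s. 0 < x \<and> x \<noteq> v \<and> \<bar>x - v\<bar> \<le> r \<and> ?f x = (b2\<^sup>2 + b3\<^sup>2) / 2 \<and>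
      ((v < x \<and> csq v \<le> \<beta>\<^sup>2 / v \<and> s = \<bar>\<beta>\<bar> / sqrt v) \<or> (x < v \<and> \<beta>\<^sup>2 / v \<le> csq v \<and> s = - \<bar>\<beta>\<bar> / sqrt v))"
  proof (cases "csq v \<le> \<beta>\<^sup>2 / v")
    case True
    have "(b2\<^sup>2 + b3\<^sup>2) / 2 \<le> p (v + r) - p v + csq v * r" using g unfolding gap_def by linarith
    also have "\<dots> \<le> ?f (v + r)" using mult_right_mono[OF True, of r] r by (simp only: add_diff_cancel_left') linarith
    finally have "(b2\<^sup>2 + b3\<^sup>2) / 2 \<le> ?f (v + r)" .
    then obtain x where x: "v \<le> x" "x \<le> v + r" "?f x = (b2\<^sup>2 + b3\<^sup>2) / 2"
      using IVT'[of ?f v "(b2\<^sup>2 + b3\<^sup>2) / 2" "v + r", OF _ _ _ cont] v r bp by auto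
    have "x \<noteq> v" using x(3) bp by auto
    thus ?thesis using x v True by (intro exI[of _ x] exI[of _ "\<bar>\<beta>\<bar> / sqrt v"]) auto
  next
    case False
    have "(b2\<^sup>2 + b3\<^sup>2) / 2 \<le> p (v - r) - p v - csq v * r" using g unfolding gap_def by linarith
    also have "\<dots> \<le> ?f (v - r)"
    proof -
      have "\<beta>\<^sup>2 / v * r \<le> csq v * r" using False r by (intro mult_right_mono) auto
      moreover have "\<beta>\<^sup>2 / v * (v - r - v) = - (\<beta>\<^sup>2 / v * r)" by simp
      ultimately show ?thesis by linarith
    qed
    finally have "(b2\<^sup>2 + b3\<^sup>2) / 2 \<le> ?f (v - r)" .
    then obtain x where x: "v - r \<le> x" "x \<le> v" "?f x = (b2\<^sup>2 + b3\<^sup>2) / 2"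
      using IVT2'[of ?f v "(b2\<^sup>2 + b3\<^sup>2) / 2" "v - r", OF _ _ _ cont] v r bp by auto
    have "x \<noteq> v" using x(3) bp by auto
    thus ?thesis using x v r False by (intro exI[of _ x] exI[of _ "- \<bar>\<beta>\<bar> / sqrt v"]) auto
  qed
  then obtain x s where x: "0 < x" "x \<noteq> v" "\<bar>x - v\<bar> \<le> r" "?f x = (b2\<^sup>2 + b3\<^sup>2) / 2"
    and dir: "(v < x \<and> csq v \<le> \<beta>\<^sup>2 / v \<and> s = \<bar>\<beta>\<bar> / sqrt v) \<or> (x < v \<and> \<beta>\<^sup>2 / v \<le> csq v \<and> s = - \<bar>\<beta>\<bar> / sqrt v)" by blast
  obtain d where d: "path (mk v b2 b3 u (z2 - \<beta> * b2 / s) (z3 - \<beta> * b3 / s)) (mk x 0 0 (u + s * (v - x)) z2 z3) d"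
      "d \<le> \<bar>\<beta>\<bar> / sqrt v * ((b2\<^sup>2 + b3\<^sup>2) / 2) * \<bar>x - v\<bar>"
    using switch_shock[OF v x(1,2,4) dir, of u "z2 - \<beta> * b2 / s" "z3 - \<beta> * b3 / s"] by auto
  have "path (mk v b2 b3 u w2 w3) (mk vg 0 0 ug z2 z3) (0 + d + 0)"
    by (rule path.trans[OF path.trans[OF path_tangential[OF v refl b] d(1)] path_gas[OF x(1) vg]])
  moreover have "\<bar>\<beta>\<bar> / sqrt v * ((b2\<^sup>2 + b3\<^sup>2) / 2) * \<bar>x - v\<bar> \<le> \<bar>\<beta>\<bar> / sqrt v * ((b2\<^sup>2 + b3\<^sup>2) / 2) * r"
    using x(3) v by (intro mult_left_mono) auto
  ultimately show ?thesis using d(2) by (intro exI[of _ d]) auto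
qed

lemma gap_pos: "0 < r \<Longrightarrow> r < v \<Longrightarrow> gap v r > 0"
  using tangent_p_less[of v "v + r"] tangent_p_less[of v "v - r"] by (auto simp: gap_def algebra_simps)

lemma isCont_gap: "0 < r \<Longrightarrow> r < v \<Longrightarrow> isCont (\<lambda>v. gap v r) v"
proof -
  assume r: "0 < r" "r < v"
  have p: "isCont p x" if "x > 0" for x using DERIV_isCont[OF DERIV_p[OF that]] .
  have c: "isCont csq v" using DERIV_isCont[OF DERIV_csq] r by simp
  have "isCont (\<lambda>v. v + r) v" "isCont (\<lambda>v. v - r) v" by (intro continuous_intros)+
  from isCont_o2[OF this(1), of p] isCont_o2[OF this(2), of p]
  have "isCont (\<lambda>v. p (v + r)) v" "isCont (\<lambda>v. p (v - r)) v" using p r by auto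
  thus ?thesis unfolding gap_def[abs_def] min_def[symmetric] using p[of v] c r
    by (intro continuous_min continuous_intros) auto
qed

subsection \<open>Reflection\<close>

text \<open>The action of x -> -x on states: velocities change sign, while volume and tangential
  field do not.\<close>

fun mir :: "state \<Rightarrow> state" where
  "mir (v, q2, q3, u1, u2, u3) = (v, q2, q3, - u1, - u2, - u3)"

lemma mir_mk [simp]: "mir (mk v b2 b3 u w2 w3) = mk v b2 b3 (- u) (- w2) (- w3)"
  by (simp add: mk_def)

lemma mir_mir [simp]: "mir (mir U) = U" by (cases U) auto

lemma mir_states [simp]: "mir U \<in> states \<longleftrightarrow> U \<in> states" by (cases U) (auto simp: states_def)

lemma RH_mir: "RH A B s \<Longrightarrow> RH (mir B) (mir A) (- s)"
  unfolding rankine_hugoniot_def by (cases A; cases B) (auto simp: algebra_simps)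

lemma ent_mir [simp]: "ent (mir U) = ent U" by (cases U) auto
lemma entf_mir [simp]: "entf (mir U) = - entf U"
proof -
  have "P * - u - c * (b2 * - w2 + b3 * - w3) = - (P * u - c * (b2 * w2 + b3 * w3))" for P u c b2 b3 w2 w3 :: real
    by (simp add: algebra_simps)
  thus ?thesis by (cases U) (simp only: mir.simps entropy_flux.simps)
qed

lemma mir_diff: "mir (U - V) = mir U - mir V" by (cases U; cases V) auto
lemma inner_mir: "inner (mir U) (mir V) = inner U V" by (cases U; cases V) auto
lemma egrad_mir: "egrad \<gamma> (mir V) = mir (egrad \<gamma> V)" by (cases V) auto
lemma fl_mir: "fl (mir V) = - mir (fl V)" by (cases V) auto
lemma diss_mir: "diss (mir B) (mir A) (- s) = diss A B s" by (simp add: diss_def algebra_simps)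

lemma rel_mir [simp]: "V \<in> states \<Longrightarrow> rel (mir U) (mir V) = rel U V"
  by (simp add: rel_eq egrad_mir inner_mir flip: mir_diff)

lemma qf_mir [simp]: "qf (mir U) (mir V) = - qf U V"
proof -
  have "fl (mir U) - fl (mir V) = - mir (fl U - fl V)" by (simp add: fl_mir mir_diff)
  thus ?thesis by (simp add: qf_def egrad_mir inner_mir)
qed

lemma path_mir: "path A B d \<Longrightarrow> path (mir B) (mir A) d"
proof (induction rule: path.induct)
  case (shock A B s)
  thus ?case using path.shock[of "mir B" "mir A" "- s"] by (simp add: RH_mir diss_mir)
next
  case (fan v1 v2 e u w2 w3)
  thus ?case using path.fan[of v2 v1 "- e" "- (u + e * (Cint v2 - Cint v1))" "- w2" "- w3"]
    by (auto simp: algebra_simps)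
next
  case (trans A B d C d')
  thus ?case using path.trans[of "mir C" "mir B" d' "mir A" d] by (simp add: add.commute)
qed (simp add: path.nil)

lemma path_switch_on:
  assumes r: "0 < r" "r < v" and b: "b2 \<noteq> 0 \<or> b3 \<noteq> 0" and g: "(b2\<^sup>2 + b3\<^sup>2) / 2 \<le> gap v r" and vg: "0 < vg"
  shows "\<exists>d. path (mk vg 0 0 ug z2 z3) (mk v b2 b3 u w2 w3) d \<and> d \<le> \<bar>\<beta>\<bar> / sqrt v * ((b2\<^sup>2 + b3\<^sup>2) / 2) * r"
proof -
  obtain d where d: "path (mk v b2 b3 (- u) (- w2) (- w3)) (mk vg 0 0 (- ug) (- z2) (- z3)) d"
      "d \<le> \<bar>\<beta>\<bar> / sqrt v * ((b2\<^sup>2 + b3\<^sup>2) / 2) * r"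
    using path_switch_off[OF assms] by blast
  from path_mir[OF d(1)] d(2) show ?thesis by (intro exI[of _ d]) simp
qed

text \<open>Reflection moves the weight \<open>a\<close> to the other side; dividing the functional
  by \<open>a\<close> normalises it again, with weight \<open>1 / a\<close>.\<close>

lemma expanding_mir:
  assumes ex: "expanding (1 / a) (mir B) (mir A)" and a: "a > 0"
  shows "expanding a A B"
proof -
  obtain U V s dl dr where pl: "path (mir B) U dl" and pr: "path V (mir A) dr" and RH: "RH U V s" and d: "0 \<le> diss U V s"
    and exU: "0 \<le> excess (1 / a) (mir B) (mir A) U" and exV: "excess (1 / a) (mir B) (mir A) V \<le> 0"
    and pos: "0 < 1 / a * (qf V (mir A) - dr - s * rel V (mir A)) - (qf U (mir B) + dl - s * rel U (mir B))"
    using ex unfolding expanding_def by blast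
  have st: "A \<in> states" "B \<in> states" using path_states[OF pl] path_states[OF pr] by auto
  have r: "rel (mir X) A = rel X (mir A)" "rel (mir X) B = rel X (mir B)"
    "qf (mir X) A = - qf X (mir A)" "qf (mir X) B = - qf X (mir B)" for X
    using rel_mir[of "mir A" X] rel_mir[of "mir B" X] qf_mir[of X "mir A"] qf_mir[of X "mir B"] st by auto
  have "0 < a * (1 / a * (qf V (mir A) - dr - s * rel V (mir A)) - (qf U (mir B) + dl - s * rel U (mir B)))"
    using pos a by (rule mult_pos_pos[rotated])
  also have "\<dots> = (qf V (mir A) - dr - s * rel V (mir A)) - a * (qf U (mir B) + dl - s * rel U (mir B))"
    using a by (simp add: right_diff_distrib)
  finally have D: "0 < (qf V (mir A) - dr - s * rel V (mir A)) - a * (qf U (mir B) + dl - s * rel U (mir B))" .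
  have E: "0 \<le> rel U (mir A) - a * rel U (mir B)" "rel V (mir A) - a * rel V (mir B) \<le> 0"
    using exU exV a by (auto simp: excess_def field_simps)
  show ?thesis unfolding expanding_def
  proof (intro exI conjI)
    show "path A (mir V) dr" "path (mir U) B dl" using path_mir[OF pr] path_mir[OF pl] by simp_all
    show "RH (mir V) (mir U) (- s)" by (rule RH_mir[OF RH])
    show "0 \<le> diss (mir V) (mir U) (- s)" using d by (simp add: diss_mir)
    show "0 \<le> excess a A B (mir V)" "excess a A B (mir U) \<le> 0" using E by (auto simp: excess_def r)
    show "0 < a * (qf (mir U) B - dl - - s * rel (mir U) B) - (qf (mir V) A + dr - - s * rel (mir V) A)"
      using D by (simp add: r algebra_simps)
  qed
qed

subsection \<open>Shocks with tangential field on both sides\<close>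

lemma tendsto_mk [tendsto_intros]:
  assumes "(v \<longlongrightarrow> v') F" "(b2 \<longlongrightarrow> b2') F" "(b3 \<longlongrightarrow> b3') F" "(u \<longlongrightarrow> u') F" "(w2 \<longlongrightarrow> w2') F" "(w3 \<longlongrightarrow> w3') F"
  shows "((\<lambda>x. mk (v x) (b2 x) (b3 x) (u x) (w2 x) (w3 x)) \<longlongrightarrow> mk v' b2' b3' u' w2' w3') F"
  unfolding mk_def by (intro tendsto_intros assms)

lemma tendsto_continuous_states:
  assumes "continuous_on states g" "(U \<longlongrightarrow> U0) F" "U0 \<in> states"
  shows "((\<lambda>x. g (U x)) \<longlongrightarrow> g U0) F"
  using continuous_on_interior[of states g U0] assms open_states
  by (intro isCont_tendsto_compose[of U0 g]) (auto simp: interior_open)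

text \<open>At A itself the relative entropy to A vanishes and that to B is positive; continuity
  carries the sign to states near A.\<close>

lemma excess_left:
  assumes U: "(U \<longlongrightarrow> A) F" and AB: "A \<in> states" "B \<in> states" "A \<noteq> B" and a: "a > 0"
  shows "\<forall>\<^sub>F x in F. 0 \<le> excess a A B (U x)"
proof -
  have "((\<lambda>x. excess a A B (U x)) \<longlongrightarrow> excess a A B A) F" unfolding excess_def
    by (intro tendsto_intros tendsto_continuous_states[OF continuous_on_rel U] AB)
  moreover have "0 < excess a A B A" using rel_pos[OF AB] a by (simp add: excess_def rel_self[OF AB(1)])
  ultimately have "\<forall>\<^sub>F x in F. 0 < excess a A B (U x)" by (rule order_tendstoD(1))
  thus ?thesis by eventually_elim simp
qed

lemma excess_right:
  assumes U: "(U \<longlongrightarrow> B) F" and AB: "A \<in> states" "B \<in> states" "A \<noteq> B"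
  shows "\<forall>\<^sub>F x in F. excess a A B (U x) \<le> 0"
proof -
  have "((\<lambda>x. excess a A B (U x)) \<longlongrightarrow> excess a A B B) F" unfolding excess_def
    by (intro tendsto_intros tendsto_continuous_states[OF continuous_on_rel U] AB)
  moreover have "excess a A B B < 0" using rel_pos[OF AB(2,1)] AB(3) by (simp add: excess_def rel_self[OF AB(2)])
  ultimately have "\<forall>\<^sub>F x in F. excess a A B (U x) < 0" by (rule order_tendstoD(2))
  thus ?thesis by eventually_elim simp
qed

lemma RH_diff: "RH A W s \<Longrightarrow> RH A B s \<Longrightarrow> RH W B s"
  unfolding rankine_hugoniot_def
proof -
  assume 1: "fl W - fl A = s *\<^sub>R (W - A)" and 2: "fl B - fl A = s *\<^sub>R (B - A)"
  have "fl B - fl W = (fl B - fl A) - (fl W - fl A)" by simp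
  also have "\<dots> = s *\<^sub>R (B - W)" unfolding 1 2 by (simp add: scaleR_diff_right)
  finally show "fl B - fl W = s *\<^sub>R (B - W)" .
qed

text \<open>Rotations and constant changes of tangential velocity preserve the system, so the turned
  pair is again a shock with the same speed and dissipation, reached by free Alfven profiles. The
  quadratic form measuring the deviation from A can be made zero, and the one for B is then positive
  since \<open>vr < vl\<close>.\<close>

lemma expanding_rotation:
  assumes v: "0 < vl" "0 < vr" "vr < vl" and b: "b2 \<noteq> 0 \<or> b3 \<noteq> 0" and \<rho>: "0 < \<rho>" and \<sigma>: "\<sigma> < 0" "\<sigma>\<^sup>2 * vl \<le> \<beta>\<^sup>2"
    and A: "A = mk vl b2 b3 ul w2 w3" and B: "B = mk vr (\<rho> * b2) (\<rho> * b3) ur z2 z3" and RH: "RH A B \<sigma>"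
    and d: "0 \<le> diss A B \<sigma>" and a: "a > 0"
  shows "expanding a A B"
proof -
  note R = RH[unfolded A B RH_mk[OF v(1,2)]]
  have s0: "\<sigma> \<noteq> 0" using \<sigma> by simp
  \<comment> \<open>The jump of tangential velocity is this multiple of the left field.\<close>
  define \<kappa> where "\<kappa> = \<beta> * (1 - \<rho>) / \<sigma>"
  have z: "z2 = w2 + \<kappa> * b2" "z3 = w3 + \<kappa> * b3"
    using R s0 by (auto simp: \<kappa>_def field_simps)
  have R1: "\<beta>\<^sup>2 * (1 - \<rho>) = \<sigma>\<^sup>2 * (vl - \<rho> * vr)"
  proof -
    have "(\<beta>\<^sup>2 * (1 - \<rho>)) * b = (\<sigma>\<^sup>2 * (vl - \<rho> * vr)) * b"
      if "\<beta> * (w - z) = \<sigma> * (vr * (\<rho> * b) - vl * b)" "\<beta> * (b - \<rho> * b) = \<sigma> * (z - w)" for b w z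
      using that by algebra
    thus ?thesis using R b by (metis mult_right_cancel)
  qed
  have ks: "\<kappa> * \<sigma> = \<beta> * (1 - \<rho>)" "\<kappa> * \<beta> = \<sigma> * (vl - \<rho> * vr)"
    using s0 R1 by (simp_all add: \<kappa>_def field_simps power2_eq_square)
  \<comment> \<open>A root of the quadratic that gives the left contribution per unit of velocity
    over field deviation; it is real because the shock is not faster than the left Alfven
    speed.\<close>
  define \<zeta> where "\<zeta> = (- \<beta> + sqrt (\<beta>\<^sup>2 - \<sigma>\<^sup>2 * vl)) / \<sigma>"
  have "\<sigma> * \<zeta> + \<beta> = sqrt (\<beta>\<^sup>2 - \<sigma>\<^sup>2 * vl)" using s0 by (simp add: \<zeta>_def)
  hence "(\<sigma> * \<zeta> + \<beta>)\<^sup>2 = \<beta>\<^sup>2 - \<sigma>\<^sup>2 * vl" using \<sigma>(2) by simp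
  hence "\<sigma> * (\<sigma> * \<zeta>\<^sup>2 + 2 * \<beta> * \<zeta> + \<sigma> * vl) = 0" by (simp add: power2_eq_square algebra_simps)
  hence \<zeta>: "\<sigma> * \<zeta>\<^sup>2 + 2 * \<beta> * \<zeta> + \<sigma> * vl = 0" using s0 by simp
  define c2 where "c2 t = cos t * b2 - sin t * b3" for t
  define c3 where "c3 t = sin t * b2 + cos t * b3" for t
  define U where "U t = mk vl (c2 t) (c3 t) ul (w2 + \<zeta> * (c2 t - b2)) (w3 + \<zeta> * (c3 t - b3))" for t
  define V where "V t = mk vr (\<rho> * c2 t) (\<rho> * c3 t) ur (w2 + \<zeta> * (c2 t - b2) + \<kappa> * c2 t) (w3 + \<zeta> * (c3 t - b3) + \<kappa> * c3 t)" for t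
  have norm: "(c2 t)\<^sup>2 + (c3 t)\<^sup>2 = b2\<^sup>2 + b3\<^sup>2" for t
  proof -
    have "(c2 t)\<^sup>2 + (c3 t)\<^sup>2 = ((sin t)\<^sup>2 + (cos t)\<^sup>2) * (b2\<^sup>2 + b3\<^sup>2)"
      unfolding c2_def c3_def by algebra
    thus ?thesis by simp
  qed
  have lim: "(U \<longlongrightarrow> A) (at_right 0)" "(V \<longlongrightarrow> B) (at_right 0)"
  proof -
    have c: "(c2 \<longlongrightarrow> b2) (at_right 0)" "(c3 \<longlongrightarrow> b3) (at_right 0)"
      unfolding c2_def[abs_def] c3_def[abs_def] by (auto intro!: tendsto_eq_intros)
    show "(U \<longlongrightarrow> A) (at_right 0)" unfolding U_def[abs_def] A
      by (rule tendsto_eq_rhs[OF tendsto_mk]) (auto intro!: tendsto_eq_intros c)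
    show "(V \<longlongrightarrow> B) (at_right 0)" unfolding V_def[abs_def] B
      by (rule tendsto_eq_rhs[OF tendsto_mk]) (auto intro!: tendsto_eq_intros c simp: z)
  qed
  have AB: "A \<in> states" "B \<in> states" using v by (simp_all add: A B)
  moreover have "A \<noteq> B" using v by (auto simp: A B mk_def)
  ultimately have AB: "A \<in> states" "B \<in> states" "A \<noteq> B" by blast+
  have "\<forall>\<^sub>F t in at_right (0::real). t \<in> {0<..<1}" by (rule eventually_at_right_real) simp
  with excess_left[OF lim(1) AB a] excess_right[OF lim(2) AB, of a]
  have "\<forall>\<^sub>F t in at_right 0. 0 \<le> excess a A B (U t) \<and> excess a A B (V t) \<le> 0 \<and> t \<in> {0<..<1}"
    by eventually_elim auto
  then obtain t where ex: "0 \<le> excess a A B (U t)" "excess a A B (V t) \<le> 0" and t: "t \<in> {0<..<1}"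
    by (metis (no_types, lifting) eventually_happens trivial_limit_at_right_real)
  have RHt: "RH (U t) (V t) \<sigma>" unfolding U_def V_def RH_mk[OF v(1,2)]
  proof (intro conjI)
    show "ul - ur = \<sigma> * (vr - vl)" using R by blast
    show "\<beta> * (w2 + \<zeta> * (c2 t - b2) - (w2 + \<zeta> * (c2 t - b2) + \<kappa> * c2 t)) = \<sigma> * (vr * (\<rho> * c2 t) - vl * c2 t)"
      "\<beta> * (w3 + \<zeta> * (c3 t - b3) - (w3 + \<zeta> * (c3 t - b3) + \<kappa> * c3 t)) = \<sigma> * (vr * (\<rho> * c3 t) - vl * c3 t)"
      using ks(2) by algebra+
    show "\<beta> * (c2 t - \<rho> * c2 t) = \<sigma> * (w2 + \<zeta> * (c2 t - b2) + \<kappa> * c2 t - (w2 + \<zeta> * (c2 t - b2)))"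
      "\<beta> * (c3 t - \<rho> * c3 t) = \<sigma> * (w3 + \<zeta> * (c3 t - b3) + \<kappa> * c3 t - (w3 + \<zeta> * (c3 t - b3)))"
      using ks(1) by algebra+
    have "(\<rho> * c2 t)\<^sup>2 + (\<rho> * c3 t)\<^sup>2 = (\<rho> * b2)\<^sup>2 + (\<rho> * b3)\<^sup>2"
      using norm[of t] by (simp add: power_mult_distrib flip: distrib_left)
    thus "p vr + ((\<rho> * c2 t)\<^sup>2 + (\<rho> * c3 t)\<^sup>2) / 2 - p vl - ((c2 t)\<^sup>2 + (c3 t)\<^sup>2) / 2 = \<sigma> * (ur - ul)"
      using R norm[of t] by simp
  qed
  have "(c2 t - \<rho> * c2 t)\<^sup>2 + (c3 t - \<rho> * c3 t)\<^sup>2 = (b2 - \<rho> * b2)\<^sup>2 + (b3 - \<rho> * b3)\<^sup>2"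
  proof -
    have "(x - \<rho> * x)\<^sup>2 + (y - \<rho> * y)\<^sup>2 = (1 - \<rho>)\<^sup>2 * (x\<^sup>2 + y\<^sup>2)" for x y by (simp add: power2_eq_square algebra_simps)
    thus ?thesis by (simp add: norm)
  qed
  hence dt: "diss (U t) (V t) \<sigma> = diss A B \<sigma>"
    unfolding U_def V_def A B diss_mk[OF v(1,2) RH[unfolded A B] s0] diss_mk[OF v(1,2) RHt[unfolded U_def V_def] s0] by simp
  define G where "G = (c2 t - b2)\<^sup>2 + (c3 t - b3)\<^sup>2"
  have G: "G > 0"
  proof -
    have "sin t > 0" using t pi_gt3 by (intro sin_gt_zero) auto
    have "G = ((cos t - 1)\<^sup>2 + (sin t)\<^sup>2) * (b2\<^sup>2 + b3\<^sup>2)"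
      unfolding G_def c2_def c3_def by algebra
    moreover have "(cos t - 1)\<^sup>2 + (sin t)\<^sup>2 > 0" using \<open>sin t > 0\<close> by (intro add_nonneg_pos) auto
    moreover have "b2\<^sup>2 + b3\<^sup>2 > 0" using b by (simp add: sum_power2_gt_zero_iff)
    ultimately show ?thesis by simp
  qed
  have L: "qf (U t) A - \<sigma> * rel (U t) A = 0"
  proof -
    have "qf (U t) A - \<sigma> * rel (U t) A = - (G * (\<sigma> * \<zeta>\<^sup>2 + 2 * \<beta> * \<zeta> + \<sigma> * vl)) / 2"
    proof -
      have e: "- \<beta> * (x * (\<zeta> * x) + y * (\<zeta> * y)) - \<sigma> * (((\<zeta> * x)\<^sup>2 + (\<zeta> * y)\<^sup>2) / 2 + vl / 2 * (x\<^sup>2 + y\<^sup>2))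
          = - ((x\<^sup>2 + y\<^sup>2) * (\<sigma> * \<zeta>\<^sup>2 + 2 * \<beta> * \<zeta> + \<sigma> * vl)) / 2" for x y
        by (simp add: power2_eq_square field_simps)
      show ?thesis unfolding U_def A qf_mk[OF v(1,1)] rel_mk[OF v(1,1)] G_def e[symmetric] by simp
    qed
    thus ?thesis using \<zeta> by simp
  qed
  have Rr: "qf (V t) B - \<sigma> * rel (V t) B = - \<sigma> * \<rho> * (vl - vr) * G / 2"
  proof -
    have n: "(\<rho> * c2 t)\<^sup>2 + (\<rho> * c3 t)\<^sup>2 = (\<rho> * b2)\<^sup>2 + (\<rho> * b3)\<^sup>2"
      using norm[of t] by (simp add: power_mult_distrib flip: distrib_left)
    have "qf (V t) B - \<sigma> * rel (V t) B = - (G * (2 * \<beta> * \<rho> * (\<zeta> + \<kappa>) + \<sigma> * (\<zeta> + \<kappa>)\<^sup>2 + \<sigma> * vr * \<rho>\<^sup>2)) / 2"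
    proof -
      have e: "- \<beta> * (\<rho> * x * (\<mu> * x) + \<rho> * y * (\<mu> * y)) - \<sigma> * (((\<mu> * x)\<^sup>2 + (\<mu> * y)\<^sup>2) / 2 + vr / 2 * ((\<rho> * x)\<^sup>2 + (\<rho> * y)\<^sup>2))
          = - ((x\<^sup>2 + y\<^sup>2) * (2 * \<beta> * \<rho> * \<mu> + \<sigma> * \<mu>\<^sup>2 + \<sigma> * vr * \<rho>\<^sup>2)) / 2" for x y \<mu>
        by (simp add: power2_eq_square field_simps)
      have f: "\<rho> * c - \<rho> * b = \<rho> * (c - b)" "w + \<zeta> * (c - b) + \<kappa> * c - (w + \<kappa> * b) = (\<zeta> + \<kappa>) * (c - b)" for b c w
        by (simp_all add: algebra_simps)
      show ?thesis unfolding V_def B qf_mk[OF v(2,2)] rel_mk[OF v(2,2)] G_def z n f e[symmetric] by simp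
    qed
    also have "2 * \<beta> * \<rho> * (\<zeta> + \<kappa>) + \<sigma> * (\<zeta> + \<kappa>)\<^sup>2 + \<sigma> * vr * \<rho>\<^sup>2 = \<sigma> * \<rho> * (vl - vr)"
      using \<zeta> ks by algebra
    finally show ?thesis by simp
  qed
  have "0 < - \<sigma> * \<rho> * (vl - vr) * G / 2" using \<sigma> \<rho> v G by (intro divide_pos_pos mult_pos_pos) auto
  hence "0 < a * (- \<sigma> * \<rho> * (vl - vr) * G / 2)" by (rule mult_pos_pos[OF a])
  hence pos: "0 < a * (qf (V t) B - 0 - \<sigma> * rel (V t) B) - (qf (U t) A + 0 - \<sigma> * rel (U t) A)"
    using L Rr by simp
  have "path A (U t) 0" unfolding U_def A by (rule path_tangential[OF v(1) norm[symmetric] b])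
  moreover have "path (V t) B 0" unfolding V_def B
  proof (rule path_tangential[OF v(2)])
    show "(\<rho> * c2 t)\<^sup>2 + (\<rho> * c3 t)\<^sup>2 = (\<rho> * b2)\<^sup>2 + (\<rho> * b3)\<^sup>2"
      using norm[of t] by (simp add: power_mult_distrib flip: distrib_left)
    have "(c2 t)\<^sup>2 + (c3 t)\<^sup>2 > 0" using b by (simp add: norm sum_power2_gt_zero_iff)
    thus "\<rho> * c2 t \<noteq> 0 \<or> \<rho> * c3 t \<noteq> 0" using \<rho> by (auto simp: sum_power2_gt_zero_iff)
  qed
  ultimately show ?thesis unfolding expanding_def using RHt d dt ex pos
    by (intro exI[of _ "U t"] exI[of _ "V t"] exI[of _ \<sigma>] exI[of _ 0]) auto
qed

text \<open>The state W lies between the two waves, so it can play the role of U or of V, according to the sign of its excess.\<close>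

lemma expanding_two_waves:
  assumes AB: "A \<in> states" "B \<in> states" and W: "W \<in> states" "RH A W s" "0 \<le> diss A W s"
    and V: "RH W V s'" "0 \<le> diss W V s'" and ex: "excess a A B V \<le> 0" and pr: "path V B d" and a: "a > 0"
    and D1: "0 < (s' - s) * rel W A + a * (qf V B - s' * rel V B - d)"
    and D2: "excess a A B W < 0 \<Longrightarrow> 0 < (s' - s) * rel W B + (qf V B - s' * rel V B - d)"
  shows "expanding a A B"
proof (cases "0 \<le> excess a A B W")
  case True
  have Vs: "V \<in> states" using path_states[OF pr] by simp
  \<comment> \<open>The jump relation of the first wave absorbs its own dissipation. What remains on
    the left is the widening region of W between the waves, charged by the relative entropy to
    A.\<close>
  have q: "qf W A + diss A W s = s * rel W A"
    using qf_rel[OF W(2) AB(1)] AB(1) by (simp add: rel_self)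
  have "0 < a * (qf V B - d - s' * rel V B) - (qf W A + diss A W s - s' * rel W A)"
    using D1 unfolding q by (simp add: algebra_simps)
  thus ?thesis unfolding expanding_def
    using path.shock[OF AB(1) W] pr V True ex by blast
next
  case False
  hence eW: "excess a A B W < 0" by simp
  have Vs: "V \<in> states" using path_states[OF pr] by simp
  have "qf W B - (diss W V s' + d) - s * rel W B = (s' - s) * rel W B + (qf V B - s' * rel V B - d)"
    using qf_rel[OF V(1) AB(2)] by (simp add: algebra_simps)
  hence "0 < a * (qf W B - (diss W V s' + d) - s * rel W B) - (qf A A + 0 - s * rel A A)"
    using D2[OF eW] a AB(1) by (simp add: rel_self)
  moreover have "0 \<le> excess a A B A"
    using rel_nonneg[OF AB] a by (simp add: excess_def rel_self[OF AB(1)])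
  moreover have "path W B (diss W V s' + d)" by (rule path.trans[OF path.shock[OF W(1) Vs V] pr])
  ultimately show ?thesis unfolding expanding_def using path.nil[OF AB(1)] W less_imp_le[OF eW] by blast
qed

lemma continuous_on_p_Icc: "0 < x \<Longrightarrow> continuous_on {x..y} p"
  by (rule DERIV_continuous_on[of _ _ "\<lambda>x. - csq x"]) (auto intro!: has_field_derivative_at_within DERIV_p)

subsection \<open>Splitting a shock\<close>

text \<open>The volume behind the second of two shocks of equal speed m when that speed is lowered to \<open>m - \<tau>\<close>.\<close>

lemma perturbed_volume:
  assumes m: "0 < m" "m\<^sup>2 * vW = \<beta>\<^sup>2" "m\<^sup>2 < csq vr" and v: "0 < vr" "vr < vW" and h: "0 < h"
    and P: "p vr = p vW + h + m\<^sup>2 * (vW - vr)"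
  obtains C c \<tau>0 f where "0 < C" "0 < c" "0 < \<tau>0" "\<tau>0 \<le> m / 2"
    "\<And>\<tau>. 0 < \<tau> \<Longrightarrow> \<tau> < \<tau>0 \<Longrightarrow> vr \<le> f \<tau> \<and> f \<tau> \<le> vr + C * \<tau> \<and> (m - \<tau>)\<^sup>2 * f \<tau> < \<beta>\<^sup>2
      \<and> vW * (m\<^sup>2 - (m - \<tau>)\<^sup>2) / (\<beta>\<^sup>2 - (m - \<tau>)\<^sup>2 * f \<tau>) \<le> c * \<tau>
      \<and> p (f \<tau>) + h * (vW * (m\<^sup>2 - (m - \<tau>)\<^sup>2) / (\<beta>\<^sup>2 - (m - \<tau>)\<^sup>2 * f \<tau>))\<^sup>2 + (m - \<tau>)\<^sup>2 * (f \<tau> - vW) = p vW + h"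
proof -
  have lim: "((\<lambda>\<eta>. csq (vr + \<eta>)) \<longlongrightarrow> csq vr) (at_right 0)"
    by (rule isCont_tendsto_compose[OF DERIV_isCont[OF DERIV_csq[OF v(1)]]]) (auto intro!: tendsto_eq_intros)
  have "\<forall>\<^sub>F \<eta> in at_right 0. m\<^sup>2 < csq (vr + \<eta>) \<and> \<eta> \<in> {0<..<vW - vr}"
    using order_tendstoD(1)[OF lim m(3)] eventually_at_right_real[of 0 "vW - vr"] v by (auto elim: eventually_elim2)
  then obtain \<eta> where \<eta>: "m\<^sup>2 < csq (vr + \<eta>)" "0 < \<eta>" "vr + \<eta> < vW"
    by (metis (no_types, lifting) eventually_happens trivial_limit_at_right_real greaterThanLessThan_iff less_diff_eq add.commute)
  define m1 where "m1 = csq (vr + \<eta>)"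
  define \<Theta> where "\<Theta> = \<beta>\<^sup>2 - m\<^sup>2 * (vr + \<eta>)"
  have \<Theta>: "\<Theta> > 0" unfolding \<Theta>_def m(2)[symmetric] using \<eta> m(1) by simp
  define c where "c = 2 * m * vW / \<Theta>"
  have vW: "0 < vW" using v by simp
  have c: "c > 0" unfolding c_def using m(1) vW \<Theta> by simp
  have mm: "m1 - m\<^sup>2 > 0" using \<eta> by (simp add: m1_def)
  \<comment> \<open>Chosen so that moving the volume by \<open>C * \<tau>\<close> outweighs both the
    change of the momentum term and the bound \<open>h * c\<^sup>2 * \<tau>\<close> for the residual
    magnetic pressure.\<close>
  define C where "C = (2 * m * (vW - vr) + h * c\<^sup>2) / (m1 - m\<^sup>2)"
  have C: "C > 0" unfolding C_def using m(1) v h c mm by (intro divide_pos_pos add_pos_pos mult_pos_pos) auto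
  define \<tau>0 where "\<tau>0 = min (min 1 (m / 2)) (\<eta> / C)"
  have "\<tau>0 \<le> m / 2" unfolding \<tau>0_def by (rule order_trans[OF min.cobounded1 min.cobounded2])
  moreover have "0 < \<tau>0" "\<tau>0 \<le> 1" "\<tau>0 \<le> \<eta> / C" using m(1) \<eta> C by (auto simp: \<tau>0_def)
  ultimately have \<tau>0: "0 < \<tau>0" "\<tau>0 \<le> 1" "\<tau>0 \<le> m / 2" "\<tau>0 \<le> \<eta> / C" by blast+
  have "\<exists>x. vr \<le> x \<and> x \<le> vr + C * \<tau> \<and> (m - \<tau>)\<^sup>2 * x < \<beta>\<^sup>2
      \<and> vW * (m\<^sup>2 - (m - \<tau>)\<^sup>2) / (\<beta>\<^sup>2 - (m - \<tau>)\<^sup>2 * x) \<le> c * \<tau>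
      \<and> p x + h * (vW * (m\<^sup>2 - (m - \<tau>)\<^sup>2) / (\<beta>\<^sup>2 - (m - \<tau>)\<^sup>2 * x))\<^sup>2 + (m - \<tau>)\<^sup>2 * (x - vW) = p vW + h"
    if \<tau>: "0 < \<tau>" "\<tau> < \<tau>0" for \<tau>
  proof -
    define X where "X = (m - \<tau>)\<^sup>2"
    have mX: "m\<^sup>2 - X = \<tau> * (2 * m - \<tau>)" by (simp add: X_def power2_eq_square algebra_simps)
    have "\<tau> < m" using \<tau> \<tau>0 m(1) by auto
    hence mX0: "0 < m\<^sup>2 - X" unfolding mX using \<tau> by (intro mult_pos_pos) auto
    have mX1: "m\<^sup>2 - X \<le> 2 * m * \<tau>" unfolding mX using \<tau> by (simp add: algebra_simps)
    have "C * \<tau> \<le> C * \<tau>0" using \<tau> C by (intro mult_left_mono) auto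
    also have "\<dots> \<le> \<eta>" using \<tau>0(4) C by (simp add: le_divide_eq mult.commute)
    finally have Cet: "C * \<tau> \<le> \<eta>" .
    define k where "k x = vW * (m\<^sup>2 - X) / (\<beta>\<^sup>2 - X * x)" for x
    have den: "\<Theta> \<le> \<beta>\<^sup>2 - X * x" if "vr \<le> x" "x \<le> vr + \<eta>" for x
    proof -
      have "X * x \<le> m\<^sup>2 * (vr + \<eta>)" using that mX0 v by (intro mult_mono) (auto simp: X_def)
      thus ?thesis by (simp add: \<Theta>_def)
    qed
    have k: "0 < k x" "k x \<le> c * \<tau>" if "vr \<le> x" "x \<le> vr + \<eta>" for x
    proof -
      show "0 < k x" unfolding k_def using den[OF that] \<Theta> vW mX0 by (intro divide_pos_pos mult_pos_pos) auto
      have "k x \<le> vW * (2 * m * \<tau>) / \<Theta>" unfolding k_def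
        using den[OF that] \<Theta> vW mX0 mX1 m(1) \<tau> by (intro frac_le mult_left_mono) auto
      thus "k x \<le> c * \<tau>" by (simp add: c_def mult_ac)
    qed
    \<comment> \<open>The momentum balance after eliminating the residual field ratio
      \<open>k\<close>; it exceeds the required value at \<open>vr\<close> and falls short of it at
      \<open>vr + C * \<tau>\<close>.\<close>
    define H where "H x = p x + h * (k x)\<^sup>2 + X * (x - vW)" for x
    define y where "y = vr + C * \<tau>"
    have y: "vr \<le> y" "y \<le> vr + \<eta>" using C \<tau> Cet by (auto simp: y_def)
    have 1: "p vW + h \<le> H vr"
    proof -
      have "H vr = p vW + h + (m\<^sup>2 - X) * (vW - vr) + h * (k vr)\<^sup>2" unfolding H_def P by (simp add: algebra_simps)
      thus ?thesis using mX0 v h by simp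
    qed
    have 2: "H y \<le> p vW + h"
    proof -
      have "p y + csq y * (y - vr) \<le> p vr" by (rule tangent_p) (use y v in auto)
      moreover have "m1 \<le> csq y" using csq_strict_anti[of y "vr + \<eta>"] y v by (cases "y = vr + \<eta>") (auto simp: m1_def)
      hence "m1 * (y - vr) \<le> csq y * (y - vr)" using y by (intro mult_right_mono) auto
      ultimately have py: "p y \<le> p vr - m1 * (y - vr)" by linarith
      have "(k y)\<^sup>2 \<le> (c * \<tau>)\<^sup>2" using k[OF y] by (intro power_mono) auto
      also have "\<dots> \<le> c\<^sup>2 * \<tau>"
      proof -
        have "\<tau> * \<tau> \<le> \<tau>" using \<tau> \<tau>0 by (intro mult_left_le) auto
        thus ?thesis by (simp add: power_mult_distrib power2_eq_square[of \<tau>] mult_left_mono)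
      qed
      finally have ky: "h * (k y)\<^sup>2 \<le> h * c\<^sup>2 * \<tau>" using h by simp
      have "H y \<le> p vW + h + (m\<^sup>2 - X) * (vW - vr) - (m1 - X) * (y - vr) + h * c\<^sup>2 * \<tau>"
        unfolding H_def using py ky P by (simp add: algebra_simps)
      moreover have "(m\<^sup>2 - X) * (vW - vr) \<le> 2 * m * \<tau> * (vW - vr)" using mX1 v by (intro mult_right_mono) auto
      moreover have "(m1 - m\<^sup>2) * (y - vr) \<le> (m1 - X) * (y - vr)" using mX0 y by (intro mult_right_mono) auto
      moreover have "(m1 - m\<^sup>2) * (y - vr) = (2 * m * (vW - vr) + h * c\<^sup>2) * \<tau>"
        using mm by (simp add: y_def C_def)
      ultimately show ?thesis by (simp add: algebra_simps)
    qed
    have cont: "continuous_on {vr..y} H"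
    proof -
      have "\<beta>\<^sup>2 - X * x \<noteq> 0" if "x \<in> {vr..y}" for x using den[of x] that y \<Theta> by auto
      thus ?thesis unfolding H_def[abs_def] k_def[abs_def]
        by (intro continuous_intros continuous_on_p_Icc v) auto
    qed
    obtain x where x: "vr \<le> x" "x \<le> y" "H x = p vW + h" using IVT2'[OF 2 1 y(1) cont] by blast
    have xe: "x \<le> vr + \<eta>" using x y by simp
    show ?thesis
    proof (intro exI[of _ x] conjI)
      show "vr \<le> x" "x \<le> vr + C * \<tau>" using x by (auto simp: y_def)
      show "(m - \<tau>)\<^sup>2 * x < \<beta>\<^sup>2" using den[OF x(1) xe] \<Theta> by (simp add: X_def)
    qed (use k(2)[OF x(1) xe] x(3) in \<open>auto simp: k_def X_def H_def\<close>)
  qed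
  hence "\<exists>f. \<forall>\<tau>. 0 < \<tau> \<and> \<tau> < \<tau>0 \<longrightarrow> vr \<le> f \<tau> \<and> f \<tau> \<le> vr + C * \<tau> \<and> (m - \<tau>)\<^sup>2 * f \<tau> < \<beta>\<^sup>2
      \<and> vW * (m\<^sup>2 - (m - \<tau>)\<^sup>2) / (\<beta>\<^sup>2 - (m - \<tau>)\<^sup>2 * f \<tau>) \<le> c * \<tau>
      \<and> p (f \<tau>) + h * (vW * (m\<^sup>2 - (m - \<tau>)\<^sup>2) / (\<beta>\<^sup>2 - (m - \<tau>)\<^sup>2 * f \<tau>))\<^sup>2 + (m - \<tau>)\<^sup>2 * (f \<tau> - vW) = p vW + h"
    by (intro choice) blast
  then obtain f where "\<And>\<tau>. 0 < \<tau> \<Longrightarrow> \<tau> < \<tau>0 \<Longrightarrow> vr \<le> f \<tau> \<and> f \<tau> \<le> vr + C * \<tau> \<and> (m - \<tau>)\<^sup>2 * f \<tau> < \<beta>\<^sup>2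
      \<and> vW * (m\<^sup>2 - (m - \<tau>)\<^sup>2) / (\<beta>\<^sup>2 - (m - \<tau>)\<^sup>2 * f \<tau>) \<le> c * \<tau>
      \<and> p (f \<tau>) + h * (vW * (m\<^sup>2 - (m - \<tau>)\<^sup>2) / (\<beta>\<^sup>2 - (m - \<tau>)\<^sup>2 * f \<tau>))\<^sup>2 + (m - \<tau>)\<^sup>2 * (f \<tau> - vW) = p vW + h"
    by blast
  thus thesis using that[OF C c \<tau>0(1,3)] by blast
qed

lemma tendsto_diss:
  assumes U: "(U \<longlongrightarrow> A) F" and V: "(V \<longlongrightarrow> B) F" and s: "(s \<longlongrightarrow> s0) F" and AB: "A \<in> states" "B \<in> states"
  shows "((\<lambda>x. diss (U x) (V x) (s x)) \<longlongrightarrow> diss A B s0) F"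
  unfolding diss_def
  by (intro tendsto_intros s tendsto_continuous_states[OF continuous_on_ent _ AB(1)] tendsto_continuous_states[OF continuous_on_ent _ AB(2)]
    tendsto_continuous_states[OF continuous_on_entf _ AB(1)] tendsto_continuous_states[OF continuous_on_entf _ AB(2)] U V)

text \<open>Eliminating the tangential velocity from the jump relations leaves one linear equation
  for the field ratio k, the same for both components, and one momentum balance.\<close>

lemma RH_scaled:
  assumes v: "0 < v" "0 < v'" and n: "n \<noteq> 0" and k: "k * (\<beta>\<^sup>2 - n\<^sup>2 * v') = \<beta>\<^sup>2 - n\<^sup>2 * v"
    and P: "p v' + (b2\<^sup>2 + b3\<^sup>2) / 2 * k\<^sup>2 + n\<^sup>2 * (v' - v) = p v + (b2\<^sup>2 + b3\<^sup>2) / 2"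
  shows "RH (mk v b2 b3 u w2 w3) (mk v' (k * b2) (k * b3) (u + n * (v' - v))
    (w2 - \<beta> * (1 - k) * b2 / n) (w3 - \<beta> * (1 - k) * b3 / n)) (- n)"
proof -
  have t: "\<beta> * (w - (w - \<beta> * (1 - k) * b / n)) = - n * (v' * (k * b) - v * b)" for w b
  proof -
    have "\<beta> * (\<beta> * (1 - k) * b) = n * (- n * (v' * (k * b) - v * b))" using k by algebra
    thus ?thesis using n by (simp add: field_simps)
  qed
  have t': "\<beta> * (b - k * b) = - n * (w - \<beta> * (1 - k) * b / n - w)" for w b
    using n by (simp add: field_simps)
  have hk: "((k * b2)\<^sup>2 + (k * b3)\<^sup>2) / 2 = (b2\<^sup>2 + b3\<^sup>2) / 2 * k\<^sup>2" by (simp add: power_mult_distrib field_simps)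
  show ?thesis unfolding RH_mk[OF v]
  proof (intro conjI t t')
    show "u - (u + n * (v' - v)) = - n * (v' - v)" by simp
    show "p v' + ((k * b2)\<^sup>2 + (k * b3)\<^sup>2) / 2 - p v - (b2\<^sup>2 + b3\<^sup>2) / 2 = - n * (u + n * (v' - v) - u)"
      using P unfolding hk by (simp add: power2_eq_square algebra_simps)
  qed
qed

text \<open>The magnetic part of the dissipation vanishes, and strict convexity makes the gas part
  strictly positive. Strictness lets the perturbed shock remain entropic.\<close>

lemma switch_off_diss_pos:
  assumes v: "0 < vr" "vr < vW" and b: "b2 \<noteq> 0 \<or> b3 \<noteq> 0" and m: "0 < m" "m\<^sup>2 * vW = \<beta>\<^sup>2"
    and RH: "RH (mk vW b2 b3 uW w2 w3) (mk vr 0 0 ur z2 z3) (- m)"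
    and P: "p vr = p vW + (b2\<^sup>2 + b3\<^sup>2) / 2 + m\<^sup>2 * (vW - vr)"
  shows "0 < diss (mk vW b2 b3 uW w2 w3) (mk vr 0 0 ur z2 z3) (- m)"
proof -
  have vW: "0 < vW" using v by simp
  have 1: "\<beta>\<^sup>2 / (- m)\<^sup>2 = vW" using m by (simp add: field_simps)
  have h: "(b2\<^sup>2 + b3\<^sup>2) / 2 > 0" using b by (simp add: sum_power2_gt_zero_iff)
  have "Pi vW vr > (p vr - p vW) / 2 * (vW - vr)" by (rule Pi_gt_trapezoid[OF v])
  moreover have "(p vr - p vW) / 2 * (vW - vr) = (b2\<^sup>2 + b3\<^sup>2) / 2 * (vW - vr) / 2 + m\<^sup>2 * (vW - vr)\<^sup>2 / 2"
    unfolding P by (simp add: power2_eq_square field_simps)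
  moreover have "0 < (b2\<^sup>2 + b3\<^sup>2) / 2 * (vW - vr)" using h v by (intro mult_pos_pos) auto
  ultimately have "m\<^sup>2 * (vW - vr)\<^sup>2 / 2 - Pi vW vr < 0" by linarith
  moreover have "- m \<noteq> 0" using m by simp
  ultimately show ?thesis unfolding diss_mk[OF vW v(1) RH \<open>- m \<noteq> 0\<close>] 1
    using m by (simp add: mult_pos_neg)
qed

text \<open>Both waves start with the same speed. Slowing the second by \<tau> opens a region of W
  of width \<tau> t, a first-order gain. The state V then misses B by a volume and a field of order
  \<tau>, and this costs only second order.\<close>

lemma expanding_split:
  assumes A: "A \<in> states" "A \<noteq> B" and W: "W = mk vW b2 b3 uW w2 w3" "0 < vW" "b2 \<noteq> 0 \<or> b3 \<noteq> 0" "A \<noteq> W"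
    and B: "B = mk vr 0 0 ur z2 z3" "0 < vr"
    and RA: "RH A W (- m)" "0 \<le> diss A W (- m)" and RB: "RH W B (- m)"
    and m: "0 < m" "m\<^sup>2 < csq vr" "m\<^sup>2 * vr < \<beta>\<^sup>2" and a: "a > 0"
  shows "expanding a A B"
proof -
  note R = RB[unfolded W B RH_mk[OF W(2) B(2)]]
  define h where "h = (b2\<^sup>2 + b3\<^sup>2) / 2"
  have h: "h > 0" using W(3) by (simp add: h_def sum_power2_gt_zero_iff)
  have mv: "m\<^sup>2 * vW = \<beta>\<^sup>2"
  proof -
    have "(m\<^sup>2 * vW) * b = \<beta>\<^sup>2 * b" if "\<beta> * (w - z) = - m * (vr * 0 - vW * b)" "\<beta> * (b - 0) = - m * (z - w)" for b w z
      using that by algebra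
    thus ?thesis using R W(3) by (metis mult_right_cancel)
  qed
  have vr: "vr < vW"
  proof -
    have "m\<^sup>2 * vr < m\<^sup>2 * vW" using m mv by simp
    thus ?thesis using m(1) by simp
  qed
  have ur: "ur = uW + m * (vr - vW)" using R by (simp add: algebra_simps)
  have P: "p vr = p vW + h + m\<^sup>2 * (vW - vr)"
    using R unfolding ur by (simp add: h_def power2_eq_square algebra_simps)
  have z: "z2 = w2 - \<beta> * b2 / m" "z3 = w3 - \<beta> * b3 / m" using R m by (auto simp: field_simps)
  obtain C c \<tau>0 f where C: "0 < C" "0 < c" "0 < \<tau>0" "\<tau>0 \<le> m / 2" and f:
    "\<And>\<tau>. 0 < \<tau> \<Longrightarrow> \<tau> < \<tau>0 \<Longrightarrow> vr \<le> f \<tau> \<and> f \<tau> \<le> vr + C * \<tau> \<and> (m - \<tau>)\<^sup>2 * f \<tau> < \<beta>\<^sup>2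
      \<and> vW * (m\<^sup>2 - (m - \<tau>)\<^sup>2) / (\<beta>\<^sup>2 - (m - \<tau>)\<^sup>2 * f \<tau>) \<le> c * \<tau>
      \<and> p (f \<tau>) + h * (vW * (m\<^sup>2 - (m - \<tau>)\<^sup>2) / (\<beta>\<^sup>2 - (m - \<tau>)\<^sup>2 * f \<tau>))\<^sup>2 + (m - \<tau>)\<^sup>2 * (f \<tau> - vW) = p vW + h"
    using perturbed_volume[OF m(1) mv m(2) B(2) vr h P] by blast
  define k where "k \<tau> = vW * (m\<^sup>2 - (m - \<tau>)\<^sup>2) / (\<beta>\<^sup>2 - (m - \<tau>)\<^sup>2 * f \<tau>)" for \<tau>
  have f1: "vr \<le> f \<tau>" "f \<tau> \<le> vr + C * \<tau>" "(m - \<tau>)\<^sup>2 * f \<tau> < \<beta>\<^sup>2" "k \<tau> \<le> c * \<tau>"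
      "p (f \<tau>) + h * (k \<tau>)\<^sup>2 + (m - \<tau>)\<^sup>2 * (f \<tau> - vW) = p vW + h"
      "0 < k \<tau>" "0 < m - \<tau>" "m / 2 \<le> m - \<tau>" "m\<^sup>2 - (m - \<tau>)\<^sup>2 \<le> 2 * m * \<tau>" "0 < m\<^sup>2 - (m - \<tau>)\<^sup>2"
    if \<tau>: "0 < \<tau>" "\<tau> < \<tau>0" for \<tau>
  proof -
    show "vr \<le> f \<tau>" "f \<tau> \<le> vr + C * \<tau>" and d: "(m - \<tau>)\<^sup>2 * f \<tau> < \<beta>\<^sup>2" and "k \<tau> \<le> c * \<tau>"
      "p (f \<tau>) + h * (k \<tau>)\<^sup>2 + (m - \<tau>)\<^sup>2 * (f \<tau> - vW) = p vW + h"
      using f[OF \<tau>] by (auto simp: k_def)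
    show "0 < m - \<tau>" "m / 2 \<le> m - \<tau>" using \<tau> C(4) m(1) by auto
    have e: "m\<^sup>2 - (m - \<tau>)\<^sup>2 = \<tau> * (2 * m - \<tau>)" by (simp add: power2_eq_square algebra_simps)
    show "m\<^sup>2 - (m - \<tau>)\<^sup>2 \<le> 2 * m * \<tau>" unfolding e using \<tau> by (simp add: algebra_simps)
    show e0: "0 < m\<^sup>2 - (m - \<tau>)\<^sup>2" unfolding e using \<tau> C(4) m(1) by (intro mult_pos_pos) auto
    show "0 < k \<tau>" unfolding k_def using d e0 W(2) by (intro divide_pos_pos mult_pos_pos) auto
  qed
  have ev: "\<forall>\<^sub>F \<tau> in at_right 0. 0 < \<tau> \<and> \<tau> < \<tau>0"
    using eventually_at_right_real[OF C(3)] by (auto elim: eventually_mono)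
  have limf: "(f \<longlongrightarrow> vr) (at_right 0)"
  proof (rule tendsto_sandwich[of "\<lambda>_. vr" _ _ "\<lambda>\<tau>. vr + C * \<tau>"])
    show "\<forall>\<^sub>F \<tau> in at_right 0. vr \<le> f \<tau>" "\<forall>\<^sub>F \<tau> in at_right 0. f \<tau> \<le> vr + C * \<tau>"
      using ev f1(1,2) by (auto elim!: eventually_mono)
  qed (auto intro!: tendsto_eq_intros)
  have limk: "(k \<longlongrightarrow> 0) (at_right 0)"
  proof (rule tendsto_sandwich[of "\<lambda>_. 0" _ _ "\<lambda>\<tau>. c * \<tau>"])
    show "\<forall>\<^sub>F \<tau> in at_right 0. 0 \<le> k \<tau>" "\<forall>\<^sub>F \<tau> in at_right 0. k \<tau> \<le> c * \<tau>"
      using ev f1(4,6) by (auto elim!: eventually_mono simp: less_imp_le)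
  qed (auto intro!: tendsto_eq_intros)
  define V where "V \<tau> = mk (f \<tau>) (k \<tau> * b2) (k \<tau> * b3) (uW + (m - \<tau>) * (f \<tau> - vW))
      (w2 - \<beta> * (1 - k \<tau>) * b2 / (m - \<tau>)) (w3 - \<beta> * (1 - k \<tau>) * b3 / (m - \<tau>))" for \<tau>
  have limV: "(V \<longlongrightarrow> B) (at_right 0)" unfolding V_def[abs_def] B z ur
    by (rule tendsto_eq_rhs[OF tendsto_mk]) (use m in \<open>auto intro!: tendsto_eq_intros limf limk\<close>)
  have lims: "((\<lambda>\<tau>. - (m - \<tau>)) \<longlongrightarrow> - m) (at_right 0)" by (auto intro!: tendsto_eq_intros)
  have Bs: "B \<in> states" using B by simp
  have Ws: "W \<in> states" using W by simp
  have dWB: "0 < diss W B (- m)"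
    using switch_off_diss_pos[OF B(2) vr W(3) m(1) mv RB[unfolded W(1) B(1)] P[unfolded h_def]] by (simp add: W(1) B(1))
  have evd: "\<forall>\<^sub>F \<tau> in at_right 0. 0 < diss W (V \<tau>) (- (m - \<tau>))"
    by (rule order_tendstoD(1)[OF tendsto_diss[OF tendsto_const limV lims Ws Bs] dWB])
  \<comment> \<open>Any fixed value below \<open>vr\<close> would do: the residual field energy is
    already quadratic in \<tau>.\<close>
  define r where "r = vr / 2"
  have r: "0 < r" "r < vr" using B(2) by (auto simp: r_def)
  have "((\<lambda>\<tau>. gap (f \<tau>) r - h * (k \<tau>)\<^sup>2) \<longlongrightarrow> gap vr r - h * 0\<^sup>2) (at_right 0)"
    by (intro tendsto_intros limk isCont_tendsto_compose[OF isCont_gap[OF r] limf])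
  hence evg: "\<forall>\<^sub>F \<tau> in at_right 0. 0 < gap (f \<tau>) r - h * (k \<tau>)\<^sup>2"
    by (rule order_tendstoD(1)) (use gap_pos[OF r] in simp)
  \<comment> \<open>The three summands bound the normal part of the relative flux, its tangential
    part, and the dissipation of the final switch-off.\<close>
  define K where "K = (2 * m * vW + m\<^sup>2 * C) * (m * C + vW) + 4 * h * \<beta>\<^sup>2 * c\<^sup>2 / m + \<bar>\<beta>\<bar> / sqrt vr * h * c\<^sup>2 * r"
  have bound: "\<exists>d. path (V \<tau>) B d \<and> - K * \<tau>\<^sup>2 \<le> qf (V \<tau>) B - (- (m - \<tau>)) * rel (V \<tau>) B - d"
    if \<tau>: "0 < \<tau>" "\<tau> < \<tau>0" and g: "0 < gap (f \<tau>) r - h * (k \<tau>)\<^sup>2" for \<tau>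
  proof -
    note F = f1[OF \<tau>]
    define n where "n = m - \<tau>"
    have n: "0 < n" "m / 2 \<le> n" "n \<le> m" using F \<tau> by (auto simp: n_def)
    have fp: "0 < f \<tau>" using F(1) B(2) by simp
    have kc: "(k \<tau>)\<^sup>2 \<le> c\<^sup>2 * \<tau>\<^sup>2" using F(4,6) power_mono[of "k \<tau>" "c * \<tau>" 2] by (simp add: power_mult_distrib)
    have hk: "((k \<tau> * b2)\<^sup>2 + (k \<tau> * b3)\<^sup>2) / 2 = h * (k \<tau>)\<^sup>2" by (simp add: h_def power_mult_distrib field_simps)
    have rf: "r < f \<tau>" using r F(1) by simp
    have nz: "k \<tau> * b2 \<noteq> 0 \<or> k \<tau> * b3 \<noteq> 0" using F(6) W(3) by auto
    have g': "((k \<tau> * b2)\<^sup>2 + (k \<tau> * b3)\<^sup>2) / 2 \<le> gap (f \<tau>) r" using g unfolding hk by simp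
    obtain d where d: "path (V \<tau>) B d" "d \<le> \<bar>\<beta>\<bar> / sqrt (f \<tau>) * (((k \<tau> * b2)\<^sup>2 + (k \<tau> * b3)\<^sup>2) / 2) * r"
      unfolding V_def B(1) using path_switch_off[OF r(1) rf nz g' B(2)] by blast
    have d1: "d \<le> (\<bar>\<beta>\<bar> / sqrt vr * h * c\<^sup>2 * r) * \<tau>\<^sup>2"
    proof -
      have "\<bar>\<beta>\<bar> / sqrt (f \<tau>) \<le> \<bar>\<beta>\<bar> / sqrt vr" using F(1) B(2) by (intro divide_left_mono) auto
      hence "\<bar>\<beta>\<bar> / sqrt (f \<tau>) * (h * (k \<tau>)\<^sup>2) * r \<le> \<bar>\<beta>\<bar> / sqrt vr * (h * (c\<^sup>2 * \<tau>\<^sup>2)) * r"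
        using kc h r B(2) by (intro mult_mono mult_left_mono) auto
      thus ?thesis using d(2) unfolding hk by (simp add: mult_ac)
    qed
    have PP: "p (f \<tau>) + ((k \<tau> * b2)\<^sup>2 + (k \<tau> * b3)\<^sup>2) / 2 - p vr = - ((m\<^sup>2 - n\<^sup>2) * (vW - vr) + n\<^sup>2 * (f \<tau> - vr))"
      using F(5) P unfolding hk n_def by (simp add: algebra_simps)
    have uu: "uW + n * (f \<tau> - vW) - ur = n * (f \<tau> - vr) + \<tau> * (vW - vr)"
      unfolding ur n_def by (simp add: algebra_simps)
    \<comment> \<open>S is the total pressure of B minus that of V, T the normal velocity of V minus
      that of B. Both are of first order, and the normal flux is \<open>- S * T\<close>.\<close>
    define S where "S = (m\<^sup>2 - n\<^sup>2) * (vW - vr) + n\<^sup>2 * (f \<tau> - vr)"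
    define T where "T = n * (f \<tau> - vr) + \<tau> * (vW - vr)"
    have S: "0 \<le> S" "S \<le> (2 * m * vW + m\<^sup>2 * C) * \<tau>"
    proof -
      show "0 \<le> S" unfolding S_def using F(1,10) vr by (intro add_nonneg_nonneg mult_nonneg_nonneg) (auto simp: n_def)
      have "(m\<^sup>2 - n\<^sup>2) * (vW - vr) \<le> (2 * m * \<tau>) * vW" using F(9,10) vr B(2) \<tau> m(1) by (intro mult_mono) (auto simp: n_def)
      moreover have "n\<^sup>2 * (f \<tau> - vr) \<le> m\<^sup>2 * (C * \<tau>)" using F(1,2,10) by (intro mult_mono) (auto simp: n_def)
      ultimately show "S \<le> (2 * m * vW + m\<^sup>2 * C) * \<tau>" unfolding S_def by (simp add: algebra_simps)
    qed
    have T: "0 \<le> T" "T \<le> (m * C + vW) * \<tau>"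
    proof -
      show "0 \<le> T" unfolding T_def using F(1) n vr \<tau> by (intro add_nonneg_nonneg mult_nonneg_nonneg) auto
      have "n * (f \<tau> - vr) \<le> m * (C * \<tau>)" using F(1,2) n m by (intro mult_mono) auto
      moreover have "\<tau> * (vW - vr) \<le> \<tau> * vW" using \<tau> B(2) by (intro mult_left_mono) auto
      ultimately show "T \<le> (m * C + vW) * \<tau>" unfolding T_def by (simp add: algebra_simps)
    qed
    have ST: "S * T \<le> ((2 * m * vW + m\<^sup>2 * C) * (m * C + vW)) * \<tau>\<^sup>2"
      using mult_mono[OF S(2) T(2)] S T by (simp add: power2_eq_square mult_ac)
    \<comment> \<open>The velocity mismatch has a part proportional to the residual ratio
      \<open>k \<tau>\<close>, giving second order after multiplication with the field, and a part
      of favourable sign.\<close>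
    have tang: "- (4 * h * \<beta>\<^sup>2 * c\<^sup>2 / m) * \<tau>\<^sup>2 \<le> - \<beta> * ((k \<tau> * b2 - 0) * (w2 - \<beta> * (1 - k \<tau>) * b2 / n - z2)
        + (k \<tau> * b3 - 0) * (w3 - \<beta> * (1 - k \<tau>) * b3 / n - z3))"
    proof -
      have x: "w - \<beta> * (1 - k \<tau>) * b / n - (w - \<beta> * b / m) = \<beta> * b * (k \<tau> / n - \<tau> / (m * n))" for w b
      proof -
        have "w - \<beta> * (1 - \<kappa>) * b / n - (w - \<beta> * b / m) = \<beta> * b * (\<kappa> / n - (m - n) / (m * n))" for \<kappa>
          using n(1) m(1) by (simp add: field_simps)
        thus ?thesis by (simp add: n_def)
      qed
      have "- \<beta> * ((\<kappa> * b2 - 0) * (\<beta> * b2 * X) + (\<kappa> * b3 - 0) * (\<beta> * b3 * X)) = - (2 * h * \<beta>\<^sup>2) * \<kappa> * X" for \<kappa> X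
        unfolding h_def by (simp add: power2_eq_square algebra_simps)
      hence "- \<beta> * ((k \<tau> * b2 - 0) * (w2 - \<beta> * (1 - k \<tau>) * b2 / n - z2) + (k \<tau> * b3 - 0) * (w3 - \<beta> * (1 - k \<tau>) * b3 / n - z3))
        = - (2 * h * \<beta>\<^sup>2) * k \<tau> * (k \<tau> / n - \<tau> / (m * n))" unfolding z x .
      also have "\<dots> = - (2 * h * \<beta>\<^sup>2) * (k \<tau>)\<^sup>2 / n + (2 * h * \<beta>\<^sup>2) * k \<tau> * \<tau> / (m * n)"
        by (simp add: right_diff_distrib power2_eq_square)
      finally have "- \<beta> * ((k \<tau> * b2 - 0) * (w2 - \<beta> * (1 - k \<tau>) * b2 / n - z2) + (k \<tau> * b3 - 0) * (w3 - \<beta> * (1 - k \<tau>) * b3 / n - z3))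
        = - (2 * h * \<beta>\<^sup>2) * (k \<tau>)\<^sup>2 / n + (2 * h * \<beta>\<^sup>2) * k \<tau> * \<tau> / (m * n)" .
      moreover have "0 \<le> (2 * h * \<beta>\<^sup>2) * k \<tau> * \<tau> / (m * n)" using h F(6) \<tau> m n by simp
      moreover have "(2 * h * \<beta>\<^sup>2) * (k \<tau>)\<^sup>2 / n \<le> (2 * h * \<beta>\<^sup>2) * (c\<^sup>2 * \<tau>\<^sup>2) / (m / 2)"
        using h kc n m by (intro frac_le mult_left_mono) auto
      ultimately show ?thesis by (simp add: mult_ac)
    qed
    have vv: "0 < f \<tau>" "0 < vr" using fp B by auto
    have "qf (V \<tau>) B = - S * T - \<beta> * ((k \<tau> * b2 - 0) * (w2 - \<beta> * (1 - k \<tau>) * b2 / n - z2)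
        + (k \<tau> * b3 - 0) * (w3 - \<beta> * (1 - k \<tau>) * b3 / n - z3))"
      unfolding V_def B(1) qf_mk[OF vv] using PP uu by (simp add: S_def T_def n_def)
    hence "- S * T - 4 * h * \<beta>\<^sup>2 * c\<^sup>2 / m * \<tau>\<^sup>2 \<le> qf (V \<tau>) B" using tang by simp
    moreover have "K * \<tau>\<^sup>2 = ((2 * m * vW + m\<^sup>2 * C) * (m * C + vW)) * \<tau>\<^sup>2 + 4 * h * \<beta>\<^sup>2 * c\<^sup>2 / m * \<tau>\<^sup>2
        + (\<bar>\<beta>\<bar> / sqrt vr * h * c\<^sup>2 * r) * \<tau>\<^sup>2" by (simp add: K_def distrib_right)
    ultimately have "- K * \<tau>\<^sup>2 \<le> qf (V \<tau>) B - d" using ST d1 by linarith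
    moreover have "0 \<le> n * rel (V \<tau>) B" using n rel_nonneg[of "V \<tau>" B] fp B by (simp add: V_def)
    ultimately have "- K * \<tau>\<^sup>2 \<le> qf (V \<tau>) B - (- n) * rel (V \<tau>) B - d" by simp
    thus ?thesis using d(1) unfolding n_def by blast
  qed
  have rpos: "0 < rel W A" "W \<noteq> B \<Longrightarrow> 0 < rel W B" using rel_pos[OF Ws A(1)] rel_pos[OF Ws Bs] W(4) by auto
  have WB: "W \<noteq> B" using vr by (auto simp: W B mk_def)
  have "((\<lambda>\<tau>. rel W A - a * K * \<tau>) \<longlongrightarrow> rel W A - a * K * 0) (at_right 0)"
    "((\<lambda>\<tau>. rel W B - K * \<tau>) \<longlongrightarrow> rel W B - K * 0) (at_right 0)" by (intro tendsto_intros)+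
  hence "\<forall>\<^sub>F \<tau> in at_right 0. 0 < rel W A - a * K * \<tau>" "\<forall>\<^sub>F \<tau> in at_right 0. 0 < rel W B - K * \<tau>"
    using order_tendstoD(1)[of "\<lambda>\<tau>. rel W A - a * K * \<tau>" _ _ 0] order_tendstoD(1)[of "\<lambda>\<tau>. rel W B - K * \<tau>" _ _ 0] rpos WB by fastforce+
  with ev evd evg excess_right[OF limV A(1) Bs A(2), of a]
  have "\<forall>\<^sub>F \<tau> in at_right 0. 0 < \<tau> \<and> \<tau> < \<tau>0 \<and> 0 < diss W (V \<tau>) (- (m - \<tau>)) \<and> 0 < gap (f \<tau>) r - h * (k \<tau>)\<^sup>2
      \<and> excess a A B (V \<tau>) \<le> 0 \<and> 0 < rel W A - a * K * \<tau> \<and> 0 < rel W B - K * \<tau>"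
    by eventually_elim auto
  then obtain \<tau> where \<tau>: "0 < \<tau>" "\<tau> < \<tau>0" "0 < diss W (V \<tau>) (- (m - \<tau>))" "0 < gap (f \<tau>) r - h * (k \<tau>)\<^sup>2"
      "excess a A B (V \<tau>) \<le> 0" "0 < rel W A - a * K * \<tau>" "0 < rel W B - K * \<tau>"
    by (metis (no_types, lifting) eventually_happens trivial_limit_at_right_real)
  obtain d where d: "path (V \<tau>) B d" "- K * \<tau>\<^sup>2 \<le> qf (V \<tau>) B - (- (m - \<tau>)) * rel (V \<tau>) B - d"
    using bound[OF \<tau>(1,2,4)] by blast
  note F = f1[OF \<tau>(1,2)]
  have RV: "RH W (V \<tau>) (- (m - \<tau>))"
  proof -
    have "\<beta>\<^sup>2 - (m - \<tau>)\<^sup>2 * f \<tau> \<noteq> 0" using F(3) by simp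
    hence "k \<tau> * (\<beta>\<^sup>2 - (m - \<tau>)\<^sup>2 * f \<tau>) = vW * (m\<^sup>2 - (m - \<tau>)\<^sup>2)" by (simp add: k_def)
    hence kk: "k \<tau> * (\<beta>\<^sup>2 - (m - \<tau>)\<^sup>2 * f \<tau>) = \<beta>\<^sup>2 - (m - \<tau>)\<^sup>2 * vW" using mv by (simp add: algebra_simps)
    show ?thesis unfolding W(1) V_def
      by (rule RH_scaled[OF W(2) _ _ kk]) (use F B(2) in \<open>auto simp: h_def\<close>)
  qed
  show ?thesis
  proof (rule expanding_two_waves[OF A(1) Bs Ws RA RV less_imp_le[OF \<tau>(3)] \<tau>(5) d(1) a])
    have "a * (- K * \<tau>\<^sup>2) \<le> a * (qf (V \<tau>) B - (- (m - \<tau>)) * rel (V \<tau>) B - d)" using d(2) a by (intro mult_left_mono) auto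
    moreover have "0 < \<tau> * (rel W A - a * K * \<tau>)" using \<tau> by (intro mult_pos_pos)
    ultimately show "0 < (- (m - \<tau>) - - m) * rel W A + a * (qf (V \<tau>) B - - (m - \<tau>) * rel (V \<tau>) B - d)"
      by (simp add: power2_eq_square algebra_simps)
    have "0 < \<tau> * (rel W B - K * \<tau>)" using \<tau> by (intro mult_pos_pos)
    thus "0 < (- (m - \<tau>) - - m) * rel W B + (qf (V \<tau>) B - - (m - \<tau>) * rel (V \<tau>) B - d)"
      using d(2) by (simp add: power2_eq_square algebra_simps)
  qed
qed

subsection \<open>Shocks into a state without tangential field\<close>

text \<open>Without field the tangential velocity cannot jump. A shock slower than the sound speed
  behind it must then compress and be supersonic ahead, by strict convexity of
  \<open>p\<close>.\<close>

lemma gas_shock: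
  assumes v: "0 < vl" "0 < vr" and RH: "RH (mk vl 0 0 ul w2 w3) (mk vr 0 0 ur z2 z3) (- m)"
    and ne: "mk vl 0 0 ul w2 w3 \<noteq> mk vr 0 0 ur z2 z3" and m: "0 < m" "m\<^sup>2 < csq vr"
  shows "z2 = w2" "z3 = w3" "ur = ul + m * (vr - vl)" "p vr = p vl + m\<^sup>2 * (vl - vr)" "vr < vl" "csq vl < m\<^sup>2"
    "0 < diss (mk vl 0 0 ul w2 w3) (mk vr 0 0 ur z2 z3) (- m)"
proof -
  note R = RH[unfolded RH_mk[OF v]]
  show w: "z2 = w2" "z3 = w3" using R beta by auto
  show u: "ur = ul + m * (vr - vl)" using R by (simp add: algebra_simps)
  show P: "p vr = p vl + m\<^sup>2 * (vl - vr)" using R unfolding u by (simp add: power2_eq_square algebra_simps)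
  have "vl \<noteq> vr" using ne unfolding w u by auto
  from tangent_p_less[OF v(2,1)] tangent_p_less[OF v] this
  have t: "0 < (csq vr - m\<^sup>2) * (vl - vr)" "0 < (m\<^sup>2 - csq vl) * (vl - vr)" unfolding P by (auto simp: algebra_simps)
  show vv: "vr < vl" using t(1) m(2) by (simp add: zero_less_mult_iff)
  show "csq vl < m\<^sup>2" using t(2) vv by (simp add: zero_less_mult_iff)
  have "(p vr - p vl) / 2 * (vl - vr) = m\<^sup>2 * (vl - vr)\<^sup>2 / 2" unfolding P by (simp add: power2_eq_square)
  hence "m\<^sup>2 * (vl - vr)\<^sup>2 / 2 - Pi vl vr < 0" using Pi_gt_trapezoid[OF v(2) vv] by simp
  moreover have "- m \<noteq> 0" using m by simp
  ultimately show "0 < diss (mk vl 0 0 ul w2 w3) (mk vr 0 0 ur z2 z3) (- m)"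
    unfolding diss_mk[OF v RH \<open>- m \<noteq> 0\<close>] using m by (simp add: mult_pos_neg)
qed

text \<open>The tangent inequalities at \<open>x\<close> towards both ends are combined with the
  barycentric weights of \<open>x\<close>; the slope terms cancel.\<close>

lemma chord_p_less:
  assumes v: "0 < vr" "vr < x" "x < vl" and P: "p vr = p vl + c * (vl - vr)"
  shows "p x < p vl + c * (vl - x)"
proof -
  have "p x + csq x * (x - vl) < p vl" "p x + csq x * (x - vr) < p vr"
    using v by (auto intro!: tangent_p_less)
  hence "(x - vr) * (p x + csq x * (x - vl)) < (x - vr) * p vl" "(vl - x) * (p x + csq x * (x - vr)) < (vl - x) * p vr"
    using v by (auto intro!: mult_strict_left_mono)
  hence "(x - vr) * (p x + csq x * (x - vl)) + (vl - x) * (p x + csq x * (x - vr)) < (x - vr) * p vl + (vl - x) * p vr" by linarith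
  also have "(x - vr) * (p x + csq x * (x - vl)) + (vl - x) * (p x + csq x * (x - vr)) = (vl - vr) * p x" by (simp add: algebra_simps)
  also have "(x - vr) * p vl + (vl - x) * p vr = (vl - vr) * (p vl + c * (vl - x))" unfolding P by (simp add: algebra_simps)
  finally show ?thesis using v by simp
qed

text \<open>The speed is the Alfven speed of the magnetised state behind the wave, and y comes from
  the momentum balance. The magnetic part of the dissipation is no longer zero, but the trapezoid
  bound outweighs it.\<close>

lemma switch_on_wave:
  assumes v: "0 < x" "x < v" and n: "0 < n" "n\<^sup>2 * x = \<beta>\<^sup>2" and y: "y\<^sup>2 / 2 = n\<^sup>2 * (v - x) - (p x - p v)"
  shows "RH (mk v 0 0 u w2 w3) (mk x y 0 (u + n * (x - v)) (w2 + \<beta> * y / n) w3) (- n)"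
    and "0 \<le> diss (mk v 0 0 u w2 w3) (mk x y 0 (u + n * (x - v)) (w2 + \<beta> * y / n) w3) (- n)"
proof -
  have v0: "0 < v" using v by simp
  show RH: "RH (mk v 0 0 u w2 w3) (mk x y 0 (u + n * (x - v)) (w2 + \<beta> * y / n) w3) (- n)"
    unfolding RH_mk[OF v0 v(1)]
  proof (intro conjI)
    have "\<beta> * (\<beta> * y) = n * (n * x * y)" using n(2) by algebra
    thus "\<beta> * (w2 - (w2 + \<beta> * y / n)) = - n * (x * y - v * 0)" using n(1) by (simp add: field_simps)
    show "p x + (y\<^sup>2 + 0\<^sup>2) / 2 - p v - (0\<^sup>2 + 0\<^sup>2) / 2 = - n * (u + n * (x - v) - u)"
      using y by (simp add: power2_eq_square[of n] algebra_simps)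
  qed (use n in auto)
  have bn: "\<beta>\<^sup>2 / (- n)\<^sup>2 = x" using n by (simp add: field_simps)
  have "Pi v x > (p x - p v) / 2 * (v - x)" by (rule Pi_gt_trapezoid[OF v])
  moreover have "p x - p v = n\<^sup>2 * (v - x) - y\<^sup>2 / 2" using y by linarith
  ultimately have 1: "Pi v x > (n\<^sup>2 * (v - x) - y\<^sup>2 / 2) / 2 * (v - x)" by (simp only:)
  have 2: "(n\<^sup>2 * (v - x) - y\<^sup>2 / 2) / 2 * (v - x) = n\<^sup>2 * (v - x)\<^sup>2 / 2 + y\<^sup>2 / 2 * (x - v) + y\<^sup>2 / 2 * (v - x) / 2"
    by (simp add: power2_eq_square field_simps)
  have "0 \<le> y\<^sup>2 / 2 * (v - x)" using v by simp
  with 1 2 have 3: "n\<^sup>2 * (v - x)\<^sup>2 / 2 - Pi v x + y\<^sup>2 / 2 * (x - v) \<le> 0" by linarith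
  have "- n \<noteq> 0" using n by simp
  from 3 show "0 \<le> diss (mk v 0 0 u w2 w3) (mk x y 0 (u + n * (x - v)) (w2 + \<beta> * y / n) w3) (- n)"
    unfolding diss_mk[OF v0 v(1) RH \<open>- n \<noteq> 0\<close>] bn using n by (simp add: mult_nonneg_nonpos)
qed

text \<open>The intermediate state of the splitting is the front state with its magnetic field reversed: the Alfven
  speed at the front equals the speed of a switch-off shock.\<close>

lemma expanding_switch_off:
  assumes v: "0 < vl" "0 < vr" and b: "b2 \<noteq> 0 \<or> b3 \<noteq> 0" and RH: "RH (mk vl b2 b3 ul w2 w3) (mk vr 0 0 ur z2 z3) (- m)"
    and m: "0 < m" "m\<^sup>2 < csq vr" "m\<^sup>2 * vr < \<beta>\<^sup>2" and a: "a > 0"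
  shows "expanding a (mk vl b2 b3 ul w2 w3) (mk vr 0 0 ur z2 z3)"
proof -
  note R = RH[unfolded RH_mk[OF v]]
  let ?A = "mk vl b2 b3 ul w2 w3"
  let ?W = "mk vl (- b2) (- b3) ul (w2 - 2 * m * vl * b2 / \<beta>) (w3 - 2 * m * vl * b3 / \<beta>)"
  have mv: "m\<^sup>2 * vl = \<beta>\<^sup>2"
  proof -
    have "(m\<^sup>2 * vl) * b = \<beta>\<^sup>2 * b" if "\<beta> * (w - z) = - m * (vr * 0 - vl * b)" "\<beta> * (b - 0) = - m * (z - w)" for b w z
      using that by algebra
    thus ?thesis using R b by (metis mult_right_cancel)
  qed
  have RW: "RH ?A ?W (- m)" unfolding RH_mk[OF v(1,1)]
  proof (intro conjI)
    show "\<beta> * (b2 - - b2) = - m * (w2 - 2 * m * vl * b2 / \<beta> - w2)" "\<beta> * (b3 - - b3) = - m * (w3 - 2 * m * vl * b3 / \<beta> - w3)"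
      using beta mv by (simp_all add: field_simps power2_eq_square)
  qed (use beta in \<open>auto simp: algebra_simps\<close>)
  have m0: "- m \<noteq> 0" using m by simp
  have "\<beta>\<^sup>2 / (- m)\<^sup>2 = vl" using mv m by (simp add: field_simps)
  hence d: "diss ?A ?W (- m) = 0" unfolding diss_mk[OF v(1,1) RW m0] by simp
  show ?thesis
  proof (rule expanding_split[OF _ _ refl v(1) _ _ refl v(2) RW _ RH_diff[OF RW RH] m a])
    show "?A \<noteq> ?W" "?A \<noteq> mk vr 0 0 ur z2 z3" using b v by (auto simp: mk_def)
  qed (use b v d in auto)
qed

text \<open>The shock splits at the volume where its speed is the Alfven speed, into a switch-on and a switch-off shock.\<close>

lemma expanding_super_alfvenic:
  assumes v: "0 < vl" "0 < vr" and RH: "RH (mk vl 0 0 ul w2 w3) (mk vr 0 0 ur z2 z3) (- m)"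
    and ne: "mk vl 0 0 ul w2 w3 \<noteq> mk vr 0 0 ur z2 z3"
    and m: "0 < m" "m\<^sup>2 < csq vr" "m\<^sup>2 * vr < \<beta>\<^sup>2" "\<beta>\<^sup>2 < m\<^sup>2 * vl" and a: "a > 0"
  shows "expanding a (mk vl 0 0 ul w2 w3) (mk vr 0 0 ur z2 z3)"
proof -
  note g = gas_shock[OF v RH ne m(1,2)]
  define x where "x = \<beta>\<^sup>2 / m\<^sup>2"
  have x: "vr < x" "x < vl" "m\<^sup>2 * x = \<beta>\<^sup>2" using m by (auto simp: x_def field_simps)
  have x0: "0 < x" using x v by simp
  define y where "y = sqrt (2 * (m\<^sup>2 * (vl - x) - (p x - p vl)))"
  have h: "0 < m\<^sup>2 * (vl - x) - (p x - p vl)" using chord_p_less[OF v(2) x(1,2) g(4)] by simp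
  have y: "y\<^sup>2 / 2 = m\<^sup>2 * (vl - x) - (p x - p vl)" "y \<noteq> 0" using h by (auto simp: y_def)
  note W = switch_on_wave[OF x0 x(2) m(1) x(3) y(1), of ul w2 w3]
  show ?thesis
  proof (rule expanding_split[OF _ ne refl x0 _ _ refl v(2) W RH_diff[OF W(1) RH] m(1-3) a])
    show "mk vl 0 0 ul w2 w3 \<noteq> mk x y 0 (ul + m * (x - vl)) (w2 + \<beta> * y / m) w3" using x by (auto simp: mk_def)
  qed (use v y in auto)
qed

text \<open>As for rotations, the quadratic form for A is made zero and the one for B is then
  positive. There is no field to rotate, so a small one is switched on in U and V, and the switch-on
  and switch-off costs must stay below the gain per unit of field energy.\<close>

lemma expanding_sub_alfvenic:
  assumes v: "0 < vl" "0 < vr" and RH: "RH (mk vl 0 0 ul w2 w3) (mk vr 0 0 ur z2 z3) (- m)"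
    and ne: "mk vl 0 0 ul w2 w3 \<noteq> mk vr 0 0 ur z2 z3"
    and m: "0 < m" "m\<^sup>2 < csq vr" "m\<^sup>2 * vl < \<beta>\<^sup>2" and a: "a > 0"
  shows "expanding a (mk vl 0 0 ul w2 w3) (mk vr 0 0 ur z2 z3)"
proof -
  define A B where "A = mk vl 0 0 ul w2 w3" and "B = mk vr 0 0 ur z2 z3"
  note g = gas_shock[OF v RH ne m(1,2)]
  have AB: "A \<in> states" "B \<in> states" "A \<noteq> B" using v ne by (auto simp: A_def B_def)
  have mr: "m\<^sup>2 * vr < m\<^sup>2 * vl" using g(5) m by simp
  hence den: "0 < \<beta>\<^sup>2 - m\<^sup>2 * vr" using m by linarith
  \<comment> \<open>The ratio of the fields behind and ahead, forced by \<open>RH_scaled\<close> for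
    the left volume \<open>vl - \<delta>\<close>; its limit lies strictly between 0 and 1.\<close>
  define k where "k \<delta> = (\<beta>\<^sup>2 - m\<^sup>2 * (vl - \<delta>)) / (\<beta>\<^sup>2 - m\<^sup>2 * vr)" for \<delta>
  define k0 where "k0 = (\<beta>\<^sup>2 - m\<^sup>2 * vl) / (\<beta>\<^sup>2 - m\<^sup>2 * vr)"
  have k0: "0 < k0" "k0 < 1"
    using den m(3) mr by (auto simp: k0_def divide_less_eq_1 zero_less_divide_iff)
  have k1: "k \<delta> < 1" "0 < k \<delta>" if "0 < \<delta>" "\<delta> < vl - vr" for \<delta>
  proof -
    have "m\<^sup>2 * vr < m\<^sup>2 * (vl - \<delta>)" "m\<^sup>2 * (vl - \<delta>) < m\<^sup>2 * vl" using that m by auto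
    hence "\<beta>\<^sup>2 - m\<^sup>2 * (vl - \<delta>) < \<beta>\<^sup>2 - m\<^sup>2 * vr" "0 < \<beta>\<^sup>2 - m\<^sup>2 * (vl - \<delta>)" using m(3) by linarith+
    thus "k \<delta> < 1" "0 < k \<delta>" using den unfolding k_def by (simp_all only: divide_less_eq_1_pos zero_less_divide_iff simp_thms)
  qed
  define q where "q \<delta> = p vl - p (vl - \<delta>) + m\<^sup>2 * \<delta>" for \<delta>
  \<comment> \<open>This amplitude lets the jump from \<open>vl - \<delta>\<close> end exactly at
    the volume \<open>vr\<close> with the original speed.\<close>
  define y where "y \<delta> = sqrt (2 * q \<delta> / (1 - (k \<delta>)\<^sup>2))" for \<delta>
  define \<zeta> where "\<zeta> \<delta> = (\<beta> - sqrt (\<beta>\<^sup>2 - m\<^sup>2 * (vl - \<delta>))) / m" for \<delta>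
  define U where "U \<delta> = mk (vl - \<delta>) (y \<delta>) 0 (ul - m * \<delta>) (w2 + \<zeta> \<delta> * y \<delta>) w3" for \<delta>
  define V where "V \<delta> = mk vr (k \<delta> * y \<delta>) 0 ur (w2 + \<zeta> \<delta> * y \<delta> - \<beta> * (1 - k \<delta>) * y \<delta> / m) w3" for \<delta>
  have limp: "((\<lambda>\<delta>. p (vl - \<delta>)) \<longlongrightarrow> p vl) (at_right 0)"
    by (rule isCont_tendsto_compose[OF DERIV_isCont[OF DERIV_p[OF v(1)]]]) (auto intro!: tendsto_eq_intros)
  have limk: "(k \<longlongrightarrow> k0) (at_right 0)"
    unfolding k_def[abs_def] k0_def using den by (auto intro!: tendsto_eq_intros)
  have limq: "(q \<longlongrightarrow> 0) (at_right 0)"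
    unfolding q_def[abs_def] by (rule tendsto_eq_rhs) (auto intro!: tendsto_eq_intros limp)
  have k02: "k0\<^sup>2 < 1" using k0 by (simp add: abs_square_less_1)
  have limy: "(y \<longlongrightarrow> 0) (at_right 0)"
  proof -
    have "((\<lambda>\<delta>. sqrt (2 * q \<delta> / (1 - (k \<delta>)\<^sup>2))) \<longlongrightarrow> sqrt (2 * 0 / (1 - k0\<^sup>2))) (at_right 0)"
      by (intro tendsto_intros limq limk) (use k02 in simp)
    thus ?thesis by (simp add: y_def[abs_def])
  qed
  have limz: "(\<zeta> \<longlongrightarrow> \<zeta> 0) (at_right 0)"
    unfolding \<zeta>_def[abs_def] by (rule tendsto_eq_rhs) (use m in \<open>auto intro!: tendsto_eq_intros\<close>)
  have limU: "(U \<longlongrightarrow> A) (at_right 0)" unfolding U_def[abs_def] A_def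
    by (rule tendsto_eq_rhs[OF tendsto_mk]) (auto intro!: tendsto_eq_intros limy limz)
  have limV: "(V \<longlongrightarrow> B) (at_right 0)" unfolding V_def[abs_def] B_def
    by (rule tendsto_eq_rhs[OF tendsto_mk]) (use m g(1,2) in \<open>auto intro!: tendsto_eq_intros limy limz limk\<close>)
  \<comment> \<open>The limiting gain per unit of field energy; \<open>K\<close> below is the
    limiting dissipation per unit of energy and of \<open>r\<close>.\<close>
  define \<theta> where "\<theta> = a * (m * k0 * (vl - vr))"
  have \<theta>: "0 < \<theta>" using a m k0 g(5) by (auto simp: \<theta>_def intro!: mult_pos_pos)
  define K where "K = a * (\<bar>\<beta>\<bar> / sqrt vr * k0\<^sup>2) + \<bar>\<beta>\<bar> / sqrt vl"
  have K: "0 < K" unfolding K_def using a beta v by (intro add_nonneg_pos) auto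
  \<comment> \<open>Fixed before \<delta>, so that switching the field on and off consumes at most
    half of the gain.\<close>
  define r where "r = min (vr / 2) (\<theta> / (2 * K))"
  have r: "0 < r" "r < vr" "r < vl" "K * r < \<theta>"
  proof -
    show "0 < r" "r < vr" "r < vl" using v \<theta> K g(5) by (auto simp: r_def min_def)
    have "K * r \<le> K * (\<theta> / (2 * K))" using K by (intro mult_left_mono) (auto simp: r_def)
    also have "\<dots> = \<theta> / 2" using K by simp
    finally show "K * r < \<theta>" using \<theta> by simp
  qed
  define c0 where "c0 = (m\<^sup>2 - csq vl) / 2"
  have c0: "0 < c0" using g(6) by (simp add: c0_def)
  have limc: "((\<lambda>\<delta>. csq (vl - \<delta>)) \<longlongrightarrow> csq vl) (at_right 0)"
    by (rule isCont_tendsto_compose[OF DERIV_isCont[OF DERIV_csq[OF v(1)]]]) (auto intro!: tendsto_eq_intros)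
  have "csq vl < m\<^sup>2 - c0" using g(6) by (simp add: c0_def field_simps)
  hence e1: "\<forall>\<^sub>F \<delta> in at_right 0. csq (vl - \<delta>) < m\<^sup>2 - c0" by (rule order_tendstoD(2)[OF limc])
  have e2: "\<forall>\<^sub>F \<delta> in at_right 0. \<delta> \<in> {0<..<vl - vr}" using g(5) by (intro eventually_at_right_real) simp
  have "((\<lambda>\<delta>. gap (vl - \<delta>) r - (y \<delta>)\<^sup>2 / 2) \<longlongrightarrow> gap vl r - 0\<^sup>2 / 2) (at_right 0)"
    by (intro tendsto_intros limy isCont_tendsto_compose[OF isCont_gap[OF r(1,3)]]) (auto intro!: tendsto_eq_intros)
  hence e3: "\<forall>\<^sub>F \<delta> in at_right 0. 0 < gap (vl - \<delta>) r - (y \<delta>)\<^sup>2 / 2"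
    by (rule order_tendstoD(1)) (use gap_pos[OF r(1,3)] in simp)
  have "((\<lambda>\<delta>. gap vr r - (k \<delta> * y \<delta>)\<^sup>2 / 2) \<longlongrightarrow> gap vr r - (k0 * 0)\<^sup>2 / 2) (at_right 0)"
    by (intro tendsto_intros limy limk) auto
  hence e4: "\<forall>\<^sub>F \<delta> in at_right 0. 0 < gap vr r - (k \<delta> * y \<delta>)\<^sup>2 / 2"
    by (rule order_tendstoD(1)) (use gap_pos[OF r(1,2)] in simp)
  have "((\<lambda>\<delta>. diss (U \<delta>) (V \<delta>) (- m)) \<longlongrightarrow> diss A B (- m)) (at_right 0)"
    by (rule tendsto_diss[OF limU limV tendsto_const AB(1,2)])
  hence e5: "\<forall>\<^sub>F \<delta> in at_right 0. 0 < diss (U \<delta>) (V \<delta>) (- m)"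
    by (rule order_tendstoD(1)) (use g(7) in \<open>simp add: A_def B_def\<close>)
  \<comment> \<open>A lower bound for the growth rate divided by the field energy; the term with
    \<open>m ^ 3\<close> bounds the left contribution and vanishes in the limit.\<close>
  define F where "F \<delta> = a * (m * k \<delta> * (vl - \<delta> - vr) - \<bar>\<beta>\<bar> / sqrt vr * (k \<delta>)\<^sup>2 * r)
    - m ^ 3 * \<delta> / (2 * c0) - \<bar>\<beta>\<bar> / sqrt (vl - \<delta>) * r" for \<delta>
  have "(F \<longlongrightarrow> \<theta> - K * r) (at_right 0)" unfolding F_def[abs_def]
    by (rule tendsto_eq_rhs) (use v c0 in \<open>auto intro!: tendsto_eq_intros limk simp: \<theta>_def K_def algebra_simps\<close>)
  hence e6: "\<forall>\<^sub>F \<delta> in at_right 0. 0 < F \<delta>" by (rule order_tendstoD(1)) (use r in simp)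
  have e7: "\<forall>\<^sub>F \<delta> in at_right 0. \<delta> < vl - r"
    by (rule order_tendstoD(2)[OF tendsto_ident_at]) (use r in simp)
  from e1 e2 e3 e4 e5 e6 e7 excess_left[OF limU AB a] excess_right[OF limV AB, of a]
  have "\<forall>\<^sub>F \<delta> in at_right 0. csq (vl - \<delta>) < m\<^sup>2 - c0 \<and> \<delta> \<in> {0<..<vl - vr} \<and> 0 < gap (vl - \<delta>) r - (y \<delta>)\<^sup>2 / 2
      \<and> 0 < gap vr r - (k \<delta> * y \<delta>)\<^sup>2 / 2 \<and> 0 < diss (U \<delta>) (V \<delta>) (- m) \<and> 0 < F \<delta> \<and> \<delta> < vl - r
      \<and> 0 \<le> excess a A B (U \<delta>) \<and> excess a A B (V \<delta>) \<le> 0"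
    by eventually_elim blast
  from eventually_happens'[OF trivial_limit_at_right_real this] obtain \<delta> where \<delta>: "csq (vl - \<delta>) < m\<^sup>2 - c0" "\<delta> \<in> {0<..<vl - vr}" "0 < gap (vl - \<delta>) r - (y \<delta>)\<^sup>2 / 2"
      "0 < gap vr r - (k \<delta> * y \<delta>)\<^sup>2 / 2" "0 < diss (U \<delta>) (V \<delta>) (- m)" "0 < F \<delta>" "\<delta> < vl - r"
      "0 \<le> excess a A B (U \<delta>)" "excess a A B (V \<delta>) \<le> 0"
    by blast
  define x where "x = vl - \<delta>"
  have x: "vr < x" "x < vl" "0 < x" "r < x" "0 < \<delta>" "\<delta> < vl - vr" using \<delta> v by (auto simp: x_def)
  note kk = k1[OF x(5,6)]
  have k2: "(k \<delta>)\<^sup>2 < 1" using kk by (simp add: abs_square_less_1)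
  have q: "c0 * \<delta> \<le> q \<delta>"
  proof -
    have "p x + csq x * (x - vl) < p vl" by (rule tangent_p_less) (use x v in auto)
    moreover have "csq x * \<delta> \<le> (m\<^sup>2 - c0) * \<delta>" using \<delta>(1) x by (intro mult_right_mono) (auto simp: x_def)
    ultimately show ?thesis by (simp add: q_def x_def algebra_simps)
  qed
  have q0: "0 < q \<delta>" using q c0 x(5) mult_pos_pos[of c0 \<delta>] by linarith
  define Y where "Y = (y \<delta>)\<^sup>2 / 2"
  have Y: "Y = q \<delta> / (1 - (k \<delta>)\<^sup>2)"
  proof -
    have "(y \<delta>)\<^sup>2 = 2 * q \<delta> / (1 - (k \<delta>)\<^sup>2)" unfolding y_def using q0 k2 by (intro real_sqrt_pow2 divide_nonneg_pos) auto
    moreover have "2 * x / z / 2 = x / z" for x z :: real by simp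
    ultimately show ?thesis unfolding Y_def by (simp only:)
  qed
  have Yq: "Y * (1 - (k \<delta>)\<^sup>2) = q \<delta>" using k2 by (simp add: Y)
  have Y0: "0 < Y" using q0 k2 by (simp add: Y)
  \<comment> \<open>The field energy is at least proportional to \<delta>, so a term quadratic in
    \<delta> is small compared with it.\<close>
  have Yd: "\<delta> \<le> Y / c0"
  proof -
    have "q \<delta> \<le> Y" using Yq Y0 by (simp add: algebra_simps flip: Yq)
    hence "c0 * \<delta> \<le> Y" using q by linarith
    thus ?thesis using c0 by (simp add: le_divide_eq mult.commute)
  qed
  have y0: "y \<delta> \<noteq> 0" using Y0 by (auto simp: Y_def)
  have m0: "m \<noteq> 0" using m by simp
  have RUV: "RH (U \<delta>) (V \<delta>) (- m)"
  proof -
    have "k \<delta> * (\<beta>\<^sup>2 - m\<^sup>2 * vr) = \<beta>\<^sup>2 - m\<^sup>2 * x" using den by (simp add: k_def x_def)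
    moreover have "p vr + ((y \<delta>)\<^sup>2 + 0\<^sup>2) / 2 * (k \<delta>)\<^sup>2 + m\<^sup>2 * (vr - x) = p x + ((y \<delta>)\<^sup>2 + 0\<^sup>2) / 2"
      using Yq g(4) by (simp add: Y_def[symmetric] q_def x_def[symmetric]) (simp add: x_def algebra_simps)
    ultimately have "RH (mk x (y \<delta>) 0 (ul - m * \<delta>) (w2 + \<zeta> \<delta> * y \<delta>) w3) (mk vr (k \<delta> * y \<delta>) (k \<delta> * 0) (ul - m * \<delta> + m * (vr - x))
      (w2 + \<zeta> \<delta> * y \<delta> - \<beta> * (1 - k \<delta>) * y \<delta> / m) (w3 - \<beta> * (1 - k \<delta>) * 0 / m)) (- m)"
      by (rule RH_scaled[OF x(3) v(2) m0])
    moreover have "ul - m * \<delta> + m * (vr - x) = ur" unfolding g(3) x_def by (simp add: algebra_simps)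
    ultimately show ?thesis by (simp add: U_def V_def x_def)
  qed
  have "sqrt (\<beta>\<^sup>2 - m\<^sup>2 * x) = \<beta> - m * \<zeta> \<delta>" using m0 by (simp add: \<zeta>_def x_def)
  moreover have "m\<^sup>2 * x \<le> \<beta>\<^sup>2"
  proof -
    have "m\<^sup>2 * x \<le> m\<^sup>2 * vl" using x by (intro mult_left_mono) auto
    thus ?thesis using m by linarith
  qed
  ultimately have "(\<beta> - m * \<zeta> \<delta>)\<^sup>2 = \<beta>\<^sup>2 - m\<^sup>2 * x" by (metis real_sqrt_pow2 diff_ge_0_iff_ge)
  hence "m * (m * (\<zeta> \<delta>)\<^sup>2 - 2 * \<beta> * \<zeta> \<delta> + m * x) = 0" by (simp add: power2_eq_square algebra_simps)
  hence \<zeta>: "m * (\<zeta> \<delta>)\<^sup>2 - 2 * \<beta> * \<zeta> \<delta> + m * x = 0" using m0 by simp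
  have L: "qf (U \<delta>) A + m * rel (U \<delta>) A \<le> m ^ 3 * \<delta> * (Y / (2 * c0))"
  proof -
    have "qf (U \<delta>) A + m * rel (U \<delta>) A = - m * \<delta> * (p x - p vl + Y) + m * Pi x vl + m ^ 3 * \<delta>\<^sup>2 / 2
        + Y * (m * (\<zeta> \<delta>)\<^sup>2 - 2 * \<beta> * \<zeta> \<delta> + m * x)"
      unfolding U_def A_def x_def[symmetric] qf_mk[OF x(3) v(1)] rel_mk[OF x(3) v(1)] Y_def
      by (simp add: power2_eq_square power3_eq_cube field_simps)
    also have "\<dots> = - m * \<delta> * (p x - p vl + Y) + m * Pi x vl + m ^ 3 * \<delta>\<^sup>2 / 2" unfolding \<zeta> by simp
    also have "m * Pi x vl \<le> m * ((p x - p vl) / 2 * \<delta>)"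
      using Pi_lt_trapezoid[OF x(3,2)] m by (intro mult_left_mono) (auto simp: x_def)
    also have "- m * \<delta> * (p x - p vl + Y) + m * ((p x - p vl) / 2 * \<delta>) + m ^ 3 * \<delta>\<^sup>2 / 2
        = m ^ 3 * \<delta>\<^sup>2 / 2 - m * \<delta> * ((p x - p vl) / 2 + Y)" by (simp add: field_simps)
    also have "0 \<le> m * \<delta> * ((p x - p vl) / 2 + Y)"
      using p_strict_anti[OF x(3,2)] m x Y0 by (intro mult_nonneg_nonneg) auto
    hence "m ^ 3 * \<delta>\<^sup>2 / 2 - m * \<delta> * ((p x - p vl) / 2 + Y) \<le> m ^ 3 * \<delta>\<^sup>2 / 2" by linarith
    also have "\<dots> = m ^ 3 * \<delta> * (\<delta> / 2)" by (simp add: power2_eq_square)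
    also have "\<dots> \<le> m ^ 3 * \<delta> * (Y / c0 / 2)" using m x Yd by (intro mult_left_mono divide_right_mono) auto
    finally show ?thesis by (simp add: mult.commute)
  qed
  have Rr: "qf (V \<delta>) B + m * rel (V \<delta>) B = Y * (m * k \<delta> * (x - vr))"
  proof -
    define \<xi> where "\<xi> = - \<beta> * (1 - k \<delta>) / m"
    have "k \<delta> * (\<beta>\<^sup>2 - m\<^sup>2 * vr) = \<beta>\<^sup>2 - m\<^sup>2 * x" using den by (simp add: k_def x_def)
    hence \<xi>: "m * \<xi> = - \<beta> * (1 - k \<delta>)" "\<beta> * \<xi> = m * (vr * k \<delta> - x)"
    proof -
      show 1: "m * \<xi> = - \<beta> * (1 - k \<delta>)" using m0 by (simp add: \<xi>_def)
      assume k: "k \<delta> * (\<beta>\<^sup>2 - m\<^sup>2 * vr) = \<beta>\<^sup>2 - m\<^sup>2 * x"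
      have "m * (\<beta> * \<xi>) = m * (m * (vr * k \<delta> - x))" using 1 k by algebra
      thus "\<beta> * \<xi> = m * (vr * k \<delta> - x)" using m0 by simp
    qed
    have X: "\<beta> * (1 - k \<delta>) * y \<delta> / m = - (\<xi> * y \<delta>)" by (simp add: \<xi>_def)
    have w: "w2 + \<zeta> \<delta> * y \<delta> - \<beta> * (1 - k \<delta>) * y \<delta> / m - w2 = (\<zeta> \<delta> + \<xi>) * y \<delta>" unfolding X by (simp add: algebra_simps)
    have e: "- \<beta> * (\<kappa> * z * (\<mu> * z)) + m * ((\<mu> * z)\<^sup>2 / 2 + vr / 2 * (\<kappa> * z)\<^sup>2)
        = z\<^sup>2 / 2 * (m * \<mu>\<^sup>2 - 2 * \<beta> * \<kappa> * \<mu> + m * vr * \<kappa>\<^sup>2)" for \<kappa> \<mu> z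
      by (simp add: power2_eq_square field_simps)
    have "qf (V \<delta>) B + m * rel (V \<delta>) B = Y * (m * (\<zeta> \<delta> + \<xi>)\<^sup>2 - 2 * \<beta> * k \<delta> * (\<zeta> \<delta> + \<xi>) + m * vr * (k \<delta>)\<^sup>2)"
      unfolding V_def B_def qf_mk[OF v(2,2)] rel_mk[OF v(2,2)] Y_def g(1,2) w e[symmetric] by simp
    also have "m * (\<zeta> \<delta> + \<xi>)\<^sup>2 - 2 * \<beta> * k \<delta> * (\<zeta> \<delta> + \<xi>) + m * vr * (k \<delta>)\<^sup>2 = m * k \<delta> * (x - vr)"
      using \<zeta> \<xi> by algebra
    finally show ?thesis .
  qed
  obtain dl where dl: "path A (U \<delta>) dl" "dl \<le> \<bar>\<beta>\<bar> / sqrt x * (((y \<delta>)\<^sup>2 + 0\<^sup>2) / 2) * r"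
    unfolding U_def A_def x_def[symmetric] using path_switch_on[OF r(1) x(4) _ _ v(1), of "y \<delta>" 0] y0 \<delta>(3)
    unfolding x_def[symmetric] by fastforce
  have "((k \<delta> * y \<delta>)\<^sup>2 + 0\<^sup>2) / 2 \<le> gap vr r" "k \<delta> * y \<delta> \<noteq> 0 \<or> (0::real) \<noteq> 0" using \<delta>(4) kk y0 by auto
  from path_switch_off[OF r(1,2) this(2,1) v(2)]
  obtain dr where dr: "path (V \<delta>) B dr" "dr \<le> \<bar>\<beta>\<bar> / sqrt vr * (((k \<delta> * y \<delta>)\<^sup>2 + 0\<^sup>2) / 2) * r"
    unfolding V_def B_def by blast
  have dl': "dl \<le> Y * (\<bar>\<beta>\<bar> / sqrt x * r)" using dl(2) by (simp add: Y_def mult_ac)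
  have dr': "dr \<le> Y * (\<bar>\<beta>\<bar> / sqrt vr * (k \<delta>)\<^sup>2 * r)" using dr(2) by (simp add: Y_def power_mult_distrib mult_ac)
  have "0 < Y * F \<delta>" using Y0 \<delta>(6) by simp
  also have "Y * F \<delta> = a * (Y * (m * k \<delta> * (x - vr)) - Y * (\<bar>\<beta>\<bar> / sqrt vr * (k \<delta>)\<^sup>2 * r))
      - (m ^ 3 * \<delta> * (Y / (2 * c0)) + Y * (\<bar>\<beta>\<bar> / sqrt x * r))"
    unfolding F_def x_def[symmetric] by (simp add: algebra_simps)
  also have "\<dots> \<le> a * (qf (V \<delta>) B + m * rel (V \<delta>) B - dr) - (qf (U \<delta>) A + m * rel (U \<delta>) A + dl)"
  proof -
    have "a * (Y * (m * k \<delta> * (x - vr)) - Y * (\<bar>\<beta>\<bar> / sqrt vr * (k \<delta>)\<^sup>2 * r)) \<le> a * (Y * (m * k \<delta> * (x - vr)) - dr)"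
      using dr' a by (intro mult_left_mono) auto
    thus ?thesis using L dl' unfolding Rr by linarith
  qed
  finally have pos: "0 < a * (qf (V \<delta>) B - dr - (- m) * rel (V \<delta>) B) - (qf (U \<delta>) A + dl - (- m) * rel (U \<delta>) A)"
    by (simp add: algebra_simps)
  show ?thesis unfolding A_def[symmetric] B_def[symmetric] expanding_def
    using dl(1) dr(1) RUV less_imp_le[OF \<delta>(5)] \<delta>(8,9) pos by blast
qed

text \<open>The function \<open>h\<close> is the field energy produced by a switch-on shock to the
  volume \<open>vl - \<delta>\<close>. Completing this with a shock of the old speed raises the
  pressure to be matched by order \<delta>^2, whereas the residual field contributes only order
  \<delta>^3; so the final volume moves by order \<delta>^2.\<close>

lemma alfvenic_volume:
  assumes v: "0 < vr" "vr < vl" and m: "0 < m" "m\<^sup>2 * vl = \<beta>\<^sup>2" "m\<^sup>2 < csq vr" "csq vl < m\<^sup>2"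
    and P: "p vr = p vl + m\<^sup>2 * (vl - vr)"
  defines "h \<equiv> \<lambda>\<delta>. \<beta>\<^sup>2 / (vl - \<delta>) * \<delta> - (p (vl - \<delta>) - p vl)"
  obtains C c c0 \<delta>0 f where "0 < C" "0 < c" "0 < c0" "0 < \<delta>0" "\<delta>0 \<le> 1" "\<delta>0 \<le> vl - vr"
    "\<And>\<delta>. 0 < \<delta> \<Longrightarrow> \<delta> < \<delta>0 \<Longrightarrow> vr - C * \<delta>\<^sup>2 \<le> f \<delta> \<and> vr / 2 \<le> f \<delta> \<and> f \<delta> \<le> vr \<and> c0 * \<delta> \<le> h \<delta> \<and> h \<delta> \<le> \<beta>\<^sup>2 / vr * \<delta>
      \<and> 0 < m\<^sup>2 * \<delta> / (\<beta>\<^sup>2 - m\<^sup>2 * f \<delta>) \<and> m\<^sup>2 * \<delta> / (\<beta>\<^sup>2 - m\<^sup>2 * f \<delta>) \<le> c * \<delta>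
      \<and> p (f \<delta>) + h \<delta> * (m\<^sup>2 * \<delta> / (\<beta>\<^sup>2 - m\<^sup>2 * f \<delta>))\<^sup>2 + m\<^sup>2 * (f \<delta> - (vl - \<delta>)) = p vl + \<beta>\<^sup>2 / (vl - \<delta>) * \<delta>"
proof -
  define \<Theta> where "\<Theta> = \<beta>\<^sup>2 - m\<^sup>2 * vr"
  have \<Theta>: "0 < \<Theta>" unfolding \<Theta>_def m(2)[symmetric] using v m(1) by simp
  define c where "c = m\<^sup>2 / \<Theta>"
  have c: "0 < c" using \<Theta> m(1) by (simp add: c_def)
  \<comment> \<open>Lowering the volume by \<open>C * \<delta>\<^sup>2\<close> gains at least the
    pressure surplus \<open>\<beta>\<^sup>2 * \<delta>\<^sup>2 / (vl * z)\<close>.\<close>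
  define C where "C = \<beta>\<^sup>2 / (vl * vr) / (csq vr - m\<^sup>2)"
  have C: "0 < C" unfolding C_def using v m(3) beta by (intro divide_pos_pos mult_pos_pos) auto
  define c0 where "c0 = (m\<^sup>2 - csq vl) / 2"
  have c0: "0 < c0" using m(4) by (simp add: c0_def)
  have vl: "0 < vl" using v by simp
  have "((\<lambda>\<delta>. csq (vl - \<delta>)) \<longlongrightarrow> csq vl) (at_right 0)"
    by (rule isCont_tendsto_compose[OF DERIV_isCont[OF DERIV_csq[OF vl]]]) (auto intro!: tendsto_eq_intros)
  moreover have "csq vl < m\<^sup>2 - c0" using m(4) by (simp add: c0_def field_simps)
  ultimately have "\<forall>\<^sub>F \<delta> in at_right 0. csq (vl - \<delta>) < m\<^sup>2 - c0" by (rule order_tendstoD(2))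
  then obtain \<delta>1 where \<delta>1: "0 < \<delta>1" "\<And>\<delta>. 0 < \<delta> \<Longrightarrow> \<delta> < \<delta>1 \<Longrightarrow> csq (vl - \<delta>) < m\<^sup>2 - c0"
    by (auto simp: eventually_at_right_field)
  \<comment> \<open>In this order the entries secure the bound on \<open>csq\<close>,
    \<open>\<delta>\<^sup>2 \<le> \<delta>\<close>, a left volume above \<open>vr\<close>, a final
    volume of at least \<open>vr / 2\<close>, and the smallness of the residual magnetic
    pressure.\<close>
  define \<delta>0 where "\<delta>0 = Min {\<delta>1, 1, vl - vr, vr / (2 * C), vr / (vl\<^sup>2 * c\<^sup>2)}"
  have pos: "0 < vr / (2 * C)" "0 < vr / (vl\<^sup>2 * c\<^sup>2)" using v C c by auto
  have \<delta>0: "0 < \<delta>0" "\<delta>0 \<le> \<delta>1" "\<delta>0 \<le> 1" "\<delta>0 \<le> vl - vr" "\<delta>0 \<le> vr / (2 * C)" "\<delta>0 \<le> vr / (vl\<^sup>2 * c\<^sup>2)"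
    using v \<delta>1(1) pos by (auto simp: \<delta>0_def)
  have "\<exists>x. vr - C * \<delta>\<^sup>2 \<le> x \<and> vr / 2 \<le> x \<and> x \<le> vr \<and> c0 * \<delta> \<le> h \<delta> \<and> h \<delta> \<le> \<beta>\<^sup>2 / vr * \<delta>
      \<and> 0 < m\<^sup>2 * \<delta> / (\<beta>\<^sup>2 - m\<^sup>2 * x) \<and> m\<^sup>2 * \<delta> / (\<beta>\<^sup>2 - m\<^sup>2 * x) \<le> c * \<delta>
      \<and> p x + h \<delta> * (m\<^sup>2 * \<delta> / (\<beta>\<^sup>2 - m\<^sup>2 * x))\<^sup>2 + m\<^sup>2 * (x - (vl - \<delta>)) = p vl + \<beta>\<^sup>2 / (vl - \<delta>) * \<delta>"
    if \<delta>: "0 < \<delta>" "\<delta> < \<delta>0" for \<delta>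
  proof -
    define z where "z = vl - \<delta>"
    have z: "vr < z" "z < vl" "0 < z" using \<delta> \<delta>0(4) v by (auto simp: z_def)
    have n: "\<beta>\<^sup>2 / z = m\<^sup>2 + \<beta>\<^sup>2 * \<delta> / (vl * z)"
      using z vl by (simp add: m(2)[symmetric] z_def field_simps)
    have n1: "m\<^sup>2 \<le> \<beta>\<^sup>2 / z" unfolding n using z vl \<delta> by simp
    have h1: "c0 * \<delta> \<le> h \<delta>"
    proof -
      have "p z + csq z * (z - vl) < p vl" by (rule tangent_p_less) (use z vl in auto)
      moreover have "csq z * \<delta> \<le> (m\<^sup>2 - c0) * \<delta>" using \<delta>1(2)[of \<delta>] \<delta> \<delta>0 by (intro mult_right_mono) (auto simp: z_def)
      moreover have "m\<^sup>2 * \<delta> \<le> \<beta>\<^sup>2 / z * \<delta>" using n1 \<delta> by (intro mult_right_mono) auto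
      moreover have "csq z * (z - vl) = - (csq z * \<delta>)" by (simp add: z_def algebra_simps)
      moreover have "(m\<^sup>2 - c0) * \<delta> = m\<^sup>2 * \<delta> - c0 * \<delta>" by (rule left_diff_distrib)
      ultimately show ?thesis unfolding h_def z_def[symmetric] by linarith
    qed
    have h2: "h \<delta> \<le> \<beta>\<^sup>2 / vr * \<delta>"
    proof -
      have "\<beta>\<^sup>2 / z * \<delta> \<le> \<beta>\<^sup>2 / vr * \<delta>" using z v \<delta> by (intro mult_right_mono divide_left_mono) auto
      thus ?thesis unfolding h_def z_def[symmetric] using p_strict_anti[OF z(3,2)] by linarith
    qed
    have h0: "0 < h \<delta>" using h1 mult_pos_pos[OF c0 \<delta>(1)] by linarith
    define k where "k x = m\<^sup>2 * \<delta> / (\<beta>\<^sup>2 - m\<^sup>2 * x)" for x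
    have den: "\<Theta> \<le> \<beta>\<^sup>2 - m\<^sup>2 * x" if "x \<le> vr" for x using that mult_left_mono[OF that, of "m\<^sup>2"] by (simp add: \<Theta>_def)
    have k: "0 < k x" "k x \<le> c * \<delta>" if "x \<le> vr" for x
    proof -
      show "0 < k x" unfolding k_def using den[OF that] \<Theta> m(1) \<delta> by (intro divide_pos_pos mult_pos_pos) auto
      have "k x \<le> m\<^sup>2 * \<delta> / \<Theta>" unfolding k_def using den[OF that] \<Theta> \<delta> by (intro divide_left_mono mult_pos_pos) auto
      thus "k x \<le> c * \<delta>" by (simp add: c_def)
    qed
    define H where "H x = p x + h \<delta> * (k x)\<^sup>2 + m\<^sup>2 * (x - z)" for x
    define e where "e = C * \<delta>\<^sup>2"
    have dd: "\<delta>\<^sup>2 \<le> \<delta>" using \<delta> \<delta>0(3) by (simp add: power2_eq_square mult_left_le)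
    have e: "0 < e" "e \<le> vr / 2"
    proof -
      show "0 < e" using C \<delta> by (simp add: e_def)
      have "C * \<delta>\<^sup>2 \<le> C * (vr / (2 * C))" using C dd \<delta> \<delta>0(5) by (intro mult_left_mono) auto
      thus "e \<le> vr / 2" using C by (simp add: e_def)
    qed
    have T: "p vl + \<beta>\<^sup>2 / z * \<delta> = p vl + m\<^sup>2 * \<delta> + \<beta>\<^sup>2 * \<delta>\<^sup>2 / (vl * z)"
      unfolding n by (simp add: algebra_simps power2_eq_square)
    have Hr: "p vr + m\<^sup>2 * (vr - z) = p vl + m\<^sup>2 * \<delta>" unfolding P z_def by (simp add: algebra_simps)
    have 1: "H vr \<le> p vl + \<beta>\<^sup>2 / z * \<delta>"
    proof -
      have "h \<delta> * (k vr)\<^sup>2 \<le> (\<beta>\<^sup>2 / vr * \<delta>) * (c * \<delta>)\<^sup>2"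
        using h2 h0 k[of vr] by (intro mult_mono power_mono) auto
      also have "\<dots> = \<beta>\<^sup>2 * \<delta>\<^sup>2 * (c\<^sup>2 * \<delta> / vr)" by (simp add: power2_eq_square)
      also have "c\<^sup>2 * \<delta> / vr \<le> 1 / vl\<^sup>2"
      proof -
        have "\<delta> \<le> vr / (vl\<^sup>2 * c\<^sup>2)" using \<delta> \<delta>0(6) by simp
        thus ?thesis using v vl c by (simp add: field_simps)
      qed
      also have "1 / vl\<^sup>2 \<le> 1 / (vl * z)" using z vl by (intro divide_left_mono) (auto simp: power2_eq_square)
      finally have "h \<delta> * (k vr)\<^sup>2 \<le> \<beta>\<^sup>2 * \<delta>\<^sup>2 * (1 / (vl * z))" by (simp add: mult_left_mono)
      moreover have "\<beta>\<^sup>2 * \<delta>\<^sup>2 * (1 / (vl * z)) = \<beta>\<^sup>2 * \<delta>\<^sup>2 / (vl * z)" by simp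
      ultimately show ?thesis unfolding T H_def using Hr by linarith
    qed
    have 2: "p vl + \<beta>\<^sup>2 / z * \<delta> \<le> H (vr - e)"
    proof -
      have "p vr + csq vr * (vr - (vr - e)) \<le> p (vr - e)" by (rule tangent_p) (use v e in auto)
      hence "p vr + csq vr * e \<le> p (vr - e)" by simp
      moreover have "0 \<le> h \<delta> * (k (vr - e))\<^sup>2" using h0 by simp
      moreover have "m\<^sup>2 * (vr - e - z) = m\<^sup>2 * (vr - z) - m\<^sup>2 * e" by (simp add: algebra_simps)
      moreover have "csq vr * e - m\<^sup>2 * e = \<beta>\<^sup>2 * \<delta>\<^sup>2 / (vl * vr)"
      proof -
        have "csq vr - m\<^sup>2 \<noteq> 0" using m(3) by simp
        hence "(csq vr - m\<^sup>2) * (\<beta>\<^sup>2 / (vl * vr) / (csq vr - m\<^sup>2) * \<delta>\<^sup>2) = \<beta>\<^sup>2 / (vl * vr) * \<delta>\<^sup>2" by simp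
        thus ?thesis unfolding e_def C_def by (simp only: left_diff_distrib times_divide_eq_left)
      qed
      moreover have "\<beta>\<^sup>2 * \<delta>\<^sup>2 / (vl * z) \<le> \<beta>\<^sup>2 * \<delta>\<^sup>2 / (vl * vr)" using z v vl by (intro divide_left_mono) auto
      ultimately show ?thesis unfolding T H_def using Hr by linarith
    qed
    have cont: "continuous_on {vr - e..vr} H"
    proof -
      have "\<beta>\<^sup>2 - m\<^sup>2 * x \<noteq> 0" if "x \<in> {vr - e..vr}" for x using den[of x] that \<Theta> by auto
      moreover have "0 < vr - e" using e v by simp
      ultimately show ?thesis unfolding H_def[abs_def] k_def[abs_def]
        by (intro continuous_intros continuous_on_p_Icc) auto
    qed
    obtain x where x: "vr - e \<le> x" "x \<le> vr" "H x = p vl + \<beta>\<^sup>2 / z * \<delta>"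
      using IVT2'[OF 1 2 _ cont] e by auto
    have "vr / 2 \<le> x" using x e by simp
    thus ?thesis using x h1 h2 k[OF x(2)] unfolding H_def k_def e_def z_def by blast
  qed
  hence "\<exists>f. \<forall>\<delta>. 0 < \<delta> \<and> \<delta> < \<delta>0 \<longrightarrow> vr - C * \<delta>\<^sup>2 \<le> f \<delta> \<and> vr / 2 \<le> f \<delta> \<and> f \<delta> \<le> vr \<and> c0 * \<delta> \<le> h \<delta> \<and> h \<delta> \<le> \<beta>\<^sup>2 / vr * \<delta>
      \<and> 0 < m\<^sup>2 * \<delta> / (\<beta>\<^sup>2 - m\<^sup>2 * f \<delta>) \<and> m\<^sup>2 * \<delta> / (\<beta>\<^sup>2 - m\<^sup>2 * f \<delta>) \<le> c * \<delta>
      \<and> p (f \<delta>) + h \<delta> * (m\<^sup>2 * \<delta> / (\<beta>\<^sup>2 - m\<^sup>2 * f \<delta>))\<^sup>2 + m\<^sup>2 * (f \<delta> - (vl - \<delta>)) = p vl + \<beta>\<^sup>2 / (vl - \<delta>) * \<delta>"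
    by (intro choice) blast
  then obtain f where "\<And>\<delta>. 0 < \<delta> \<Longrightarrow> \<delta> < \<delta>0 \<Longrightarrow> vr - C * \<delta>\<^sup>2 \<le> f \<delta> \<and> vr / 2 \<le> f \<delta> \<and> f \<delta> \<le> vr \<and> c0 * \<delta> \<le> h \<delta> \<and> h \<delta> \<le> \<beta>\<^sup>2 / vr * \<delta>
      \<and> 0 < m\<^sup>2 * \<delta> / (\<beta>\<^sup>2 - m\<^sup>2 * f \<delta>) \<and> m\<^sup>2 * \<delta> / (\<beta>\<^sup>2 - m\<^sup>2 * f \<delta>) \<le> c * \<delta>
      \<and> p (f \<delta>) + h \<delta> * (m\<^sup>2 * \<delta> / (\<beta>\<^sup>2 - m\<^sup>2 * f \<delta>))\<^sup>2 + m\<^sup>2 * (f \<delta> - (vl - \<delta>)) = p vl + \<beta>\<^sup>2 / (vl - \<delta>) * \<delta>"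
    by blast
  thus thesis using that[OF C c c0 \<delta>0(1,3,4)] by blast
qed

text \<open>Here splitting degenerates: a switch-on shock from volume vl to \<open>vl - \<delta>\<close> is followed by a shock
  of the original speed, with a gain of order \<open>\<delta>\<^sup>2\<close> against a cost of order \<open>\<delta>\<^sup>3\<close>.\<close>

lemma expanding_alfvenic:
  assumes v: "0 < vl" "0 < vr" and RH: "RH (mk vl 0 0 ul w2 w3) (mk vr 0 0 ur z2 z3) (- m)"
    and ne: "mk vl 0 0 ul w2 w3 \<noteq> mk vr 0 0 ur z2 z3"
    and m: "0 < m" "m\<^sup>2 < csq vr" "m\<^sup>2 * vl = \<beta>\<^sup>2" and a: "a > 0"
  shows "expanding a (mk vl 0 0 ul w2 w3) (mk vr 0 0 ur z2 z3)"
proof -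
  define A B where "A = mk vl 0 0 ul w2 w3" and "B = mk vr 0 0 ur z2 z3"
  note g = gas_shock[OF v RH ne m(1,2)]
  have AB: "A \<in> states" "B \<in> states" "A \<noteq> B" using v ne by (auto simp: A_def B_def)
  define h where "h \<delta> = \<beta>\<^sup>2 / (vl - \<delta>) * \<delta> - (p (vl - \<delta>) - p vl)" for \<delta>
  obtain C c c0 \<delta>0 f where C: "0 < C" "0 < c" "0 < c0" "0 < \<delta>0" "\<delta>0 \<le> 1" "\<delta>0 \<le> vl - vr" and f:
    "\<And>\<delta>. 0 < \<delta> \<Longrightarrow> \<delta> < \<delta>0 \<Longrightarrow> vr - C * \<delta>\<^sup>2 \<le> f \<delta> \<and> vr / 2 \<le> f \<delta> \<and> f \<delta> \<le> vr \<and> c0 * \<delta> \<le> h \<delta> \<and> h \<delta> \<le> \<beta>\<^sup>2 / vr * \<delta>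
      \<and> 0 < m\<^sup>2 * \<delta> / (\<beta>\<^sup>2 - m\<^sup>2 * f \<delta>) \<and> m\<^sup>2 * \<delta> / (\<beta>\<^sup>2 - m\<^sup>2 * f \<delta>) \<le> c * \<delta>
      \<and> p (f \<delta>) + h \<delta> * (m\<^sup>2 * \<delta> / (\<beta>\<^sup>2 - m\<^sup>2 * f \<delta>))\<^sup>2 + m\<^sup>2 * (f \<delta> - (vl - \<delta>)) = p vl + \<beta>\<^sup>2 / (vl - \<delta>) * \<delta>"
    unfolding h_def using alfvenic_volume[OF v(2) g(5) m(1,3,2) g(6,4)] by blast
  define k where "k \<delta> = m\<^sup>2 * \<delta> / (\<beta>\<^sup>2 - m\<^sup>2 * f \<delta>)" for \<delta>
  define n where "n \<delta> = \<bar>\<beta>\<bar> / sqrt (vl - \<delta>)" for \<delta>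
  define y where "y \<delta> = sqrt (2 * h \<delta>)" for \<delta>
  have f1: "vr - C * \<delta>\<^sup>2 \<le> f \<delta>" "vr / 2 \<le> f \<delta>" "f \<delta> \<le> vr" "c0 * \<delta> \<le> h \<delta>" "h \<delta> \<le> \<beta>\<^sup>2 / vr * \<delta>" "0 < k \<delta>" "k \<delta> \<le> c * \<delta>"
      "p (f \<delta>) + h \<delta> * (k \<delta>)\<^sup>2 + m\<^sup>2 * (f \<delta> - (vl - \<delta>)) = p vl + \<beta>\<^sup>2 / (vl - \<delta>) * \<delta>" "0 < f \<delta>" "0 < h \<delta>" "(y \<delta>)\<^sup>2 / 2 = h \<delta>"
    if \<delta>: "0 < \<delta>" "\<delta> < \<delta>0" for \<delta>
  proof -
    note F = f[OF \<delta>, folded k_def]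
    show "vr - C * \<delta>\<^sup>2 \<le> f \<delta>" "vr / 2 \<le> f \<delta>" "f \<delta> \<le> vr" "c0 * \<delta> \<le> h \<delta>" "h \<delta> \<le> \<beta>\<^sup>2 / vr * \<delta>" "0 < k \<delta>" "k \<delta> \<le> c * \<delta>"
      "p (f \<delta>) + h \<delta> * (k \<delta>)\<^sup>2 + m\<^sup>2 * (f \<delta> - (vl - \<delta>)) = p vl + \<beta>\<^sup>2 / (vl - \<delta>) * \<delta>" using F by blast+
    show "0 < f \<delta>" using F v by linarith
    show "0 < h \<delta>" using F mult_pos_pos[OF C(3) \<delta>(1)] by linarith
    thus "(y \<delta>)\<^sup>2 / 2 = h \<delta>" by (simp add: y_def)
  qed
  have ev: "\<forall>\<^sub>F \<delta> in at_right 0. 0 < \<delta> \<and> \<delta> < \<delta>0"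
    using eventually_at_right_real[OF C(4)] by (auto elim: eventually_mono)
  have limf: "(f \<longlongrightarrow> vr) (at_right 0)"
  proof (rule tendsto_sandwich[of "\<lambda>\<delta>. vr - C * \<delta>\<^sup>2" _ _ "\<lambda>_. vr"])
    show "\<forall>\<^sub>F \<delta> in at_right 0. vr - C * \<delta>\<^sup>2 \<le> f \<delta>" "\<forall>\<^sub>F \<delta> in at_right 0. f \<delta> \<le> vr"
      using ev f1(1,3) by (auto elim!: eventually_mono)
  qed (auto intro!: tendsto_eq_intros)
  have limk: "(k \<longlongrightarrow> 0) (at_right 0)"
  proof (rule tendsto_sandwich[of "\<lambda>_. 0" _ _ "\<lambda>\<delta>. c * \<delta>"])
    show "\<forall>\<^sub>F \<delta> in at_right 0. 0 \<le> k \<delta>" "\<forall>\<^sub>F \<delta> in at_right 0. k \<delta> \<le> c * \<delta>"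
      using ev f1(6,7) by (auto elim!: eventually_mono simp: less_imp_le)
  qed (auto intro!: tendsto_eq_intros)
  have limh: "(h \<longlongrightarrow> 0) (at_right 0)"
  proof (rule tendsto_sandwich[of "\<lambda>_. 0" _ _ "\<lambda>\<delta>. \<beta>\<^sup>2 / vr * \<delta>"])
    show "\<forall>\<^sub>F \<delta> in at_right 0. 0 \<le> h \<delta>" "\<forall>\<^sub>F \<delta> in at_right 0. h \<delta> \<le> \<beta>\<^sup>2 / vr * \<delta>"
      using ev f1(10,5) by (auto elim!: eventually_mono simp: less_imp_le)
    show "((\<lambda>\<delta>. \<beta>\<^sup>2 / vr * \<delta>) \<longlongrightarrow> 0) (at_right 0)" by (rule tendsto_mult_right_zero) (rule tendsto_ident_at)
  qed auto
  have limy: "(y \<longlongrightarrow> 0) (at_right 0)"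
  proof -
    have "((\<lambda>\<delta>. sqrt (2 * h \<delta>)) \<longlongrightarrow> sqrt (2 * 0)) (at_right 0)" by (intro tendsto_intros limh)
    thus ?thesis by (simp add: y_def[abs_def])
  qed
  have n0: "\<bar>\<beta>\<bar> / sqrt vl = m"
  proof -
    have "\<bar>\<beta>\<bar> = m * sqrt vl" using arg_cong[OF m(3), of sqrt] m(1) by (simp add: real_sqrt_mult)
    thus ?thesis using v by simp
  qed
  have limn: "(n \<longlongrightarrow> m) (at_right 0)"
  proof -
    have "((\<lambda>\<delta>. \<bar>\<beta>\<bar> / sqrt (vl - \<delta>)) \<longlongrightarrow> \<bar>\<beta>\<bar> / sqrt (vl - 0)) (at_right 0)"
      by (intro tendsto_intros) (use v in simp)
    thus ?thesis by (simp add: n_def[abs_def] n0)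
  qed
  define W where "W \<delta> = mk (vl - \<delta>) (y \<delta>) 0 (ul + n \<delta> * (vl - \<delta> - vl)) (w2 + \<beta> * y \<delta> / n \<delta>) w3" for \<delta>
  define V where "V \<delta> = mk (f \<delta>) (k \<delta> * y \<delta>) (k \<delta> * 0) (ul + n \<delta> * (vl - \<delta> - vl) + m * (f \<delta> - (vl - \<delta>)))
    (w2 + \<beta> * y \<delta> / n \<delta> - \<beta> * (1 - k \<delta>) * y \<delta> / m) (w3 - \<beta> * (1 - k \<delta>) * 0 / m)" for \<delta>
  have limW: "(W \<longlongrightarrow> A) (at_right 0)" unfolding W_def[abs_def] A_def
    by (rule tendsto_eq_rhs[OF tendsto_mk]) (use m in \<open>auto intro!: tendsto_eq_intros limy limn\<close>)
  have limV: "(V \<longlongrightarrow> B) (at_right 0)" unfolding V_def[abs_def] B_def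
    by (rule tendsto_eq_rhs[OF tendsto_mk]) (use m g(1,2,3) in \<open>auto intro!: tendsto_eq_intros limy limn limf limk\<close>)
  have "((\<lambda>\<delta>. diss (W \<delta>) (V \<delta>) (- m)) \<longlongrightarrow> diss A B (- m)) (at_right 0)"
    by (rule tendsto_diss[OF limW limV tendsto_const AB(1,2)])
  hence evd: "\<forall>\<^sub>F \<delta> in at_right 0. 0 < diss (W \<delta>) (V \<delta>) (- m)"
    by (rule order_tendstoD(1)) (use g(7) in \<open>simp add: A_def B_def\<close>)
  \<comment> \<open>W tends to A, so its excess is positive and W always plays the role of
    U.\<close>
  have "((\<lambda>\<delta>. excess a A B (W \<delta>)) \<longlongrightarrow> excess a A B A) (at_right 0)" unfolding excess_def
    by (intro tendsto_intros tendsto_continuous_states[OF continuous_on_rel limW] AB)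
  hence evW: "\<forall>\<^sub>F \<delta> in at_right 0. 0 < excess a A B (W \<delta>)"
    by (rule order_tendstoD(1)) (use rel_pos[OF AB] a in \<open>simp add: excess_def rel_self[OF AB(1)]\<close>)
  \<comment> \<open>The final volume is only known to be at least \<open>vr / 2\<close>, hence the
    smaller radius.\<close>
  define r where "r = vr / 4"
  have r: "0 < r" "r < vr" using v by (auto simp: r_def)
  have "((\<lambda>\<delta>. gap (f \<delta>) r - h \<delta> * (k \<delta>)\<^sup>2) \<longlongrightarrow> gap vr r - 0 * 0\<^sup>2) (at_right 0)"
    by (intro tendsto_intros limk limh isCont_tendsto_compose[OF isCont_gap[OF r] limf])
  hence evg: "\<forall>\<^sub>F \<delta> in at_right 0. 0 < gap (f \<delta>) r - h \<delta> * (k \<delta>)\<^sup>2"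
    by (rule order_tendstoD(1)) (use gap_pos[OF r] in simp)
  define N where "N = \<bar>\<beta>\<bar> / sqrt vr"
  have N: "0 < N" using v beta by (simp add: N_def)
  \<comment> \<open>The squared speeds of the two waves differ by at least a multiple of \<delta>;
    dividing by \<open>2 * N\<close>, a bound for their sum, compares the speeds themselves.\<close>
  define c2 where "c2 = \<beta>\<^sup>2 / vl\<^sup>2 / (2 * N)"
  have c2: "0 < c2" using v beta N by (simp add: c2_def)
  \<comment> \<open>K1, K2 and K3 belong to the normal flux, the tangential flux and the dissipation
    of switching off the residual field.\<close>
  define K1 where "K1 = (\<beta>\<^sup>2 / vr\<^sup>2 + m\<^sup>2 * C) * (\<beta>\<^sup>2 / vr\<^sup>2 / m + m * C)"
  define K2 where "K2 = 2 * (\<beta>\<^sup>2 / vr) * \<beta>\<^sup>2 * c\<^sup>2 / m"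
  define K3 where "K3 = \<bar>\<beta>\<bar> / sqrt (vr / 2) * (\<beta>\<^sup>2 / vr * c\<^sup>2) * r"
  have K1: "0 \<le> K1" unfolding K1_def using m C v by (intro mult_nonneg_nonneg add_nonneg_nonneg) auto
  have bound: "\<exists>d. path (V \<delta>) B d \<and> - (K1 + K2 + K3) * \<delta> ^ 3 \<le> qf (V \<delta>) B - (- m) * rel (V \<delta>) B - d"
      and speed: "c2 * \<delta> \<le> n \<delta> - m" and Wp: "RH A (W \<delta>) (- n \<delta>)" "0 \<le> diss A (W \<delta>) (- n \<delta>)" and WV: "RH (W \<delta>) (V \<delta>) (- m)"
    if \<delta>: "0 < \<delta>" "\<delta> < \<delta>0" and gp: "0 < gap (f \<delta>) r - h \<delta> * (k \<delta>)\<^sup>2" for \<delta>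
  proof -
    note F = f1[OF \<delta>]
    define x where "x = vl - \<delta>"
    have x: "vr < x" "x < vl" "0 < x" using \<delta> C(6) v by (auto simp: x_def)
    have n2: "(n \<delta>)\<^sup>2 * x = \<beta>\<^sup>2" "0 < n \<delta>" "(n \<delta>)\<^sup>2 = \<beta>\<^sup>2 / x"
      using x beta by (auto simp: n_def power_divide x_def[symmetric])
    have y2: "(y \<delta>)\<^sup>2 / 2 = (n \<delta>)\<^sup>2 * (vl - x) - (p x - p vl)" unfolding F(11) n2(3) by (simp add: h_def x_def)
    show "RH A (W \<delta>) (- n \<delta>)" "0 \<le> diss A (W \<delta>) (- n \<delta>)"
      unfolding A_def W_def x_def[symmetric] by (rule switch_on_wave[OF x(3,2) n2(2,1) y2])+
    have dn: "(n \<delta>)\<^sup>2 - m\<^sup>2 = \<beta>\<^sup>2 / (vl * x) * \<delta>"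
    proof -
      have "m\<^sup>2 = \<beta>\<^sup>2 / vl" using m(3) v by (simp add: field_simps)
      thus ?thesis unfolding n2(3) using x v by (simp add: x_def field_simps)
    qed
    have fac: "(n \<delta>)\<^sup>2 - m\<^sup>2 = (n \<delta> - m) * (n \<delta> + m)" by (simp add: power2_eq_square algebra_simps)
    have "0 < (n \<delta> - m) * (n \<delta> + m)" unfolding fac[symmetric] dn using beta v x \<delta> by simp
    hence nm: "m < n \<delta>" using m(1) n2(2) by (simp add: zero_less_mult_iff)
    have nN: "n \<delta> \<le> N" unfolding n_def N_def x_def[symmetric] using x v by (intro divide_left_mono) auto
    show "c2 * \<delta> \<le> n \<delta> - m"
    proof -
      have "\<beta>\<^sup>2 / vl\<^sup>2 \<le> \<beta>\<^sup>2 / (vl * x)" using x v by (intro divide_left_mono) (auto simp: power2_eq_square)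
      hence "\<beta>\<^sup>2 / vl\<^sup>2 * \<delta> \<le> (n \<delta> - m) * (n \<delta> + m)" unfolding fac[symmetric] dn using \<delta> by (intro mult_right_mono) auto
      also have "\<dots> \<le> (n \<delta> - m) * (2 * N)" using nm nN by (intro mult_left_mono) auto
      finally have "\<beta>\<^sup>2 / vl\<^sup>2 * \<delta> / (2 * N) \<le> n \<delta> - m" using N by (subst pos_divide_le_eq) auto
      thus ?thesis by (simp add: c2_def)
    qed
    have up: "\<beta>\<^sup>2 / (vl * x) \<le> \<beta>\<^sup>2 / vr\<^sup>2"
      using x v unfolding power2_eq_square[of vr] by (intro divide_left_mono mult_mono mult_pos_pos) auto
    hence dn1: "(n \<delta>)\<^sup>2 - m\<^sup>2 \<le> \<beta>\<^sup>2 / vr\<^sup>2 * \<delta>" unfolding dn using \<delta> by (intro mult_right_mono) auto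
    have dn2: "n \<delta> - m \<le> \<beta>\<^sup>2 / vr\<^sup>2 / m * \<delta>"
    proof -
      have "(n \<delta> - m) * m \<le> (n \<delta> - m) * (n \<delta> + m)" using nm n2 by (intro mult_left_mono) auto
      hence "(n \<delta> - m) * m \<le> \<beta>\<^sup>2 / vr\<^sup>2 * \<delta>" using dn1 unfolding fac by linarith
      hence "n \<delta> - m \<le> \<beta>\<^sup>2 / vr\<^sup>2 * \<delta> / m" by (subst pos_le_divide_eq[OF m(1)])
      thus ?thesis by simp
    qed
    have m0: "m \<noteq> 0" using m by simp
    have den: "\<beta>\<^sup>2 - m\<^sup>2 * f \<delta> \<noteq> 0" using F(6) by (auto simp: k_def)
    have kk: "k \<delta> * (\<beta>\<^sup>2 - m\<^sup>2 * f \<delta>) = \<beta>\<^sup>2 - m\<^sup>2 * (vl - \<delta>)"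
    proof -
      have "k \<delta> * (\<beta>\<^sup>2 - m\<^sup>2 * f \<delta>) = m\<^sup>2 * \<delta>" using den by (simp add: k_def)
      thus ?thesis using m(3) by (simp add: right_diff_distrib)
    qed
    show "RH (W \<delta>) (V \<delta>) (- m)" unfolding W_def V_def
    proof (rule RH_scaled[OF x(3)[unfolded x_def] F(9) m0 kk])
      have "p vl + \<beta>\<^sup>2 / (vl - \<delta>) * \<delta> = p (vl - \<delta>) + h \<delta>" by (simp add: h_def)
      thus "p (f \<delta>) + ((y \<delta>)\<^sup>2 + 0\<^sup>2) / 2 * (k \<delta>)\<^sup>2 + m\<^sup>2 * (f \<delta> - (vl - \<delta>)) = p (vl - \<delta>) + ((y \<delta>)\<^sup>2 + 0\<^sup>2) / 2"
        using F(8,11) by simp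
    qed
    have hk: "((k \<delta> * y \<delta>)\<^sup>2 + (k \<delta> * 0)\<^sup>2) / 2 = h \<delta> * (k \<delta>)\<^sup>2" by (simp add: power_mult_distrib flip: F(11))
    have kc: "(k \<delta>)\<^sup>2 \<le> c\<^sup>2 * \<delta>\<^sup>2" using F(6,7) power_mono[of "k \<delta>" "c * \<delta>" 2] by (simp add: power_mult_distrib)
    have hkk: "h \<delta> * (k \<delta>)\<^sup>2 \<le> \<beta>\<^sup>2 / vr * c\<^sup>2 * \<delta> ^ 3"
    proof -
      have "h \<delta> * (k \<delta>)\<^sup>2 \<le> (\<beta>\<^sup>2 / vr * \<delta>) * (c\<^sup>2 * \<delta>\<^sup>2)" using F(5,10) kc by (intro mult_mono) auto
      thus ?thesis by (simp add: power2_eq_square power3_eq_cube mult_ac)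
    qed
    have "y \<delta> \<noteq> 0" using F(10,11) by auto
    hence nz: "k \<delta> * y \<delta> \<noteq> 0 \<or> k \<delta> * 0 \<noteq> 0" using F(6) by simp
    have rf: "r < f \<delta>" using F(2) r by (simp add: r_def)
    have g': "((k \<delta> * y \<delta>)\<^sup>2 + (k \<delta> * 0)\<^sup>2) / 2 \<le> gap (f \<delta>) r" using gp unfolding hk by simp
    obtain d where d: "path (V \<delta>) B d" "d \<le> \<bar>\<beta>\<bar> / sqrt (f \<delta>) * (((k \<delta> * y \<delta>)\<^sup>2 + (k \<delta> * 0)\<^sup>2) / 2) * r"
      unfolding V_def B_def using path_switch_off[OF r(1) rf nz g' v(2)] by blast
    have d1: "d \<le> K3 * \<delta> ^ 3"
    proof -
      have "\<bar>\<beta>\<bar> / sqrt (f \<delta>) \<le> \<bar>\<beta>\<bar> / sqrt (vr / 2)" using F(2) v by (intro divide_left_mono) auto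
      hence "\<bar>\<beta>\<bar> / sqrt (f \<delta>) * (h \<delta> * (k \<delta>)\<^sup>2) * r \<le> \<bar>\<beta>\<bar> / sqrt (vr / 2) * (\<beta>\<^sup>2 / vr * c\<^sup>2 * \<delta> ^ 3) * r"
        using hkk F(10) r v by (intro mult_right_mono[OF mult_mono]) auto
      also have "\<dots> = K3 * \<delta> ^ 3" by (simp add: K3_def mult_ac)
      finally show ?thesis using d(2) unfolding hk by linarith
    qed
    define S where "S = ((n \<delta>)\<^sup>2 - m\<^sup>2) * \<delta> + m\<^sup>2 * (vr - f \<delta>)"
    define T where "T = (n \<delta> - m) * \<delta> + m * (vr - f \<delta>)"
    have PP: "p (f \<delta>) + ((k \<delta> * y \<delta>)\<^sup>2 + (k \<delta> * 0)\<^sup>2) / 2 - p vr = S"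
    proof -
      have "p (f \<delta>) + h \<delta> * (k \<delta>)\<^sup>2 + m\<^sup>2 * (f \<delta> - (vl - \<delta>)) = p vl + (n \<delta>)\<^sup>2 * \<delta>" using F(8) unfolding n2(3) x_def .
      thus ?thesis unfolding hk S_def using g(4) by (simp add: algebra_simps)
    qed
    have uu: "ul + n \<delta> * (vl - \<delta> - vl) + m * (f \<delta> - (vl - \<delta>)) - ur = - T"
      unfolding T_def g(3) by (simp add: algebra_simps)
    have d2: "\<delta>\<^sup>2 \<le> 1" using \<delta> C(5) by (intro power_le_one) auto
    have S: "S \<le> (\<beta>\<^sup>2 / vr\<^sup>2 + m\<^sup>2 * C) * \<delta>\<^sup>2"
    proof -
      have "((n \<delta>)\<^sup>2 - m\<^sup>2) * \<delta> \<le> (\<beta>\<^sup>2 / vr\<^sup>2 * \<delta>) * \<delta>" using dn1 \<delta> by (intro mult_right_mono) auto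
      moreover have "m\<^sup>2 * (vr - f \<delta>) \<le> m\<^sup>2 * (C * \<delta>\<^sup>2)" using F(1) by (intro mult_left_mono) auto
      ultimately show ?thesis unfolding S_def by (simp add: power2_eq_square[of \<delta>] distrib_right)
    qed
    have T: "0 \<le> T" "T \<le> (\<beta>\<^sup>2 / vr\<^sup>2 / m + m * C) * \<delta>\<^sup>2"
    proof -
      show "0 \<le> T" unfolding T_def using nm \<delta> m F(3) by simp
      have "(n \<delta> - m) * \<delta> \<le> (\<beta>\<^sup>2 / vr\<^sup>2 / m * \<delta>) * \<delta>" using dn2 \<delta> by (intro mult_right_mono) auto
      moreover have "m * (vr - f \<delta>) \<le> m * (C * \<delta>\<^sup>2)" using F(1) m by (intro mult_left_mono) auto
      ultimately show "T \<le> (\<beta>\<^sup>2 / vr\<^sup>2 / m + m * C) * \<delta>\<^sup>2" unfolding T_def by (simp add: power2_eq_square[of \<delta>] distrib_right)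
    qed
    have ST: "S * T \<le> K1 * \<delta> ^ 3"
    proof -
      have "S * T \<le> ((\<beta>\<^sup>2 / vr\<^sup>2 + m\<^sup>2 * C) * \<delta>\<^sup>2) * ((\<beta>\<^sup>2 / vr\<^sup>2 / m + m * C) * \<delta>\<^sup>2)"
        using S T C m v by (intro mult_mono mult_nonneg_nonneg add_nonneg_nonneg) auto
      also have "\<dots> = K1 * (\<delta> ^ 3 * \<delta>)" by (simp add: K1_def power2_eq_square power3_eq_cube)
      also have "\<dots> \<le> K1 * (\<delta> ^ 3 * 1)" using K1 \<delta> C(5) by (intro mult_left_mono) auto
      finally show ?thesis by simp
    qed
    define X where "X = k \<delta> / m - (n \<delta> - m) / (m * n \<delta>)"
    have w: "w2 + \<beta> * y \<delta> / n \<delta> - \<beta> * (1 - k \<delta>) * y \<delta> / m - w2 = \<beta> * y \<delta> * X"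
    proof -
      have "w2 + \<beta> * Y / \<nu> - \<beta> * (1 - \<kappa>) * Y / m - w2 = \<beta> * Y * (\<kappa> / m - (\<nu> - m) / (m * \<nu>))" if "\<nu> \<noteq> 0" for Y \<nu> \<kappa>
        using that m0 by (simp add: field_simps)
      thus ?thesis unfolding X_def using n2(2) by simp
    qed
    have e: "- \<beta> * (\<kappa> * Y * (\<beta> * Y * Z)) = - (2 * \<beta>\<^sup>2 * (Y\<^sup>2 / 2) * \<kappa> * Z)" for \<kappa> Y Z by (simp add: power2_eq_square)
    have tang: "- K2 * \<delta> ^ 3 \<le> - \<beta> * (k \<delta> * y \<delta> * (\<beta> * y \<delta> * X))"
    proof -
      have "k \<delta> * X \<le> (k \<delta>)\<^sup>2 / m"
      proof -
        have "X \<le> k \<delta> / m" unfolding X_def using nm m(1) n2(2) by simp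
        hence "k \<delta> * X \<le> k \<delta> * (k \<delta> / m)" using F(6) by (intro mult_left_mono) auto
        thus ?thesis by (simp add: power2_eq_square)
      qed
      hence "2 * \<beta>\<^sup>2 * h \<delta> * (k \<delta> * X) \<le> 2 * \<beta>\<^sup>2 * h \<delta> * ((k \<delta>)\<^sup>2 / m)" using F(10) by (intro mult_left_mono) auto
      also have "\<dots> = 2 * \<beta>\<^sup>2 / m * (h \<delta> * (k \<delta>)\<^sup>2)" by simp
      also have "\<dots> \<le> 2 * \<beta>\<^sup>2 / m * (\<beta>\<^sup>2 / vr * c\<^sup>2 * \<delta> ^ 3)" using hkk m(1) by (intro mult_left_mono) auto
      also have "\<dots> = K2 * \<delta> ^ 3" by (simp add: K2_def mult_ac)
      finally show ?thesis unfolding e F(11) by (simp add: mult_ac)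
    qed
    have "qf (V \<delta>) B = S * (- T) - \<beta> * (k \<delta> * y \<delta> * (\<beta> * y \<delta> * X))"
      unfolding V_def B_def qf_mk[OF F(9) v(2)] g(1,2) w uu using PP by simp
    hence "- K1 * \<delta> ^ 3 - K2 * \<delta> ^ 3 \<le> qf (V \<delta>) B" using ST tang by simp
    moreover have "- (K1 + K2 + K3) * \<delta> ^ 3 = - K1 * \<delta> ^ 3 - K2 * \<delta> ^ 3 - K3 * \<delta> ^ 3" by (simp add: algebra_simps)
    moreover have "0 \<le> m * rel (V \<delta>) B" using m rel_nonneg[of "V \<delta>" B] F(9) AB by (simp add: V_def)
    ultimately have "- (K1 + K2 + K3) * \<delta> ^ 3 \<le> qf (V \<delta>) B - (- m) * rel (V \<delta>) B - d" using d1 by simp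
    thus "\<exists>d. path (V \<delta>) B d \<and> - (K1 + K2 + K3) * \<delta> ^ 3 \<le> qf (V \<delta>) B - (- m) * rel (V \<delta>) B - d" using d(1) by blast
  qed
  \<comment> \<open>The switched-on field has amplitude of order the square root of \<delta>, so the
    magnetic part alone makes the relative entropy of W first order; times the speed difference, the
    gain is second order.\<close>
  have gain: "vr * c0 * \<delta> \<le> rel (W \<delta>) A" if \<delta>: "0 < \<delta>" "\<delta> < \<delta>0" for \<delta>
  proof -
    note F = f1[OF \<delta>]
    have x: "vr \<le> vl - \<delta>" "0 < vl - \<delta>" using \<delta> C(6) v by auto
    have "vr * (c0 * \<delta>) \<le> (vl - \<delta>) * h \<delta>" using x F v C \<delta> by (intro mult_mono) auto
    also have "\<dots> = (vl - \<delta>) / 2 * ((y \<delta> - 0)\<^sup>2 + (0 - 0)\<^sup>2)" by (simp add: F(11)[symmetric])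
    also have "\<dots> \<le> rel (W \<delta>) A" unfolding W_def A_def rel_mk[OF x(2) v(1)]
      using Pi_nonneg[OF x(2) v(1)] by simp
    finally show ?thesis by (simp add: mult.assoc)
  qed
  have "((\<lambda>\<delta>. c2 * (vr * c0) - a * (K1 + K2 + K3) * \<delta>) \<longlongrightarrow> c2 * (vr * c0) - a * (K1 + K2 + K3) * 0) (at_right 0)"
    by (intro tendsto_intros)
  hence "\<forall>\<^sub>F \<delta> in at_right 0. 0 < c2 * (vr * c0) - a * (K1 + K2 + K3) * \<delta>"
    by (rule order_tendstoD(1)) (use c2 v C in simp)
  with ev evd evg evW excess_right[OF limV AB, of a]
  have "\<forall>\<^sub>F \<delta> in at_right 0. 0 < \<delta> \<and> \<delta> < \<delta>0 \<and> 0 < diss (W \<delta>) (V \<delta>) (- m) \<and> 0 < gap (f \<delta>) r - h \<delta> * (k \<delta>)\<^sup>2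
      \<and> 0 < excess a A B (W \<delta>) \<and> excess a A B (V \<delta>) \<le> 0 \<and> 0 < c2 * (vr * c0) - a * (K1 + K2 + K3) * \<delta>"
    by eventually_elim blast
  from eventually_happens'[OF trivial_limit_at_right_real this]
  obtain \<delta> where \<delta>: "0 < \<delta>" "\<delta> < \<delta>0" "0 < diss (W \<delta>) (V \<delta>) (- m)" "0 < gap (f \<delta>) r - h \<delta> * (k \<delta>)\<^sup>2"
      "0 < excess a A B (W \<delta>)" "excess a A B (V \<delta>) \<le> 0" "0 < c2 * (vr * c0) - a * (K1 + K2 + K3) * \<delta>" by blast
  obtain d where d: "path (V \<delta>) B d" "- (K1 + K2 + K3) * \<delta> ^ 3 \<le> qf (V \<delta>) B - (- m) * rel (V \<delta>) B - d"
    using bound[OF \<delta>(1,2,4)] by blast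
  have Ws: "W \<delta> \<in> states" using \<delta> C(6) v by (simp add: W_def)
  have "expanding a A B"
  proof (rule expanding_two_waves[OF AB(1,2) Ws Wp[OF \<delta>(1,2,4)] WV[OF \<delta>(1,2,4)] less_imp_le[OF \<delta>(3)] \<delta>(6) d(1) a])
    have "(c2 * \<delta>) * (vr * c0 * \<delta>) \<le> (n \<delta> - m) * rel (W \<delta>) A"
    proof (rule mult_mono[OF speed[OF \<delta>(1,2,4)] gain[OF \<delta>(1,2)]])
      show "0 \<le> n \<delta> - m" using speed[OF \<delta>(1,2,4)] mult_pos_pos[OF c2 \<delta>(1)] by linarith
    qed (use v C \<delta> in auto)
    moreover have "a * (- (K1 + K2 + K3) * \<delta> ^ 3) \<le> a * (qf (V \<delta>) B - (- m) * rel (V \<delta>) B - d)"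
      using d(2) a by (intro mult_left_mono) auto
    moreover have "0 < \<delta>\<^sup>2 * (c2 * (vr * c0) - a * (K1 + K2 + K3) * \<delta>)" using \<delta> by (intro mult_pos_pos) auto
    moreover have "\<delta>\<^sup>2 * (c2 * (vr * c0) - a * (K1 + K2 + K3) * \<delta>) = (c2 * \<delta>) * (vr * c0 * \<delta>) + a * (- (K1 + K2 + K3) * \<delta> ^ 3)"
      by (simp add: power2_eq_square power3_eq_cube algebra_simps)
    ultimately show "0 < (- m - - n \<delta>) * rel (W \<delta>) A + a * (qf (V \<delta>) B - - m * rel (V \<delta>) B - d)" by simp
  qed (use \<delta>(5) in simp)
  thus ?thesis by (simp add: A_def B_def)
qed

subsection \<open>Slow shocks\<close>

text \<open>The slow speed lies below both the sound speed and the Alfven speed. These are the only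
  properties of the eigenvalues that enter.\<close>

lemma alpha_minus:
  assumes "U \<in> states"
  shows "0 \<le> alpha (- 1) \<beta> \<gamma> U" "alpha (- 1) \<beta> \<gamma> U \<le> csq (fst U)" "alpha (- 1) \<beta> \<gamma> U * fst U \<le> \<beta>\<^sup>2"
proof -
  define v where "v = fst U"
  have v: "0 < v" using assms by (auto simp: states_def v_def)
  define c where "c = csq v"
  define t where "t = \<beta>\<^sup>2 / v"
  define B where "B = ((B2 U)\<^sup>2 + (B3 U)\<^sup>2) / v"
  have c: "c > 0" using csq_pos[OF v] by (simp add: c_def)
  have t: "t > 0" using v beta by (simp add: t_def)
  have B: "B \<ge> 0" using v by (simp add: B_def)
  have al: "alpha (- 1) \<beta> \<gamma> U = (B + t + c - sqrt ((B + t + c)\<^sup>2 - 4 * t * c)) / 2"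
    by (simp add: alpha_def Let_def sound2_eq[OF v] flip: v_def c_def)
      (simp add: B_def t_def add_divide_distrib)
  \<comment> \<open>Two ways of completing the square, each bounding the root from below: one yields
    the sound speed bound, the other the Alfven speed bound.\<close>
  have e: "(B + t + c)\<^sup>2 - 4 * t * c = (B + t - c)\<^sup>2 + 4 * B * c" "(B + t + c)\<^sup>2 - 4 * t * c = (B + c - t)\<^sup>2 + 4 * B * t"
    by (simp_all add: power2_eq_square algebra_simps)
  have "sqrt ((B + t + c)\<^sup>2 - 4 * t * c) \<le> sqrt ((B + t + c)\<^sup>2)" using t c by (intro real_sqrt_le_mono) auto
  thus "0 \<le> alpha (- 1) \<beta> \<gamma> U" unfolding al using B t c by simp
  have "B + t - c \<le> sqrt ((B + t + c)\<^sup>2 - 4 * t * c)" unfolding e(1) by (rule real_le_rsqrt) (use B c in simp)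
  thus "alpha (- 1) \<beta> \<gamma> U \<le> csq (fst U)" unfolding al c_def[symmetric] v_def[symmetric] by simp
  have "B + c - t \<le> sqrt ((B + t + c)\<^sup>2 - 4 * t * c)" unfolding e(2) by (rule real_le_rsqrt) (use B t in simp)
  hence "alpha (- 1) \<beta> \<gamma> U \<le> t" unfolding al by simp
  thus "alpha (- 1) \<beta> \<gamma> U * fst U \<le> \<beta>\<^sup>2" using v by (simp add: t_def le_divide_eq v_def)
qed

lemma slow_speed:
  assumes U: "U \<in> states" and s: "0 \<le> s" "s < sqrt (alpha (- 1) \<beta> \<gamma> U)"
  shows "s\<^sup>2 < csq (fst U)" "s\<^sup>2 * fst U < \<beta>\<^sup>2"
proof -
  have "s\<^sup>2 < (sqrt (alpha (- 1) \<beta> \<gamma> U))\<^sup>2" using s by (intro power_strict_mono) auto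
  hence 1: "s\<^sup>2 < alpha (- 1) \<beta> \<gamma> U" using alpha_minus(1)[OF U] by simp
  thus "s\<^sup>2 < csq (fst U)" using alpha_minus(2)[OF U] by simp
  have "s\<^sup>2 * fst U < alpha (- 1) \<beta> \<gamma> U * fst U" using 1 U by (intro mult_strict_right_mono) (auto simp: states_def)
  thus "s\<^sup>2 * fst U < \<beta>\<^sup>2" using alpha_minus(3)[OF U] by simp
qed

text \<open>A slow shock can only rescale the tangential field. The sign conditions leave a ratio in
  [0, 1) or no field at all; the ratio 0 is the switch-off shock, and without field the front state
  is compared with the Alfven speed.\<close>

lemma expanding_slow_shock:
  assumes AB: "A \<in> states" "B \<in> states" "A \<noteq> B" and RH: "RH A B (- m)" and d: "0 \<le> diss A B (- m)"
    and m: "0 < m" "m\<^sup>2 < csq (fst B)" "m\<^sup>2 * fst B < \<beta>\<^sup>2" and a: "a > 0"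
    and sgn2: "(B2 A > B2 B \<and> B2 B \<ge> 0) \<or> (B2 A < B2 B \<and> B2 B \<le> 0) \<or> (B2 A = 0 \<and> B2 B = 0)"
    and sgn3: "(B3 A > B3 B \<and> B3 B \<ge> 0) \<or> (B3 A < B3 B \<and> B3 B \<le> 0) \<or> (B3 A = 0 \<and> B3 B = 0)"
  shows "expanding a A B"
proof -
  obtain vl b2 b3 ul w2 w3 where A: "A = mk vl b2 b3 ul w2 w3" "0 < vl" "B2 A = b2" "B3 A = b3" using mk_cases[OF AB(1)] by metis
  obtain vr c2 c3 ur z2 z3 where B: "B = mk vr c2 c3 ur z2 z3" "0 < vr" "B2 B = c2" "B3 B = c3" using mk_cases[OF AB(2)] by metis
  note RH' = RH[unfolded A(1) B(1)]
  note R = RH'[unfolded RH_mk[OF A(2) B(2)]]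
  note ne = AB(3)[unfolded A(1) B(1)]
  note sg2 = sgn2[unfolded A(3) B(3)] and sg3 = sgn3[unfolded A(4) B(4)]
  have mr: "m\<^sup>2 < csq vr" "m\<^sup>2 * vr < \<beta>\<^sup>2" using m(2,3) by (simp_all add: B(1) mk_def)
  define D where "D = \<beta>\<^sup>2 - m\<^sup>2 * vr"
  have D: "0 < D" using mr by (simp add: D_def)
  \<comment> \<open>Eliminating the tangential velocities; \<open>D > 0\<close> because the shock is
    sub-Alfvenic behind, so the left field determines the right one.\<close>
  have colin: "c * D = b * (\<beta>\<^sup>2 - m\<^sup>2 * vl)"
    if "\<beta> * (w - z) = - m * (vr * c - vl * b)" "\<beta> * (b - c) = - m * (z - w)" for b c w z
  proof -
    have "\<beta> * (\<beta> * (b - c)) = m * (\<beta> * (w - z))" unfolding that(2) by (simp add: algebra_simps)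
    also have "\<dots> = m * (- m * (vr * c - vl * b))" unfolding that(1) ..
    finally show ?thesis by (simp add: D_def power2_eq_square algebra_simps)
  qed
  have cD: "c2 * D = b2 * (\<beta>\<^sup>2 - m\<^sup>2 * vl)" "c3 * D = b3 * (\<beta>\<^sup>2 - m\<^sup>2 * vl)" using R colin[where b = b2 and c = c2 and w = w2 and z = z2] colin[where b = b3 and c = c3 and w = w3 and z = z3] by blast+
  show ?thesis
  proof (cases "b2 \<noteq> 0 \<or> b3 \<noteq> 0")
    case False
    hence b: "b2 = 0" "b3 = 0" by auto
    hence c: "c2 = 0" "c3 = 0" using cD D by auto
    note RH0 = RH'[unfolded b c] and ne0 = ne[unfolded b c]
    consider "\<beta>\<^sup>2 < m\<^sup>2 * vl" | "m\<^sup>2 * vl = \<beta>\<^sup>2" | "m\<^sup>2 * vl < \<beta>\<^sup>2" by linarith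
    thus ?thesis unfolding A(1) B(1) b c
    proof cases
      case 1
      thus "expanding a (mk vl 0 0 ul w2 w3) (mk vr 0 0 ur z2 z3)" by (rule expanding_super_alfvenic[OF A(2) B(2) RH0 ne0 m(1) mr _ a])
    next
      case 2
      thus "expanding a (mk vl 0 0 ul w2 w3) (mk vr 0 0 ur z2 z3)" by (rule expanding_alfvenic[OF A(2) B(2) RH0 ne0 m(1) mr(1) _ a])
    next
      case 3
      thus "expanding a (mk vl 0 0 ul w2 w3) (mk vr 0 0 ur z2 z3)" by (rule expanding_sub_alfvenic[OF A(2) B(2) RH0 ne0 m(1) mr(1) _ a])
    qed
  next
    case True
    define \<rho> where "\<rho> = (\<beta>\<^sup>2 - m\<^sup>2 * vl) / D"
    have c: "c2 = \<rho> * b2" "c3 = \<rho> * b3" using cD D by (auto simp: \<rho>_def field_simps)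
    have ratio: "0 \<le> \<rho> \<and> \<rho> < 1" if "b \<noteq> 0" "(b > \<rho> * b \<and> \<rho> * b \<ge> 0) \<or> (b < \<rho> * b \<and> \<rho> * b \<le> 0) \<or> (b = 0 \<and> \<rho> * b = 0)" for b
      using that by (auto simp: zero_le_mult_iff mult_le_0_iff)
    have \<rho>: "0 \<le> \<rho>" "\<rho> < 1" using True ratio[of b2] ratio[of b3] sg2 sg3 unfolding c by blast+
    \<comment> \<open>A ratio below 1 means compression, and a nonnegative ratio means that the
      shock is not faster than the Alfven speed ahead.\<close>
    have "\<rho> * D = \<beta>\<^sup>2 - m\<^sup>2 * vl" using D by (simp add: \<rho>_def)
    moreover have "\<rho> * D < 1 * D" using \<rho>(2) D by (rule mult_strict_right_mono)
    moreover have "0 \<le> \<rho> * D" using \<rho> D by simp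
    ultimately have "\<beta>\<^sup>2 - m\<^sup>2 * vl < D" "0 \<le> \<beta>\<^sup>2 - m\<^sup>2 * vl" by simp_all
    hence "m\<^sup>2 * vr < m\<^sup>2 * vl" "m\<^sup>2 * vl \<le> \<beta>\<^sup>2" by (simp_all add: D_def)
    hence vv: "vr < vl" "(- m)\<^sup>2 * vl \<le> \<beta>\<^sup>2" using m(1) by auto
    show ?thesis
    proof (cases "\<rho> = 0")
      case True
      hence c0: "c2 = 0" "c3 = 0" using c by auto
      show ?thesis unfolding A(1) B(1) c0
        by (rule expanding_switch_off[OF A(2) B(2) \<open>b2 \<noteq> 0 \<or> b3 \<noteq> 0\<close> RH'[unfolded c0] m(1) mr a])
    next
      case False
      hence "0 < \<rho>" using \<rho> by simp
      moreover have "- m < 0" using m by simp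
      ultimately show ?thesis
        using expanding_rotation[OF A(2) B(2) vv(1) \<open>b2 \<noteq> 0 \<or> b3 \<noteq> 0\<close> _ _ vv(2) A(1) B(1)[unfolded c] RH d a] by blast
    qed
  qed
qed

lemma diss_nonneg: "entropy_flux \<beta> \<gamma> B - entropy_flux \<beta> \<gamma> A \<le> s * (eta \<gamma> B - eta \<gamma> A) \<Longrightarrow> 0 \<le> diss A B s"
  by (simp add: diss_def)

lemma B_mir [simp]: "fst (mir U) = fst U" "B2 (mir U) = B2 U" "B3 (mir U) = B3 U"
  by (cases U; simp)+

lemma mir_eq_iff [simp]: "mir U = mir V \<longleftrightarrow> U = V"
  by (metis mir_mir)

text \<open>The Lax inequalities make the speed negative and slower than the slow speed of the right
  state, which \<open>slow_speed\<close> turns into the two bounds on m^2.\<close>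

lemma three_shock_fails_contraction:
  assumes sh: "shock_wave \<beta> \<gamma> 3 A B s" and a: "a > 0"
    and sgn: "\<forall>C\<in>{B2, B3}. (C A > C B \<and> C B \<ge> 0) \<or> (C A < C B \<and> C B \<le> 0) \<or> (C A = 0 \<and> C B = 0)"
  shows "fails_contraction \<beta> \<gamma> a A B s"
proof -
  have S: "A \<in> states" "B \<in> states" "A \<noteq> B" "RH A B s" and d: "0 \<le> diss A B s"
    and L: "eigenvalue \<beta> \<gamma> 3 B < s" "s < eigenvalue \<beta> \<gamma> 3 A"
    using sh by (auto simp: shock_wave_def lax_condition_def intro: diss_nonneg)
  have e: "eigenvalue \<beta> \<gamma> 3 U = - sqrt (alpha (- 1) \<beta> \<gamma> U)" for U by (simp add: eigenvalue_def numeral_3_eq_3)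
  define m where "m = - s"
  have "s < 0" using L(2) alpha_minus(1)[OF S(1)] unfolding e by (smt (verit) real_sqrt_ge_zero)
  hence m: "0 < m" "m < sqrt (alpha (- 1) \<beta> \<gamma> B)" using L(1) by (auto simp: m_def e)
  have s: "s = - m" by (simp add: m_def)
  have "expanding a A B"
    using expanding_slow_shock[OF S(1-3) S(4)[unfolded s] d[unfolded s] m(1) slow_speed[OF S(2) less_imp_le[OF m(1)] m(2)] a] sgn by simp
  thus ?thesis using a by (rule expanding_fails_contraction)
qed

text \<open>After reflection the left state becomes the state behind a 3-shock, and the Lax
  inequality at the left state supplies the bounds there.\<close>

lemma four_shock_fails_contraction:
  assumes sh: "shock_wave \<beta> \<gamma> 4 A B s" and a: "a > 0"
    and sgn: "\<forall>C\<in>{B2, B3}. (C B > C A \<and> C A \<ge> 0) \<or> (C B < C A \<and> C A \<le> 0) \<or> (C A = 0 \<and> C B = 0)"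
  shows "fails_contraction \<beta> \<gamma> a A B s"
proof -
  have S: "A \<in> states" "B \<in> states" "A \<noteq> B" "RH A B s" and d: "0 \<le> diss A B s"
    and L: "eigenvalue \<beta> \<gamma> 4 B < s" "s < eigenvalue \<beta> \<gamma> 4 A"
    using sh by (auto simp: shock_wave_def lax_condition_def intro: diss_nonneg)
  have e: "eigenvalue \<beta> \<gamma> 4 U = sqrt (alpha (- 1) \<beta> \<gamma> U)" for U by (simp add: eigenvalue_def)
  have s: "0 < s" "s < sqrt (alpha (- 1) \<beta> \<gamma> A)"
    using L alpha_minus(1)[OF S(2)] unfolding e by (smt (verit) real_sqrt_ge_zero)+
  have "expanding (1 / a) (mir B) (mir A)"
  proof (rule expanding_slow_shock[OF _ _ _ RH_mir[OF S(4)] _ s(1)])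
    show "s\<^sup>2 < csq (fst (mir A))" "s\<^sup>2 * fst (mir A) < \<beta>\<^sup>2" using slow_speed[OF S(1) less_imp_le[OF s(1)] s(2)] by simp_all
  qed (use S d a sgn in \<open>auto simp: diss_mir\<close>)
  hence "expanding a A B" using a by (rule expanding_mir)
  thus ?thesis using a by (rule expanding_fails_contraction)
qed

end

theorem theorem3p1:
  fixes \<beta> \<gamma> :: real
  assumes "\<beta> \<noteq> 0" and "\<gamma> > 1"
  shows
    "(\<forall>Ul Ur \<sigma>3. shock_wave \<beta> \<gamma> 3 Ul Ur \<sigma>3
        \<and> (\<forall>B\<in>{B2, B3}. (B Ul > B Ur \<and> B Ur \<ge> 0) \<or> (B Ul < B Ur \<and> B Ur \<le> 0)
                         \<or> (B Ul = 0 \<and> B Ur = 0))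
        \<longrightarrow> (\<forall>a>0. fails_contraction \<beta> \<gamma> a Ul Ur \<sigma>3))
     \<and>
     (\<forall>Ul Ur \<sigma>4. shock_wave \<beta> \<gamma> 4 Ul Ur \<sigma>4
        \<and> (\<forall>B\<in>{B2, B3}. (B Ur > B Ul \<and> B Ul \<ge> 0) \<or> (B Ur < B Ul \<and> B Ul \<le> 0)
                         \<or> (B Ul = 0 \<and> B Ur = 0))
        \<longrightarrow> (\<forall>a>0. fails_contraction \<beta> \<gamma> a Ul Ur \<sigma>4))"
proof -
  interpret planar_mhd \<beta> \<gamma> using assms by unfold_locales
  show ?thesis
    by (rule conjI; intro allI impI; elim conjE)
      ((rule three_shock_fails_contraction; assumption), (rule four_shock_fails_contraction; assumption))
qed

end
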